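(* Let $\Omega\subset X$ be open, let $B(y,R)\subset\Omega$ with $0<R\le R(y)$, and let $k_0\in\mathbb{R}$. If $u$ satisfies the De Giorgi type inequality (with constant $C_{DG}$), then there exists $C>0$ such that $$\operatorname*{ess\,sup}_{B(y,R/2)}u\le k_0+C\left(\frac{1}{\mu(B(y,R))}\int_{B(y,R)}(u-k_0)_+^q\,d\mu\right)^{1/q}.$$ The constant $C=C(\alpha,\beta,C_{PI},Q)$ (for fixed exponents and fixed $C_{DG}$) is independent of the ball $B(y,R)$.
   Context: Setting. $(X,d,\mu)$ is a complete metric space with a Borel regular measure $\mu$ that is doubling: $0<\mu(B(y,2\rho))\le C_d\,\mu(B(y,\rho))<\infty$ for all $y\in X$, $\rho>0$. $Q>0$ is an exponent (depending only on $C_d$; it may be enlarged so that $Q>p$) with $\mu(B(y,\rho))/\mu(B(x,R))\ge C(\rho/R)^Q$ for $0<\rho\le R$, $x\in X$, $y\in B(x,R)$. For $1\le\kappa<\infty$, $X$ supports a weak $(1,\kappa)$-Poincaré inequality if there are $C_{PI}>0$ and $\lambda\ge1$ with $\frac{1}{\mu(B(y,r))}\int_{B(y,r)}|u-u_{B(y,r)}|\,d\mu\le C_{PI}\,r\big(\frac{1}{\mu(B(y,\lambda r))}\int_{B(y,\lambda r)}g_u^\kappa\,d\mu\big)^{1/\kappa}$ for all balls and all $u\in L^1_{loc}(X)$, where $u_B$ is the mean value of $u$ on $B$. It is assumed that $X$ supports a weak $(1,p)$-Poincaré inequality and $1<p<q<p^*=Qp/(Q-p)$; an exponent $1<s<p$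 is fixed for which $X$ also supports a weak $(1,s)$-Poincaré inequality (such $s$ exists). The functions $a,b:X\to\mathbb{R}$ are measurable with $0<\alpha\le a,b\le\beta$. $\Omega\subset X$ is nonempty and open with $\mu(X\setminus\Omega)>0$, and $R(y)=\frac12 d(y,X\setminus\Omega)$ for $y\in\Omega$. $f_+=\max\{f,0\}$. Function spaces. $g_u$ denotes the minimal $q$-weak upper gradient of $u$: the $\mu$-a.e. smallest Borel $g\ge0$ with $|u(x)-u(y)|\le\int_\gamma g\,ds$ for all compact rectifiable paths $\gamma$ joining $x$ to $y$ outside a family of zero $q$-modulus (the integral being $+\infty$ if $u(x)$ or $u(y)$ is infinite). $N^{1,q}_{loc}(\Omega)$ is the set of measurable $u$ on $\Omega$ such that $u$ and $g_u$ are $q$-integrable on bounded subsets. De Giorgi type inequality. $u\in N^{1,q}_{loc}(\Omega)$ satisfies the De Giorgi type inequality with constant $C_{DG}$ if for all $y\in\Omega$, all $0<\rho<R<R(y)$ and all $k\in\mathbb{R}$, with $S_{k,r}=\{x\in B(y,r)\cap\Omega:u(x)>k\}$, $\int_{S_{k,\rho}}(ag_u^p+bg_u^q)\,d\mu\le C_{DG}\big(\frac{1}{(R-\rho)^p}\int_{S_{k,R}}a(u-k)^p\,d\mu+\frac{1}{(R-\rho)^q}\int_{S_{k,R}}b(u-k)^q\,d\mu\big)$. *)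

theory Defs
  imports "HOL-Analysis.Analysis" "HOL-Probability.Essential_Supremum"
begin

text \<open>Powers with real exponent \<open>r > 0\<close> of extended nonnegative reals, with \<open>\<infinity>\<close> raised to \<open>r\<close>
  equal to \<open>\<infinity>\<close>.\<close>

definition epowr :: "ennreal \<Rightarrow> real \<Rightarrow> ennreal" where
  "epowr x r = (if x = top then top else ennreal (enn2real x powr r))"

text \<open>The carrier \<open>X\<close> and the metric \<open>d\<close> are variables (rather than coming from a type class), so that
  one can state that a constant does not depend on the space. A Borel regular (outer) measure is
  represented by its restriction \<open>\<mu>\<close> to a sigma-algebra of measurable sets. This sigma-algebra
  contains the Borel sets, but may be larger (for example, that of all Caratheodory measurable sets).\<close>

locale borel_regular_space = Metric_space X d
  for X :: "'a set" and d :: "'a \<Rightarrow> 'a \<Rightarrow> real" +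
  fixes \<mu> :: "'a measure"
  assumes space_mu: "space \<mu> = X"
    and open_measurable: "\<And>U. openin mtopology U \<Longrightarrow> U \<in> sets \<mu>"
    and borel_regular: "\<And>A. A \<in> sets \<mu> \<Longrightarrow>
      \<exists>B \<in> sigma_sets X {U. openin mtopology U}. A \<subseteq> B \<and> emeasure \<mu> B = emeasure \<mu> A"

context Metric_space
begin

definition borel_on :: "'a set \<Rightarrow> 'a measure" where
  "borel_on A = restrict_space (sigma M {U. openin mtopology U}) A"

text \<open>Length of the restriction of \<open>\<gamma>\<close> to \<open>[0,s]\<close>: supremum over all partitions
  \<open>0 \<le> t 0 \<le> \<dots> \<le> t n \<le> s\<close>.\<close>

definition path_len :: "(real \<Rightarrow> 'a) \<Rightarrow> real \<Rightarrow> ennreal" where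
  "path_len \<gamma> s = (SUP (n, t) \<in> {(n :: nat, t :: nat \<Rightarrow> real).
       (\<forall>i\<le>n. t i \<in> {0..s}) \<and> (\<forall>i<n. t i \<le> t (Suc i))}.
     \<Sum>i<n. ennreal (d (\<gamma> (t i)) (\<gamma> (t (Suc i)))))"

text \<open>Compact rectifiable paths in \<open>A\<close>. Constant paths are left out, as usual: the condition
  defining weak upper gradients would otherwise fail at each point where the function is infinite.\<close>

definition rect_paths :: "'a set \<Rightarrow> (real \<Rightarrow> 'a) set" where
  "rect_paths A = {\<gamma>. pathin (subtopology mtopology A) \<gamma> \<and>
     0 < path_len \<gamma> 1 \<and> path_len \<gamma> 1 < \<infinity>}"

text \<open>Arc length parametrization: the point reached after length \<open>t\<close>. The parameter \<open>\<tau>\<close> need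
  not be unique, but the point is, since \<open>\<gamma>\<close> is constant between two such parameters.\<close>

definition arc_param :: "(real \<Rightarrow> 'a) \<Rightarrow> real \<Rightarrow> 'a" where
  "arc_param \<gamma> t = \<gamma> (SOME \<tau>. \<tau> \<in> {0..1} \<and> path_len \<gamma> \<tau> = ennreal t)"

definition line_integral :: "('a \<Rightarrow> ennreal) \<Rightarrow> (real \<Rightarrow> 'a) \<Rightarrow> ennreal" where
  "line_integral g \<gamma> = (\<integral>\<^sup>+ t \<in> {0..enn2real (path_len \<gamma> 1)}. g (arc_param \<gamma> t) \<partial>lborel)"

definition half_dist :: "'a set \<Rightarrow> 'a \<Rightarrow> real" where
  "half_dist \<Omega> y = (INF z \<in> M - \<Omega>. d y z) / 2"

end

context borel_regular_space
begin

definition modulus :: "real \<Rightarrow> 'a set \<Rightarrow> (real \<Rightarrow> 'a) set \<Rightarrow> ennreal" where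
  "modulus q A \<Gamma> = (INF \<rho> \<in> {\<rho> \<in> borel_measurable (borel_on A). \<forall>\<gamma>\<in>\<Gamma>. 1 \<le> line_integral \<rho> \<gamma>}.
     \<integral>\<^sup>+ x \<in> A. epowr (\<rho> x) q \<partial>\<mu>)"

definition weak_upper_gradient ::
  "real \<Rightarrow> 'a set \<Rightarrow> ('a \<Rightarrow> ereal) \<Rightarrow> ('a \<Rightarrow> ennreal) \<Rightarrow> bool" where
  "weak_upper_gradient q A u g \<longleftrightarrow> g \<in> borel_measurable (borel_on A) \<and>
     (\<exists>\<Gamma> \<subseteq> rect_paths A. modulus q A \<Gamma> = 0 \<and>
       (\<forall>\<gamma> \<in> rect_paths A - \<Gamma>.
         (if \<bar>u (\<gamma> 0)\<bar> = \<infinity> \<or> \<bar>u (\<gamma> 1)\<bar> = \<infinity> then line_integral g \<gamma> = \<infinity>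
          else e2ennreal \<bar>u (\<gamma> 0) - u (\<gamma> 1)\<bar> \<le> line_integral g \<gamma>)))"

definition q_integrable_bdd :: "real \<Rightarrow> 'a set \<Rightarrow> ('a \<Rightarrow> ennreal) \<Rightarrow> bool" where
  "q_integrable_bdd q A f \<longleftrightarrow>
     (\<forall>E \<in> sets \<mu>. E \<subseteq> A \<and> mbounded E \<longrightarrow> (\<integral>\<^sup>+ x \<in> E. epowr (f x) q \<partial>\<mu>) < \<infinity>)"

text \<open>\<open>g\<close> is (a representative of) the minimal \<open>q\<close>-weak upper gradient of \<open>u\<close> on \<open>A\<close>. As usual,
  minimality refers to \<open>q\<close>-integrable competitors. Without this restriction no minimal one exists in
  general: on the real line, if \<open>h\<close> is finite almost everywhere, but has infinite integral over each
  interval, then every positive multiple of \<open>h\<close> is an upper gradient of every real function.\<close>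

definition minimal_weak_ug ::
  "real \<Rightarrow> 'a set \<Rightarrow> ('a \<Rightarrow> ereal) \<Rightarrow> ('a \<Rightarrow> ennreal) \<Rightarrow> bool" where
  "minimal_weak_ug q A u g \<longleftrightarrow> weak_upper_gradient q A u g \<and> q_integrable_bdd q A g \<and>
     (\<forall>g'. weak_upper_gradient q A u g' \<and> q_integrable_bdd q A g' \<longrightarrow>
        (AE x in \<mu>. x \<in> A \<longrightarrow> g x \<le> g' x))"

definition newtonian_loc :: "real \<Rightarrow> 'a set \<Rightarrow> ('a \<Rightarrow> ereal) set" where
  "newtonian_loc q A = {u \<in> borel_measurable (restrict_space \<mu> A).
     q_integrable_bdd q A (\<lambda>x. e2ennreal \<bar>u x\<bar>) \<and> (\<exists>g. minimal_weak_ug q A u g)}"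

definition L1_loc :: "('a \<Rightarrow> ereal) set" where
  "L1_loc = {u \<in> borel_measurable \<mu>.
     \<forall>x\<in>X. \<exists>r>0. (\<integral>\<^sup>+ z \<in> mball x r. e2ennreal \<bar>u z\<bar> \<partial>\<mu>) < \<infinity>}"

definition doubling :: "real \<Rightarrow> bool" where
  "doubling Cd \<longleftrightarrow> (\<forall>y\<in>X. \<forall>\<rho>>0. 0 < emeasure \<mu> (mball y (2 * \<rho>)) \<and>
     emeasure \<mu> (mball y (2 * \<rho>)) \<le> ennreal Cd * emeasure \<mu> (mball y \<rho>) \<and>
     emeasure \<mu> (mball y \<rho>) < \<infinity>)"

definition dimension_exponent :: "real \<Rightarrow> bool" where
  "dimension_exponent Q \<longleftrightarrow> (\<exists>c>0. \<forall>x\<in>X. \<forall>R \<rho>. \<forall>y \<in> mball x R. 0 < \<rho> \<and> \<rho> \<le> R \<longrightarrow>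
     ennreal (c * (\<rho> / R) powr Q) \<le> emeasure \<mu> (mball y \<rho>) / emeasure \<mu> (mball x R))"

definition mean :: "'a set \<Rightarrow> ('a \<Rightarrow> ereal) \<Rightarrow> real" where
  "mean B u = (LINT x:B|\<mu>. real_of_ereal (u x)) / measure \<mu> B"

text \<open>Weak \<open>(1,\<kappa>)\<close>-Poincare inequality. The gradient is the minimal \<open>q\<close>-weak upper gradient for a
  fixed \<open>q\<close>, whatever \<open>\<kappa>\<close> is. If \<open>u\<close> has no locally \<open>q\<close>-integrable weak upper gradient, then there
  is no condition on \<open>u\<close> (which amounts to an infinite right-hand side).\<close>

definition weak_poincare :: "real \<Rightarrow> real \<Rightarrow> real \<Rightarrow> real \<Rightarrow> bool" where
  "weak_poincare q \<kappa> C\<^sub>P\<^sub>I l \<longleftrightarrow> C\<^sub>P\<^sub>I > 0 \<and> l \<ge> 1 \<and>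
     (\<forall>y\<in>X. \<forall>r>0. \<forall>u \<in> L1_loc. \<forall>g. minimal_weak_ug q X u g \<longrightarrow>
       (\<integral>\<^sup>+ x \<in> mball y r. e2ennreal \<bar>u x - ereal (mean (mball y r) u)\<bar> \<partial>\<mu>) / emeasure \<mu> (mball y r)
       \<le> ennreal (C\<^sub>P\<^sub>I * r) *
         epowr ((\<integral>\<^sup>+ x \<in> mball y (l * r). epowr (g x) \<kappa> \<partial>\<mu>) / emeasure \<mu> (mball y (l * r))) (1 / \<kappa>))"

definition superlevel :: "'a set \<Rightarrow> ('a \<Rightarrow> ereal) \<Rightarrow> 'a \<Rightarrow> real \<Rightarrow> real \<Rightarrow> 'a set" where
  "superlevel \<Omega> u y k r = {x \<in> mball y r \<inter> \<Omega>. u x > ereal k}"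

definition de_giorgi ::
  "real \<Rightarrow> real \<Rightarrow> ('a \<Rightarrow> real) \<Rightarrow> ('a \<Rightarrow> real) \<Rightarrow> 'a set \<Rightarrow> real \<Rightarrow> ('a \<Rightarrow> ereal) \<Rightarrow> bool" where
  "de_giorgi p q a b \<Omega> C\<^sub>D\<^sub>G u \<longleftrightarrow> u \<in> newtonian_loc q \<Omega> \<and>
     (\<forall>g. minimal_weak_ug q \<Omega> u g \<longrightarrow>
       (\<forall>y\<in>\<Omega>. \<forall>\<rho> R k. 0 < \<rho> \<and> \<rho> < R \<and> R < half_dist \<Omega> y \<longrightarrow>
         (\<integral>\<^sup>+ x \<in> superlevel \<Omega> u y k \<rho>.
            (ennreal (a x) * epowr (g x) p + ennreal (b x) * epowr (g x) q) \<partial>\<mu>)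
         \<le> ennreal C\<^sub>D\<^sub>G *
           (ennreal (1 / (R - \<rho>) powr p) *
              (\<integral>\<^sup>+ x \<in> superlevel \<Omega> u y k R. ennreal (a x) * epowr (e2ennreal (u x - ereal k)) p \<partial>\<mu>)
            + ennreal (1 / (R - \<rho>) powr q) *
              (\<integral>\<^sup>+ x \<in> superlevel \<Omega> u y k R. ennreal (b x) * epowr (e2ennreal (u x - ereal k)) q \<partial>\<mu>))))"

text \<open>The standing assumptions. The Poincare inequality for the smaller exponent \<open>s\<close> is a
  self-improvement of the one for \<open>p\<close>, hence its constants are not among the parameters.\<close>

definition standing ::
  "real \<Rightarrow> real \<Rightarrow> real \<Rightarrow> real \<Rightarrow> real \<Rightarrow> real \<Rightarrow> real \<Rightarrow> real \<Rightarrow> real \<Rightarrow>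
    ('a \<Rightarrow> real) \<Rightarrow> ('a \<Rightarrow> real) \<Rightarrow> 'a set \<Rightarrow> bool" where
  "standing p q s Q Cd C\<^sub>P\<^sub>I l \<alpha> \<beta> a b \<Omega> \<longleftrightarrow>
     mcomplete \<and> doubling Cd \<and> dimension_exponent Q \<and>
     weak_poincare q p C\<^sub>P\<^sub>I l \<and> (\<exists>C' l'. weak_poincare q s C' l') \<and>
     a \<in> borel_measurable \<mu> \<and> b \<in> borel_measurable \<mu> \<and>
     (\<forall>x\<in>X. \<alpha> \<le> a x \<and> a x \<le> \<beta> \<and> \<alpha> \<le> b x \<and> b x \<le> \<beta>) \<and>
     openin mtopology \<Omega> \<and> \<Omega> \<noteq> {} \<and> emeasure \<mu> (X - \<Omega>) > 0"

text \<open>For an extended real \<open>t\<close>, \<open>e2ennreal t\<close> is the positive part of \<open>t\<close>.\<close>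

definition mean_excess :: "real \<Rightarrow> ('a \<Rightarrow> ereal) \<Rightarrow> real \<Rightarrow> 'a set \<Rightarrow> ennreal" where
  "mean_excess q u k B =
     epowr ((\<integral>\<^sup>+ x \<in> B. epowr (e2ennreal (u x - ereal k)) q \<partial>\<mu>) / emeasure \<mu> B) (1 / q)"

end

end

theory Submission
  imports Defs
begin

text \<open>The proof is a De Giorgi iteration for the quantity
  \<open>Y k r = \<integral>\<^bsub>B(y,r)\<^esub> \<Phi> ((u - k)\<^sub>+ / R)\<close> with \<open>\<Phi> t = t\<^sup>p + t\<^sup>q\<close>. Treating both exponents at once makes the
  estimate homogeneous although the two growth terms scale differently: the De Giorgi inequality
  bounds \<open>\<integral> \<Phi> g\<^sub>u\<close> over a superlevel set by \<open>Y\<close>, and \<open>\<Phi> (\<Lambda> t) \<ge> \<Lambda> \<Phi> t\<close> for \<open>\<Lambda> \<ge> 1\<close> allows us to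
  start the iteration at the height \<open>\<Lambda> M\<close>, where \<open>M\<close> is the \<open>q\<close>-mean of \<open>(u - k\<^sub>0)\<^sub>+\<close> over \<open>B(y,R)\<close>.

  The gain in the iteration comes from doubling and the \<open>(1,p)\<close>-Poincare inequality, without a
  Sobolev embedding: if a truncation \<open>w\<close> of
  \<open>u\<close> at heights \<open>k < h\<close> has averages at most \<open>(h - k) / 2\<close> over balls of radius \<open>r\<close>, then a chain
  of averages over shrinking balls gives the weak type estimate \<open>\<mu> {w = h - k} \<le> C (r / (h - k))\<^sup>\<kappa> \<integral> g\<^sub>w\<^sup>\<kappa>\<close>
  for \<open>\<kappa> = p\<close> and \<open>\<kappa> = q\<close>; doubling permits \<open>r\<close> to be \<open>R\<close> times a positive power of the density of
  \<open>{u > k}\<close>. Summing over dyadic heights \<open>h\<close> turns this into a superlinear recursion for \<open>Y\<close>.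

  To apply the Poincare inequality to \<open>w\<close>, one needs that \<open>w\<close> has a minimal weak upper gradient on
  the whole space. It is obtained by minimizing the energy, the class of weak upper gradients being
  closed under minima and decreasing limits.\<close>

section \<open>Arc length\<close>

context Metric_space
begin

text \<open>The obstacle is the lack of homogeneity: \<open>M / R\<close> may be small or large, and
  the constant must not depend on it. Dividing \<open>u - k\<close> by \<open>R\<close> gives it the
  dimension of a gradient, so that both factors \<open>1 / (R - \<rho>) powr p\<close> and
  \<open>1 / (R - \<rho>) powr q\<close> of the De Giorgi inequality turn into powers of
  \<open>R / e\<close>, where \<open>e\<close> is the gap between the radii. The weak type estimates
  for the two exponents \<kappa> carry the factor \<open>1 / s powr \<kappa>\<close>, where the
  heights differ by \<open>R * s\<close>; multiplied by \<open>s powr \<kappa>\<close> and added,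
  they control \<open>\<Phi> s\<close> times the measure of a superlevel set.

  The exponent \<open>\<theta> = ln 2 / ln Cd\<close> plays the role of a reciprocal dimension.
  Halving a radius costs at most a factor \<open>Cd\<close> in measure, so that a set of density
  \<open>x\<close> fills at most half of a ball whose radius is about
  \<open>x powr \<theta> * R\<close>. The gain of a step is then the factor
  \<open>(Y / (\<Phi> s * \<mu> B(y,R))) powr \<theta>\<close>, and any positive exponent is enough
  for geometric convergence.\<close>

definition variation :: "(real \<Rightarrow> 'a) \<Rightarrow> real \<Rightarrow> real \<Rightarrow> ennreal" where
  "variation \<gamma> a b = (SUP (n, t) \<in> {(n :: nat, t :: nat \<Rightarrow> real).
       (\<forall>i\<le>n. t i \<in> {a..b}) \<and> (\<forall>i<n. t i \<le> t (Suc i))}.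
     \<Sum>i<n. ennreal (d (\<gamma> (t i)) (\<gamma> (t (Suc i)))))"

lemma path_len_eq_variation: "path_len \<gamma> s = variation \<gamma> 0 s"
  by (simp add: path_len_def variation_def)

lemma sum_le_variation:
  assumes "\<And>i. i \<le> n \<Longrightarrow> t i \<in> {a..b}" "\<And>i. i < n \<Longrightarrow> t i \<le> t (Suc i)"
  shows "(\<Sum>i<n. ennreal (d (\<gamma> (t i)) (\<gamma> (t (Suc i))))) \<le> variation \<gamma> a b"
  unfolding variation_def
  by (rule SUP_upper2[where i="(n, t)"]) (use assms in auto)

lemma variation_leI:
  assumes "\<And>n t. (\<And>i. i \<le> n \<Longrightarrow> t i \<in> {a..b}) \<Longrightarrow> (\<And>i. i < n \<Longrightarrow> t i \<le> t (Suc i)) \<Longrightarrow>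
    (\<Sum>i<n. ennreal (d (\<gamma> (t i)) (\<gamma> (t (Suc i))))) \<le> z"
  shows "variation \<gamma> a b \<le> z"
  unfolding variation_def by (rule SUP_least) (use assms in auto)

lemma variation_ge_dist:
  assumes "a \<le> b"
  shows "ennreal (d (\<gamma> a) (\<gamma> b)) \<le> variation \<gamma> a b"
  using sum_le_variation[of 1 "\<lambda>i. if i = 0 then a else b" a b \<gamma>] assms by auto

text \<open>At most one step of a monotone partition straddles \<open>b\<close>, and there the
  triangle inequality goes through \<open>\<gamma> b\<close>. On every other step one of the two
  clamped terms is the original one and the other is at least zero.\<close>

lemma sum_dist_split:
  assumes "\<And>i. i < n \<Longrightarrow> t i \<le> t (Suc i)" and "\<And>i. i \<le> n \<Longrightarrow> \<gamma> (t i) \<in> M" "\<gamma> b \<in> M"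
  shows "(\<Sum>i<n. ennreal (d (\<gamma> (t i)) (\<gamma> (t (Suc i)))))
    \<le> (\<Sum>i<n. ennreal (d (\<gamma> (min (t i) b)) (\<gamma> (min (t (Suc i)) b))))
      + (\<Sum>i<n. ennreal (d (\<gamma> (max (t i) b)) (\<gamma> (max (t (Suc i)) b))))"
  unfolding sum.distrib[symmetric]
proof (rule sum_mono)
  fix i assume i: "i \<in> {..<n}"
  have "d (\<gamma> (t i)) (\<gamma> (t (Suc i))) \<le> d (\<gamma> (min (t i) b)) (\<gamma> (min (t (Suc i)) b)) + d (\<gamma> (max (t i) b)) (\<gamma> (max (t (Suc i)) b))"
    using assms(1)[of i] assms(2)[of i] assms(2)[of "Suc i"] assms(3) i
      triangle[of "\<gamma> (t i)" "\<gamma> b" "\<gamma> (t (Suc i))"]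
    by (auto simp: min_def max_def not_le)
  then show "ennreal (d (\<gamma> (t i)) (\<gamma> (t (Suc i)))) \<le> ennreal (d (\<gamma> (min (t i) b)) (\<gamma> (min (t (Suc i)) b))) + ennreal (d (\<gamma> (max (t i) b)) (\<gamma> (max (t (Suc i)) b)))"
    by (subst ennreal_plus[symmetric]) (auto intro!: ennreal_leI simp del: ennreal_plus)
qed

lemma variation_split_le:
  assumes "a \<le> b" "b \<le> c" "\<And>t. t \<in> {a..c} \<Longrightarrow> \<gamma> t \<in> M"
  shows "variation \<gamma> a c \<le> variation \<gamma> a b + variation \<gamma> b c"
proof (rule variation_leI)
  fix n t assume t: "\<And>i. i \<le> n \<Longrightarrow> t i \<in> {a..c}" "\<And>i. i < n \<Longrightarrow> t i \<le> t (Suc i)"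
  have "(\<Sum>i<n. ennreal (d (\<gamma> (t i)) (\<gamma> (t (Suc i)))))
    \<le> (\<Sum>i<n. ennreal (d (\<gamma> (min (t i) b)) (\<gamma> (min (t (Suc i)) b))))
      + (\<Sum>i<n. ennreal (d (\<gamma> (max (t i) b)) (\<gamma> (max (t (Suc i)) b))))"
    by (rule sum_dist_split) (use t assms in auto)
  also have "\<dots> \<le> variation \<gamma> a b + variation \<gamma> b c"
    by (intro add_mono sum_le_variation)
       (use t assms in \<open>auto simp: min.coboundedI1 max.coboundedI1 intro: min.mono max.mono\<close>)
  finally show "(\<Sum>i<n. ennreal (d (\<gamma> (t i)) (\<gamma> (t (Suc i))))) \<le> variation \<gamma> a b + variation \<gamma> b c" .
qed

lemma variation_split_ge:
  assumes "a \<le> b" "b \<le> c"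
  shows "variation \<gamma> a b + variation \<gamma> b c \<le> variation \<gamma> a c"
proof -
  let ?S = "\<lambda>n t. \<Sum>i<n. ennreal (d (\<gamma> (t i)) (\<gamma> (t (Suc i))))"
  have concat: "?S n t + ?S m t' \<le> variation \<gamma> a c"
    if t: "\<And>i. i \<le> n \<Longrightarrow> t i \<in> {a..b}" "\<And>i. i < n \<Longrightarrow> t i \<le> t (Suc i)"
      and t': "\<And>i. i \<le> m \<Longrightarrow> t' i \<in> {b..c}" "\<And>i. i < m \<Longrightarrow> t' i \<le> t' (Suc i)" for n t m t'
  proof -
    \<comment> \<open>The second partition is appended from index \<open>Suc n\<close> on. The link
      from \<open>t n\<close> to \<open>t' 0\<close> becomes the step with index \<open>n\<close>,
      which can only enlarge the sum.\<close>
    define T where "T i = (if i \<le> n then t i else t' (i - Suc n))" for i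
    have T: "T i \<le> T (Suc i)" if "i < Suc n + m" for i
    proof -
      consider "i < n" | "i = n" | "i > n" by linarith
      then show ?thesis
      proof cases
        case 3
        then show ?thesis using t'(2)[of "i - Suc n"] that by (simp add: T_def Suc_diff_Suc)
      qed (use t t'(1)[of 0] in \<open>auto simp: T_def\<close>, force)
    qed
    have "?S n t = ?S n T" by (rule sum.cong) (auto simp: T_def)
    moreover have "?S m t' = (\<Sum>i<m. ennreal (d (\<gamma> (T (i + Suc n))) (\<gamma> (T (Suc (i + Suc n))))))"
      by (rule sum.cong) (auto simp: T_def)
    moreover have "\<dots> = (\<Sum>i\<in>{Suc n..<m + Suc n}. ennreal (d (\<gamma> (T i)) (\<gamma> (T (Suc i)))))"
      using sum.shift_bounds_nat_ivl[of "\<lambda>i. ennreal (d (\<gamma> (T i)) (\<gamma> (T (Suc i))))" 0 "Suc n" m]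
      by (simp add: atLeast0LessThan)
    moreover have "?S n T + (\<Sum>i\<in>{Suc n..<m + Suc n}. ennreal (d (\<gamma> (T i)) (\<gamma> (T (Suc i))))) \<le> ?S (Suc n + m) T"
      by (subst sum.union_disjoint[symmetric]) (auto intro!: sum_mono2 simp del: sum_ennreal sum.lessThan_Suc)
    moreover have "?S (Suc n + m) T \<le> variation \<gamma> a c"
    proof (rule sum_le_variation)
      fix i assume "i \<le> Suc n + m"
      then show "T i \<in> {a..c}"
        using t(1)[of i] t'(1)[of "i - Suc n"] assms unfolding T_def by (cases "i \<le> n") force+
    qed (use T in auto)
    ultimately show ?thesis by simp
  qed
  let ?P = "\<lambda>a b. {(n :: nat, t :: nat \<Rightarrow> real). (\<forall>i\<le>n. t i \<in> {a..b}) \<and> (\<forall>i<n. t i \<le> t (Suc i))}"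
  have ne: "?P a b \<noteq> {}" "?P b c \<noteq> {}"
    using assms by (force intro!: exI[of _ 0] exI[of _ "\<lambda>_. b"])+
  have "variation \<gamma> a b + (\<lambda>(n, t). ?S n t) nt \<le> variation \<gamma> a c" if "nt \<in> ?P b c" for nt
    unfolding variation_def[of _ a b] ennreal_SUP_add_left[OF ne(1), symmetric]
    by (rule SUP_least) (use that concat in force)
  then show ?thesis
    unfolding variation_def[of _ b c] ennreal_SUP_add_right[OF ne(2)] by (rule SUP_least)
qed

text \<open>A partition of \<open>[0, 1]\<close> into \<open>n\<close> pieces that nearly attains the length, clamped to \<open>[a, b]\<close>,
  bounds the variation there. Since \<open>n\<close> does not depend on \<open>[a, b]\<close>, the length is a continuous function.\<close>

lemma variation_le_oscillation:
  assumes fin: "variation \<gamma> 0 1 < \<infinity>" and "0 < e" and M: "\<And>t. t \<in> {0..1} \<Longrightarrow> \<gamma> t \<in> M"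
  shows "\<exists>n::nat. \<forall>a b \<eta>. 0 \<le> a \<and> a \<le> b \<and> b \<le> 1 \<and> 0 \<le> \<eta> \<and> (\<forall>x\<in>{a..b}. \<forall>y\<in>{a..b}. d (\<gamma> x) (\<gamma> y) \<le> \<eta>)
    \<longrightarrow> variation \<gamma> a b \<le> ennreal (e + real n * \<eta>)"
proof -
  let ?A = "{(n :: nat, t :: nat \<Rightarrow> real). (\<forall>i\<le>n. t i \<in> {0..1}) \<and> (\<forall>i<n. t i \<le> t (Suc i))}"
  have "\<exists>i\<in>?A. variation \<gamma> 0 1 < (\<lambda>(n,t). \<Sum>i<n. ennreal (d (\<gamma> (t i)) (\<gamma> (t (Suc i))))) i + ennreal e"
  proof (rule SUP_approx_ennreal)
    show "?A \<noteq> {}" by (force intro!: exI[of _ 0] exI[of _ "\<lambda>_. 0"])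
    show "variation \<gamma> 0 1 = (SUP i\<in>?A. (\<lambda>(n,t). \<Sum>i<n. ennreal (d (\<gamma> (t i)) (\<gamma> (t (Suc i))))) i)"
      by (simp only: variation_def)
    show "variation \<gamma> 0 1 \<noteq> \<infinity>" using fin by (simp add: less_top)
  qed (rule \<open>0 < e\<close>)
  then obtain n t where t: "\<And>i. i \<le> n \<Longrightarrow> t i \<in> {0..1}" "\<And>i. i < n \<Longrightarrow> t i \<le> t (Suc i)"
    and *: "variation \<gamma> 0 1 \<le> (\<Sum>i<n. ennreal (d (\<gamma> (t i)) (\<gamma> (t (Suc i))))) + ennreal e"
    by (auto intro: less_imp_le)
  show ?thesis
  proof (rule exI[of _ n], safe)
    fix a b \<eta> :: real assume ab: "0 \<le> a" "a \<le> b" "b \<le> 1" "0 \<le> \<eta>" and osc: "\<forall>x\<in>{a..b}. \<forall>y\<in>{a..b}. d (\<gamma> x) (\<gamma> y) \<le> \<eta>"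
    \<comment> \<open>Clamping at \<open>a\<close> and then at \<open>b\<close> cuts the nearly
      optimal partition into three. The outer pieces are bounded by the variation there, the middle
      one by \<open>n\<close> oscillations.\<close>
    define t' where "t' i = max (t i) a" for i
    have t': "\<And>i. i \<le> n \<Longrightarrow> t' i \<in> {a..1}" "\<And>i. i < n \<Longrightarrow> t' i \<le> t' (Suc i)"
      using t ab by (auto simp: t'_def max.coboundedI1 intro: max.mono)
    have "(\<Sum>i<n. ennreal (d (\<gamma> (t i)) (\<gamma> (t (Suc i)))))
      \<le> (\<Sum>i<n. ennreal (d (\<gamma> (min (t i) a)) (\<gamma> (min (t (Suc i)) a)))) +
        (\<Sum>i<n. ennreal (d (\<gamma> (t' i)) (\<gamma> (t' (Suc i)))))"
      unfolding t'_def by (rule sum_dist_split) (use t M ab in auto)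
    also have "(\<Sum>i<n. ennreal (d (\<gamma> (min (t i) a)) (\<gamma> (min (t (Suc i)) a)))) \<le> variation \<gamma> 0 a"
      by (rule sum_le_variation) (use t ab in \<open>auto simp: min.coboundedI1 intro: min.mono\<close>)
    also have "(\<Sum>i<n. ennreal (d (\<gamma> (t' i)) (\<gamma> (t' (Suc i)))))
      \<le> (\<Sum>i<n. ennreal (d (\<gamma> (min (t' i) b)) (\<gamma> (min (t' (Suc i)) b)))) +
        (\<Sum>i<n. ennreal (d (\<gamma> (max (t' i) b)) (\<gamma> (max (t' (Suc i)) b))))"
      by (rule sum_dist_split) (use t' M ab in force)+
    also have "(\<Sum>i<n. ennreal (d (\<gamma> (max (t' i) b)) (\<gamma> (max (t' (Suc i)) b)))) \<le> variation \<gamma> b 1"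
      by (rule sum_le_variation) (use t' ab in \<open>auto simp: max.coboundedI1 intro: max.mono\<close>)
    also have "(\<Sum>i<n. ennreal (d (\<gamma> (min (t' i) b)) (\<gamma> (min (t' (Suc i)) b)))) \<le> (\<Sum>i<n. ennreal \<eta>)"
      by (intro sum_mono ennreal_leI osc[rule_format]) (use t' ab in auto)
    finally have **: "(\<Sum>i<n. ennreal (d (\<gamma> (t i)) (\<gamma> (t (Suc i)))))
       \<le> variation \<gamma> 0 a + ((\<Sum>i<n. ennreal \<eta>) + variation \<gamma> b 1)"
      by (simp del: sum_ennreal sum_constant add: add_mono)
    \<comment> \<open>The outer variations occur on both sides and are finite, so that they
      cancel.\<close>
    have le: "variation \<gamma> 0 a + variation \<gamma> a b + variation \<gamma> b 1 \<le> variation \<gamma> 0 1"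
      using variation_split_ge[of 0 a b \<gamma>] variation_split_ge[of 0 b 1 \<gamma>] ab
      by (meson add_right_mono order_trans)
    also have "\<dots> \<le> variation \<gamma> 0 a + variation \<gamma> b 1 + ((\<Sum>i<n. ennreal \<eta>) + ennreal e)"
      using order_trans[OF * add_right_mono[OF **]] by (simp only: ac_simps)
    finally have "variation \<gamma> 0 a + variation \<gamma> b 1 + variation \<gamma> a b \<le> variation \<gamma> 0 a + variation \<gamma> b 1 + ((\<Sum>i<n. ennreal \<eta>) + ennreal e)"
      by (simp only: ac_simps)
    moreover have "variation \<gamma> 0 a + variation \<gamma> b 1 \<noteq> top"
      using le fin by (auto simp: top_unique)
    ultimately have "variation \<gamma> a b \<le> (\<Sum>i<n. ennreal \<eta>) + ennreal e"
      by (simp add: ennreal_add_left_cancel_le del: sum_ennreal sum_constant)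
    also have "\<dots> = ennreal (e + real n * \<eta>)"
      using ab \<open>0 < e\<close> by (simp add: ennreal_plus[symmetric] ennreal_of_nat_eq_real_of_nat ennreal_mult[symmetric] add.commute del: ennreal_plus)
    finally show "variation \<gamma> a b \<le> ennreal (e + real n * \<eta>)" .
  qed
qed

definition arc_len :: "(real \<Rightarrow> 'a) \<Rightarrow> real \<Rightarrow> real" where
  "arc_len \<gamma> s = enn2real (path_len \<gamma> s)"

lemma rect_paths_mem:
  assumes "\<gamma> \<in> rect_paths A" "t \<in> {0..1}"
  shows "\<gamma> t \<in> A" "\<gamma> t \<in> M"
proof -
  have "pathin (subtopology mtopology A) \<gamma>" using assms by (simp add: rect_paths_def)
  then have "\<gamma> \<in> {0..1} \<rightarrow> topspace (subtopology mtopology A)"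
    unfolding pathin_def using continuous_map_funspace by fastforce
  with assms(2) show "\<gamma> t \<in> A" "\<gamma> t \<in> M" by auto
qed

lemma rect_paths_continuous:
  assumes "\<gamma> \<in> rect_paths A" "s \<in> {0..1}" "0 < e"
  shows "\<exists>\<delta>>0. \<forall>t\<in>{0..1}. \<bar>t - s\<bar> < \<delta> \<longrightarrow> d (\<gamma> s) (\<gamma> t) < e"
proof -
  have "pathin (subtopology mtopology A) \<gamma>" using assms by (simp add: rect_paths_def)
  then have "continuous_map (top_of_set {0..1}) mtopology \<gamma>"
    unfolding pathin_def using continuous_map_into_fulltopology by blast
  then obtain U where "openin (top_of_set {0..1}) U" "s \<in> U" and U: "\<forall>y\<in>U. \<gamma> y \<in> mball (\<gamma> s) e"
    using assms(2,3) unfolding continuous_map_to_metric topspace_euclidean_subtopology by meson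
  then obtain V where V: "open V" "U = {0..1} \<inter> V"
    unfolding openin_open by blast
  then obtain \<delta> where "\<delta> > 0" "\<forall>t. dist t s < \<delta> \<longrightarrow> t \<in> V"
    using \<open>s \<in> U\<close> by (force simp: open_dist)
  then show ?thesis using U V by (intro exI[of _ \<delta>]) (auto simp: dist_real_def)
qed

lemma rect_paths_variation:
  assumes "\<gamma> \<in> rect_paths A" "0 \<le> a" "a \<le> b" "b \<le> 1"
  shows "arc_len \<gamma> a \<le> arc_len \<gamma> b" "variation \<gamma> a b = ennreal (arc_len \<gamma> b - arc_len \<gamma> a)"
proof -
  have fin: "variation \<gamma> 0 1 < \<infinity>" using assms by (simp add: rect_paths_def path_len_eq_variation)
  have *: "variation \<gamma> 0 a + variation \<gamma> a b = variation \<gamma> 0 b"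
    by (intro antisym variation_split_le variation_split_ge) (use assms rect_paths_mem[OF assms(1)] in auto)
  have "variation \<gamma> 0 b \<le> variation \<gamma> 0 1"
    using variation_split_ge[of 0 b 1 \<gamma>] assms by (meson add_increasing2 le_iff_add order_trans zero_le)
  then have b: "variation \<gamma> 0 b < top" using fin by (auto simp: less_top top_unique)
  have a: "variation \<gamma> 0 a < top" using * b by (metis less_top ennreal_add_eq_top)
  have ab: "variation \<gamma> a b < top" using * b by (metis less_top ennreal_add_eq_top)
  have "arc_len \<gamma> b = arc_len \<gamma> a + enn2real (variation \<gamma> a b)"
    unfolding arc_len_def path_len_eq_variation *[symmetric] by (rule enn2real_plus) (use a ab in auto)
  then show "arc_len \<gamma> a \<le> arc_len \<gamma> b" "variation \<gamma> a b = ennreal (arc_len \<gamma> b - arc_len \<gamma> a)"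
    using ab by auto
qed

lemma arc_len_0:
  assumes "\<gamma> \<in> rect_paths A"
  shows "arc_len \<gamma> 0 = 0"
  using rect_paths_variation(2)[OF assms(1), of 0 0] by (simp add: arc_len_def path_len_eq_variation)

lemma path_len_eq_arc_len:
  assumes "\<gamma> \<in> rect_paths A" "s \<in> {0..1}"
  shows "path_len \<gamma> s = ennreal (arc_len \<gamma> s)" "0 \<le> arc_len \<gamma> s"
proof -
  have "arc_len \<gamma> 0 = 0" by (rule arc_len_0[OF assms(1)])
  then show "path_len \<gamma> s = ennreal (arc_len \<gamma> s)" "0 \<le> arc_len \<gamma> s"
    using rect_paths_variation[OF assms(1), of 0 s] assms by (auto simp: path_len_eq_variation)
qed

lemma dist_le_arc_len:
  assumes "\<gamma> \<in> rect_paths A" "a \<in> {0..1}" "b \<in> {0..1}"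
  shows "d (\<gamma> a) (\<gamma> b) \<le> \<bar>arc_len \<gamma> a - arc_len \<gamma> b\<bar>"
proof -
  have *: "d (\<gamma> a) (\<gamma> b) \<le> arc_len \<gamma> b - arc_len \<gamma> a" if "a \<le> b" "a \<in> {0..1}" "b \<in> {0..1}" for a b
    using variation_ge_dist[OF that(1), of \<gamma>] rect_paths_variation[OF assms(1), of a b] that by auto
  show ?thesis using *[of a b] *[of b a] assms commute[of "\<gamma> a" "\<gamma> b"] by (cases "a \<le> b") auto
qed

text \<open>Needed for \<open>arc_len_surj\<close>: by the intermediate value theorem every length
  is attained, so that the choice in \<open>arc_param\<close> is never made from an empty
  set.\<close>

lemma continuous_on_arc_len:
  assumes "\<gamma> \<in> rect_paths A"
  shows "continuous_on {0..1} (arc_len \<gamma>)"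
  unfolding continuous_on_iff
proof (intro ballI allI impI)
  fix s e :: real assume s: "s \<in> {0..1}" and e: "0 < e"
  have "variation \<gamma> 0 1 < \<infinity>" using assms by (simp add: rect_paths_def path_len_eq_variation)
  from variation_le_oscillation[OF this, of "e/3"] rect_paths_mem[OF assms] e
  obtain n :: nat where n: "\<And>a b \<eta>. 0 \<le> a \<Longrightarrow> a \<le> b \<Longrightarrow> b \<le> 1 \<Longrightarrow> 0 \<le> \<eta> \<Longrightarrow> (\<forall>x\<in>{a..b}. \<forall>y\<in>{a..b}. d (\<gamma> x) (\<gamma> y) \<le> \<eta>)
    \<Longrightarrow> variation \<gamma> a b \<le> ennreal (e/3 + real n * \<eta>)" by (metis half_gt_zero zero_less_divide_iff zero_less_numeral)
  \<comment> \<open>This keeps \<open>real n * \<eta>\<close> below \<open>e / 3\<close>, which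
    leaves room beside the \<open>e / 3\<close> of the partition. Asking for
    \<open>\<eta> / 2\<close> near \<open>s\<close> gives \<open>\<eta>\<close> between any two
    points nearby.\<close>
  define \<eta> where "\<eta> = e / (3 * (real n + 1))"
  have \<eta>: "0 < \<eta>" "real n * \<eta> < e/2" using e by (auto simp: \<eta>_def field_simps) (smt (verit) mult_nonneg_nonneg of_nat_0_le_iff)
  obtain \<delta> where "\<delta> > 0" and \<delta>: "\<And>t. t \<in> {0..1} \<Longrightarrow> \<bar>t - s\<bar> < \<delta> \<Longrightarrow> d (\<gamma> s) (\<gamma> t) < \<eta>/2"
    using rect_paths_continuous[OF assms s, of "\<eta>/2"] \<eta> by auto
  show "\<exists>\<delta>>0. \<forall>t\<in>{0..1}. dist t s < \<delta> \<longrightarrow> dist (arc_len \<gamma> t) (arc_len \<gamma> s) < e"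
  proof (intro exI[of _ \<delta>] conjI \<open>\<delta> > 0\<close> ballI impI)
    fix t assume t: "t \<in> {0..1}" "dist t s < \<delta>"
    define a b where "a = min s t" and "b = max s t"
    have "d (\<gamma> x) (\<gamma> y) \<le> \<eta>" if "x \<in> {a..b}" "y \<in> {a..b}" for x y
    proof -
      have x: "x \<in> {0..1}" "\<bar>x - s\<bar> < \<delta>" "y \<in> {0..1}" "\<bar>y - s\<bar> < \<delta>"
        using that s t by (auto simp: a_def b_def dist_real_def min_def max_def split: if_splits)
      then show ?thesis using \<delta>[of x] \<delta>[of y] triangle[of "\<gamma> x" "\<gamma> s" "\<gamma> y"] rect_paths_mem[OF assms] s
        by (auto simp: commute)
    qed
    then have "variation \<gamma> a b \<le> ennreal (e/3 + real n * \<eta>)"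
      using n[of a b \<eta>] s t \<eta> by (auto simp: a_def b_def)
    then have "ennreal (arc_len \<gamma> b - arc_len \<gamma> a) \<le> ennreal (e/3 + real n * \<eta>)"
      using rect_paths_variation(2)[OF assms, of a b] s t by (auto simp: a_def b_def)
    then have le: "arc_len \<gamma> b - arc_len \<gamma> a \<le> e/3 + real n * \<eta>"
      using e \<eta> by (subst (asm) ennreal_le_iff) auto
    show "dist (arc_len \<gamma> t) (arc_len \<gamma> s) < e"
    proof -
      have "arc_len \<gamma> a \<le> arc_len \<gamma> b"
        using rect_paths_variation(1)[OF assms, of a b] s t by (auto simp: a_def b_def)
      moreover have "dist (arc_len \<gamma> t) (arc_len \<gamma> s) = \<bar>arc_len \<gamma> b - arc_len \<gamma> a\<bar>"
        unfolding a_def b_def dist_real_def by (cases "s \<le> t") auto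
      ultimately show ?thesis using le \<eta>(2) e by linarith
    qed
  qed
qed

lemma arc_len_surj:
  assumes "\<gamma> \<in> rect_paths A" "t \<in> {0..arc_len \<gamma> 1}"
  shows "\<exists>\<tau>\<in>{0..1}. arc_len \<gamma> \<tau> = t"
proof -
  have "\<exists>x\<ge>0. x \<le> 1 \<and> arc_len \<gamma> x = t"
    by (rule IVT'[of "arc_len \<gamma>"]) (use arc_len_0[OF assms(1)] continuous_on_arc_len[OF assms(1)] assms in auto)
  then show ?thesis by auto
qed

lemma arc_param_arc_len:
  assumes "\<gamma> \<in> rect_paths A" "\<tau> \<in> {0..1}"
  shows "arc_param \<gamma> (arc_len \<gamma> \<tau>) = \<gamma> \<tau>"
proof -
  let ?P = "\<lambda>\<sigma>. \<sigma> \<in> {0..1} \<and> path_len \<gamma> \<sigma> = ennreal (arc_len \<gamma> \<tau>)"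
  have "?P (SOME \<sigma>. ?P \<sigma>)"
    by (rule someI[of ?P \<tau>], rule conjI[OF assms(2) path_len_eq_arc_len(1)[OF assms]])
  then obtain \<sigma> where \<sigma>: "\<sigma> = (SOME \<sigma>. ?P \<sigma>)" "?P \<sigma>" by blast
  from \<sigma>(2) have "arc_len \<gamma> \<sigma> = arc_len \<gamma> \<tau>"
    using path_len_eq_arc_len(2)[OF assms] by (simp add: arc_len_def[of _ \<sigma>])
  then have "d (\<gamma> \<sigma>) (\<gamma> \<tau>) \<le> 0" using dist_le_arc_len[OF assms(1), of \<sigma> \<tau>] \<sigma> assms by auto
  then have "\<gamma> \<sigma> = \<gamma> \<tau>" using rect_paths_mem(2)[OF assms(1)] \<sigma>(2) assms(2) by (metis antisym nonneg zero)
  then show ?thesis by (simp add: arc_param_def \<sigma>(1))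
qed

lemma arc_len_pos: "\<gamma> \<in> rect_paths A \<Longrightarrow> 0 < arc_len \<gamma> 1"
  unfolding arc_len_def rect_paths_def by (auto simp: enn2real_positive_iff)

lemma arc_param_mem:
  assumes "\<gamma> \<in> rect_paths A" "t \<in> {0..arc_len \<gamma> 1}"
  shows "arc_param \<gamma> t \<in> A" "arc_param \<gamma> t \<in> M"
  using arc_len_surj[OF assms] arc_param_arc_len[OF assms(1)] rect_paths_mem[OF assms(1)] by force+

lemma arc_param_Lipschitz:
  assumes "\<gamma> \<in> rect_paths A" "s \<in> {0..arc_len \<gamma> 1}" "t \<in> {0..arc_len \<gamma> 1}"
  shows "d (arc_param \<gamma> s) (arc_param \<gamma> t) \<le> \<bar>s - t\<bar>"
  using arc_len_surj[OF assms(1,2)] arc_len_surj[OF assms(1,3)] arc_param_arc_len[OF assms(1)] dist_le_arc_len[OF assms(1)]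
  by force

lemma arc_param_endpoints:
  assumes "\<gamma> \<in> rect_paths A"
  shows "arc_param \<gamma> 0 = \<gamma> 0" "arc_param \<gamma> (arc_len \<gamma> 1) = \<gamma> 1"
  using arc_param_arc_len[OF assms, of 0] arc_param_arc_len[OF assms, of 1] arc_len_0[OF assms] by auto

lemma line_integral_eq:
  "line_integral g \<gamma> = (\<integral>\<^sup>+ t \<in> {0..arc_len \<gamma> 1}. g (arc_param \<gamma> t) \<partial>lborel)"
  by (simp add: line_integral_def arc_len_def)

end

text \<open>The Henstock lemma concerns gauge integrals of real functions; a function with finite
  integral is finite almost everywhere and may be replaced by its \<open>enn2real\<close>.
  Measurability is asked only on \<open>{a..b}\<close>, because an arc length parametrization is
  meaningful only on an interval.\<close>

lemma nn_integral_interval_real: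
  fixes g :: "real \<Rightarrow> ennreal"
  assumes [measurable]: "(\<lambda>x. g x * indicator {a..b} x) \<in> borel_measurable lborel"
    and fin: "(\<integral>\<^sup>+x\<in>{a..b}. g x \<partial>lborel) < \<infinity>" and st: "a \<le> s" "t \<le> b"
  shows "(\<lambda>x. enn2real (g x)) integrable_on {s..t}"
    "(\<integral>\<^sup>+x\<in>{s..t}. g x \<partial>lborel) = ennreal (integral {s..t} (\<lambda>x. enn2real (g x)))"
proof -
  have "AE x in lborel. g x * indicator {a..b} x \<noteq> \<infinity>"
    by (rule nn_integral_noteq_infinite) (use fin in \<open>auto simp: less_top\<close>)
  then have AE: "AE x in lborel. g x * indicator {s..t} x = ennreal (enn2real (g x) * indicator {s..t} x)"
    by (rule eventually_mono) (use st in \<open>auto simp: indicator_def less_top split: if_splits\<close>)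
  have "(\<lambda>x. enn2real (g x * indicator {a..b} x) * indicator {s..t} x) \<in> borel_measurable lborel" by measurable
  also have "(\<lambda>x. enn2real (g x * indicator {a..b} x) * indicator {s..t} x) = (\<lambda>x. enn2real (g x) * indicator {s..t} x)"
    using st by (auto simp: indicator_def fun_eq_iff)
  finally have [measurable]: "(\<lambda>x. enn2real (g x) * indicator {s..t} x) \<in> borel_measurable lborel" .
  have eq: "(\<integral>\<^sup>+x\<in>{s..t}. g x \<partial>lborel) = (\<integral>\<^sup>+x. ennreal (enn2real (g x) * indicator {s..t} x) \<partial>lborel)"
    by (rule nn_integral_cong_AE[OF AE])
  have "(\<integral>\<^sup>+x\<in>{s..t}. g x \<partial>lborel) \<le> (\<integral>\<^sup>+x\<in>{a..b}. g x \<partial>lborel)"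
    by (rule nn_integral_mono) (use st in \<open>auto simp: indicator_def\<close>)
  with fin eq have lt: "(\<integral>\<^sup>+x. ennreal (enn2real (g x) * indicator {s..t} x) \<partial>lborel) < \<infinity>" by auto
  have int: "integrable lborel (\<lambda>x. enn2real (g x) * indicator {s..t} x)"
    by (rule integrableI_nonneg[OF _ _ lt]) auto
  then have set: "set_integrable lborel {s..t} (\<lambda>x. enn2real (g x))"
    by (simp add: set_integrable_def mult.commute)
  show "(\<lambda>x. enn2real (g x)) integrable_on {s..t}"
    by (rule set_borel_integral_eq_integral(1)[OF set])
  show "(\<integral>\<^sup>+x\<in>{s..t}. g x \<partial>lborel) = ennreal (integral {s..t} (\<lambda>x. enn2real (g x)))"
    unfolding eq set_borel_integral_eq_integral(2)[OF set, symmetric] set_lebesgue_integral_def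
    by (subst nn_integral_eq_integral[OF int]) (auto simp: mult.commute)
qed

text \<open>By the Henstock lemma, on a fine tagged division both integrals agree with the values at the
  tags up to a small total error, so that the minimum may be taken tag by tag. This avoids
  differentiating \<open>f\<close>.\<close>

lemma dist_le_integral_min:
  fixes f :: "real \<Rightarrow> real" and g\<^sub>1 g\<^sub>2 :: "real \<Rightarrow> ennreal"
  assumes meas: "(\<lambda>x. g\<^sub>1 x * indicator {a..b} x) \<in> borel_measurable lborel" "(\<lambda>x. g\<^sub>2 x * indicator {a..b} x) \<in> borel_measurable lborel"
    and fin: "(\<integral>\<^sup>+x\<in>{a..b}. g\<^sub>1 x \<partial>lborel) < \<infinity>" "(\<integral>\<^sup>+x\<in>{a..b}. g\<^sub>2 x \<partial>lborel) < \<infinity>"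
    and le: "\<And>s t. a \<le> s \<Longrightarrow> s \<le> t \<Longrightarrow> t \<le> b \<Longrightarrow> ennreal \<bar>f s - f t\<bar> \<le> (\<integral>\<^sup>+x\<in>{s..t}. g\<^sub>1 x \<partial>lborel)"
      "\<And>s t. a \<le> s \<Longrightarrow> s \<le> t \<Longrightarrow> t \<le> b \<Longrightarrow> ennreal \<bar>f s - f t\<bar> \<le> (\<integral>\<^sup>+x\<in>{s..t}. g\<^sub>2 x \<partial>lborel)"
    and "a \<le> b"
  shows "ennreal \<bar>f a - f b\<bar> \<le> (\<integral>\<^sup>+x\<in>{a..b}. min (g\<^sub>1 x) (g\<^sub>2 x) \<partial>lborel)"
proof -
  define g\<^sub>3 where "g\<^sub>3 x = min (g\<^sub>1 x) (g\<^sub>2 x)" for x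
  have m3: "(\<lambda>x. g\<^sub>3 x * indicator {a..b} x) \<in> borel_measurable lborel"
  proof -
    have "(\<lambda>x. g\<^sub>3 x * indicator {a..b} x) = (\<lambda>x. min (g\<^sub>1 x * indicator {a..b} x) (g\<^sub>2 x * indicator {a..b} x))"
      by (auto simp: g\<^sub>3_def indicator_def)
    then show ?thesis using meas by simp
  qed
  have fin3: "(\<integral>\<^sup>+x\<in>{a..b}. g\<^sub>3 x \<partial>lborel) < \<infinity>"
    by (rule le_less_trans[OF nn_integral_mono fin(1)]) (auto simp: g\<^sub>3_def indicator_def)
  define h\<^sub>1 h\<^sub>2 h\<^sub>3 where "h\<^sub>1 x = enn2real (g\<^sub>1 x)" and "h\<^sub>2 x = enn2real (g\<^sub>2 x)" and "h\<^sub>3 x = enn2real (g\<^sub>3 x)" for x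
  note I1 = nn_integral_interval_real[OF meas(1) fin(1), folded h\<^sub>1_def]
  note I2 = nn_integral_interval_real[OF meas(2) fin(2), folded h\<^sub>2_def]
  note I3 = nn_integral_interval_real[OF m3 fin3, folded h\<^sub>3_def]
  have nonneg: "0 \<le> h\<^sub>1 x" "0 \<le> h\<^sub>2 x" "0 \<le> h\<^sub>3 x" for x by (auto simp: h\<^sub>1_def h\<^sub>2_def h\<^sub>3_def)
  \<comment> \<open>Equality may fail where one function is \<open>top\<close>, which
    \<open>enn2real\<close> sends to 0. The inequality is the direction used at the tags.\<close>
  have min: "min (h\<^sub>1 x) (h\<^sub>2 x) \<le> h\<^sub>3 x" for x
    unfolding h\<^sub>1_def h\<^sub>2_def h\<^sub>3_def g\<^sub>3_def by (cases "g\<^sub>1 x"; cases "g\<^sub>2 x") (auto simp: min_def ennreal_le_iff2 split: if_splits)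
  have bound: "\<bar>f s - f t\<bar> \<le> integral {s..t} h\<^sub>1" "\<bar>f s - f t\<bar> \<le> integral {s..t} h\<^sub>2"
    if "a \<le> s" "s \<le> t" "t \<le> b" for s t
    using le(1)[OF that] le(2)[OF that] I1[of s t] I2[of s t] that nonneg
    by (auto simp: ennreal_le_iff integral_nonneg)
  have "\<bar>f a - f b\<bar> \<le> integral {a..b} h\<^sub>3 + 3 * e" if "0 < e" for e :: real
  proof -
    have int: "h\<^sub>1 integrable_on cbox a b" "h\<^sub>2 integrable_on cbox a b" "h\<^sub>3 integrable_on cbox a b"
      using I1(1)[of a b] I2(1)[of a b] I3(1)[of a b] by auto
    obtain \<gamma>\<^sub>1 where 1: "gauge \<gamma>\<^sub>1" "\<And>p. \<lbrakk>p tagged_partial_division_of (cbox a b); \<gamma>\<^sub>1 fine p\<rbrakk> \<Longrightarrow>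
      (\<Sum>(x,k)\<in>p. norm (measure lborel k *\<^sub>R h\<^sub>1 x - integral k h\<^sub>1)) < e"
      using Henstock_lemma[OF int(1) \<open>0 < e\<close>] by blast
    obtain \<gamma>\<^sub>2 where 2: "gauge \<gamma>\<^sub>2" "\<And>p. \<lbrakk>p tagged_partial_division_of (cbox a b); \<gamma>\<^sub>2 fine p\<rbrakk> \<Longrightarrow>
      (\<Sum>(x,k)\<in>p. norm (measure lborel k *\<^sub>R h\<^sub>2 x - integral k h\<^sub>2)) < e"
      using Henstock_lemma[OF int(2) \<open>0 < e\<close>] by blast
    obtain \<gamma>\<^sub>3 where 3: "gauge \<gamma>\<^sub>3" "\<And>p. \<lbrakk>p tagged_partial_division_of (cbox a b); \<gamma>\<^sub>3 fine p\<rbrakk> \<Longrightarrow>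
      (\<Sum>(x,k)\<in>p. norm (measure lborel k *\<^sub>R h\<^sub>3 x - integral k h\<^sub>3)) < e"
      using Henstock_lemma[OF int(3) \<open>0 < e\<close>] by blast
    obtain p where p: "p tagged_division_of cbox a b" "(\<lambda>x. \<gamma>\<^sub>1 x \<inter> (\<gamma>\<^sub>2 x \<inter> \<gamma>\<^sub>3 x)) fine p"
      using fine_division_exists[OF gauge_Int[OF 1(1) gauge_Int[OF 2(1) 3(1)]]] by blast
    have fine: "\<gamma>\<^sub>1 fine p" "\<gamma>\<^sub>2 fine p" "\<gamma>\<^sub>3 fine p" using p(2) by (auto simp: fine_Int)
    have part: "p tagged_partial_division_of (cbox a b)" using p(1) by (simp add: tagged_division_of_def)
    have p': "p tagged_division_of {a..b}" using p(1) by simp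
    have "\<bar>f b - f a\<bar> = \<bar>\<Sum>(x,K)\<in>p. f (Sup K) - f (Inf K)\<bar>"
      by (subst additive_tagged_division_1[OF \<open>a \<le> b\<close> p', of f]) simp
    also have "\<dots> \<le> (\<Sum>(x,K)\<in>p. \<bar>f (Sup K) - f (Inf K)\<bar>)"
      by (rule order_trans[OF sum_abs]) (auto intro!: sum_mono)
    \<comment> \<open>Suppose that \<open>h\<^sub>1\<close> is the smaller function at the tag
      \<open>x\<close>. The increment of \<open>f\<close> over \<open>K\<close> is at most the
      integral of \<open>h\<^sub>1\<close>, which is \<open>measure lborel K * h\<^sub>1 x\<close>
      up to an error; this is at most \<open>measure lborel K * h\<^sub>3 x\<close>, hence at most
      the integral of \<open>h\<^sub>3\<close> up to another error. The case of
      \<open>h\<^sub>2\<close> is the same. The Henstock lemma bounds each of the three sums of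
      errors by \<open>e\<close>.\<close>
    also have "\<dots> \<le> (\<Sum>(x,K)\<in>p. integral K h\<^sub>3 + norm (measure lborel K *\<^sub>R h\<^sub>1 x - integral K h\<^sub>1)
       + norm (measure lborel K *\<^sub>R h\<^sub>2 x - integral K h\<^sub>2) + norm (measure lborel K *\<^sub>R h\<^sub>3 x - integral K h\<^sub>3))"
    proof (rule sum_mono, clarify)
      fix x K assume xK: "(x, K) \<in> p"
      obtain c d where K: "K = {c..d}" using tagged_division_ofD(4)[OF p(1) xK] by auto
      have "x \<in> K" "K \<subseteq> {a..b}" using tagged_division_ofD(2,3)[OF p(1) xK] by auto
      then have cd: "c \<le> d" "a \<le> c" "d \<le> b" using K by auto
      have "\<bar>f (Sup K) - f (Inf K)\<bar> = \<bar>f c - f d\<bar>" using K cd by (simp add: abs_minus_commute)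
      moreover have "measure lborel K * min (h\<^sub>1 x) (h\<^sub>2 x) \<le> measure lborel K * h\<^sub>3 x"
        by (intro mult_left_mono min) simp
      moreover have "measure lborel K * min (h\<^sub>1 x) (h\<^sub>2 x) = measure lborel K * h\<^sub>1 x \<or> measure lborel K * min (h\<^sub>1 x) (h\<^sub>2 x) = measure lborel K * h\<^sub>2 x"
        by (auto simp: min_def)
      ultimately show "\<bar>f (Sup K) - f (Inf K)\<bar> \<le> integral K h\<^sub>3 + norm (measure lborel K *\<^sub>R h\<^sub>1 x - integral K h\<^sub>1)
       + norm (measure lborel K *\<^sub>R h\<^sub>2 x - integral K h\<^sub>2) + norm (measure lborel K *\<^sub>R h\<^sub>3 x - integral K h\<^sub>3)"
        using bound[OF cd(2,1,3)] unfolding K real_norm_def real_scaleR_def by linarith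
    qed
    also have "\<dots> = (\<Sum>(x,K)\<in>p. integral K h\<^sub>3) + (\<Sum>(x,K)\<in>p. norm (measure lborel K *\<^sub>R h\<^sub>1 x - integral K h\<^sub>1))
      + (\<Sum>(x,K)\<in>p. norm (measure lborel K *\<^sub>R h\<^sub>2 x - integral K h\<^sub>2)) + (\<Sum>(x,K)\<in>p. norm (measure lborel K *\<^sub>R h\<^sub>3 x - integral K h\<^sub>3))"
      by (simp add: case_prod_unfold sum.distrib)
    also have "(\<Sum>(x,K)\<in>p. integral K h\<^sub>3) = integral {a..b} h\<^sub>3"
      using integral_combine_tagged_division_topdown[OF int(3) p(1)] by simp
    finally show ?thesis using 1(2)[OF part fine(1)] 2(2)[OF part fine(2)] 3(2)[OF part fine(3)] by linarith
  qed
  then have "\<bar>f a - f b\<bar> \<le> integral {a..b} h\<^sub>3 + e" if "0 < e" for e :: real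
    using that by (metis divide_pos_pos mult.commute nonzero_eq_divide_eq zero_less_numeral zero_neq_numeral)
  then have "\<bar>f a - f b\<bar> \<le> integral {a..b} h\<^sub>3" by (rule field_le_epsilon)
  then show ?thesis using I3(2)[of a b] by (auto simp: g\<^sub>3_def intro!: ennreal_leI)
qed

section \<open>Subpaths and integrals over segments of the arc length parametrization\<close>

context Metric_space
begin

lemma variation_compose_mono:
  assumes "\<And>x y. a \<le> x \<Longrightarrow> x \<le> y \<Longrightarrow> y \<le> b \<Longrightarrow> \<phi> x \<le> \<phi> y"
  shows "variation (\<lambda>x. \<gamma> (\<phi> x)) a b \<le> variation \<gamma> (\<phi> a) (\<phi> b)"
proof (rule variation_leI)
  fix n t assume t: "\<And>i. i \<le> n \<Longrightarrow> t i \<in> {a..b}" "\<And>i. i < n \<Longrightarrow> t i \<le> t (Suc i)"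
  show "(\<Sum>i<n. ennreal (d (\<gamma> (\<phi> (t i))) (\<gamma> (\<phi> (t (Suc i)))))) \<le> variation \<gamma> (\<phi> a) (\<phi> b)"
    by (rule sum_le_variation[of n "\<lambda>i. \<phi> (t i)"]) (use t assms in force)+
qed

text \<open>A weak upper gradient is tested only at the endpoints of paths on \<open>[0, 1]\<close>,
  so a segment of the arc length parametrization must itself be made a path. An affine change of the
  parameter does it; the variation is preserved because monotone composition does not increase it
  and applies to the inverse as well. The set \<open>B\<close> allows one to pass from paths in the
  whole space to paths in \<Omega>.\<close>

lemma subpath:
  assumes \<gamma>: "\<gamma> \<in> rect_paths A" and st: "0 \<le> s" "s < t" "t \<le> arc_len \<gamma> 1"
    and B: "\<And>x. x \<in> {s..t} \<Longrightarrow> arc_param \<gamma> x \<in> B"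
  obtains \<gamma>' where "\<gamma>' \<in> rect_paths B" "\<gamma>' 0 = arc_param \<gamma> s" "\<gamma>' 1 = arc_param \<gamma> t" "arc_len \<gamma>' 1 = t - s"
    "\<And>x. x \<in> {0..t - s} \<Longrightarrow> arc_param \<gamma>' x = arc_param \<gamma> (s + x)"
proof -
  obtain a b where a: "a \<in> {0..1}" "arc_len \<gamma> a = s" and b: "b \<in> {0..1}" "arc_len \<gamma> b = t"
    using arc_len_surj[OF \<gamma>, of s] arc_len_surj[OF \<gamma>, of t] st by auto
  have mono: "arc_len \<gamma> x \<le> arc_len \<gamma> y" if "x \<in> {0..1}" "y \<in> {0..1}" "x \<le> y" for x y
    using rect_paths_variation(1)[OF \<gamma>, of x y] that by auto
  have ab: "a < b"
  proof (rule ccontr)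
    assume "\<not> a < b"
    then have "arc_len \<gamma> b \<le> arc_len \<gamma> a" by (intro mono) (use a b in auto)
    then show False using a b st by simp
  qed
  define \<phi> where "\<phi> x = a + x * (b - a)" for x
  define \<gamma>' where "\<gamma>' x = \<gamma> (\<phi> x)" for x
  have \<phi>: "\<phi> x \<in> {a..b}" "\<phi> x \<in> {0..1}" if "x \<in> {0..1}" for x
  proof -
    have "x * (b - a) \<le> 1 * (b - a)" "0 \<le> x * (b - a)"
      using that ab by (auto intro!: mult_right_mono simp: zero_le_mult_iff)
    then show "\<phi> x \<in> {a..b}" by (auto simp: \<phi>_def)
    then show "\<phi> x \<in> {0..1}" using a b by auto
  qed
  have in_B: "\<gamma>' x \<in> B" if "x \<in> {0..1}" for x
    using B[of "arc_len \<gamma> (\<phi> x)"] mono[of a "\<phi> x"] mono[of "\<phi> x" b] \<phi>[OF that] a b arc_param_arc_len[OF \<gamma> \<phi>(2)[OF that]]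
    by (auto simp: \<gamma>'_def)
  have var: "variation \<gamma>' 0 x = ennreal (arc_len \<gamma> (\<phi> x) - s)" if x: "x \<in> {0..1}" for x
  proof -
    have "variation \<gamma>' 0 x \<le> variation \<gamma> (\<phi> 0) (\<phi> x)"
      unfolding \<gamma>'_def by (rule variation_compose_mono) (use ab in \<open>auto simp: \<phi>_def intro: mult_right_mono\<close>)
    moreover
    define \<psi> where "\<psi> y = (y - a) / (b - a)" for y
    have "\<gamma> = (\<lambda>y. \<gamma>' (\<psi> y))" using ab by (auto simp: \<gamma>'_def \<phi>_def \<psi>_def)
    then have "variation \<gamma> (\<phi> 0) (\<phi> x) \<le> variation \<gamma>' (\<psi> (\<phi> 0)) (\<psi> (\<phi> x))"
      using variation_compose_mono[of "\<phi> 0" "\<phi> x" \<psi> \<gamma>'] ab by (auto simp: \<psi>_def divide_right_mono)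
    moreover have "\<psi> (\<phi> 0) = 0" "\<psi> (\<phi> x) = x" "\<phi> 0 = a" using ab by (auto simp: \<psi>_def \<phi>_def)
    ultimately have "variation \<gamma>' 0 x = variation \<gamma> a (\<phi> x)" by auto
    also have "\<dots> = ennreal (arc_len \<gamma> (\<phi> x) - s)"
      using rect_paths_variation(2)[OF \<gamma>, of a "\<phi> x"] \<phi>[OF x] a by auto
    finally show ?thesis .
  qed
  have "pathin (subtopology mtopology B) \<gamma>'"
    unfolding pathin_def
  proof (rule continuous_map_into_subtopology)
    show "\<gamma>' \<in> topspace (top_of_set {0..1}) \<rightarrow> B" using in_B by auto
    show "continuous_map (top_of_set {0..1}) mtopology \<gamma>'"
      unfolding continuous_map_to_metric topspace_euclidean_subtopology
    proof (intro ballI allI impI)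
      fix x e :: real assume x: "x \<in> {0..1}" and "0 < e"
      then obtain \<delta> where \<delta>: "\<delta> > 0" "\<And>t. t \<in> {0..1} \<Longrightarrow> \<bar>t - \<phi> x\<bar> < \<delta> \<Longrightarrow> d (\<gamma> (\<phi> x)) (\<gamma> t) < e"
        using rect_paths_continuous[OF \<gamma> \<phi>(2)] by blast
      let ?U = "{0..1} \<inter> ball x (\<delta> / (b - a))"
      have "\<gamma>' y \<in> mball (\<gamma>' x) e" if "y \<in> ?U" for y
      proof -
        have "\<phi> y - \<phi> x = (y - x) * (b - a)" by (simp add: \<phi>_def algebra_simps)
        then have "\<bar>\<phi> y - \<phi> x\<bar> = \<bar>x - y\<bar> * (b - a)" using ab by (simp add: abs_mult abs_minus_commute)
        also have "\<dots> < \<delta>" using that ab by (simp add: dist_real_def pos_less_divide_eq)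
        finally have "\<bar>\<phi> y - \<phi> x\<bar> < \<delta>" .
        then show ?thesis using \<delta>(2)[OF \<phi>(2)] that x rect_paths_mem(2)[OF \<gamma> \<phi>(2)] by (auto simp: \<gamma>'_def)
      qed
      then show "\<exists>U. openin (top_of_set {0..1}) U \<and> x \<in> U \<and> (\<forall>y\<in>U. \<gamma>' y \<in> mball (\<gamma>' x) e)"
        using x \<delta>(1) ab by (intro exI[of _ ?U]) (auto simp: openin_open_Int)
    qed
  qed
  moreover have "path_len \<gamma>' 1 = ennreal (t - s)"
    using var[of 1] b by (simp add: path_len_eq_variation \<phi>_def)
  ultimately have \<gamma>': "\<gamma>' \<in> rect_paths B" using st by (simp add: rect_paths_def)
  have len: "arc_len \<gamma>' x = arc_len \<gamma> (\<phi> x) - s" if "x \<in> {0..1}" for x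
    using var[OF that] mono[of a "\<phi> x"] \<phi>[OF that] a by (simp add: arc_len_def path_len_eq_variation)
  show ?thesis
  proof
    show "\<gamma>' 0 = arc_param \<gamma> s" "\<gamma>' 1 = arc_param \<gamma> t"
      using arc_param_arc_len[OF \<gamma>] a b by (auto simp: \<gamma>'_def \<phi>_def)
    show "arc_len \<gamma>' 1 = t - s" using len[of 1] b by (simp add: \<phi>_def)
    fix x assume x: "x \<in> {0..t - s}"
    then obtain y where y: "y \<in> {0..1}" "arc_len \<gamma>' y = x"
      using arc_len_surj[OF \<gamma>', of x] \<open>arc_len \<gamma>' 1 = t - s\<close> by auto
    then have "arc_param \<gamma>' x = \<gamma> (\<phi> y)" using arc_param_arc_len[OF \<gamma>' y(1)] by (simp add: \<gamma>'_def)
    also have "\<dots> = arc_param \<gamma> (s + x)" using arc_param_arc_len[OF \<gamma> \<phi>(2)[OF y(1)]] len[OF y(1)] y(2) by simp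
    finally show "arc_param \<gamma>' x = arc_param \<gamma> (s + x)" .
  qed (rule \<gamma>')
qed

text \<open>The parametrization is 1-Lipschitz, so that preimages of open sets are relatively open
  in the parameter interval.\<close>

lemma arc_param_measurable:
  assumes \<gamma>: "\<gamma> \<in> rect_paths A"
  shows "arc_param \<gamma> \<in> measurable (restrict_space borel {0..arc_len \<gamma> 1}) (borel_on A)"
  unfolding borel_on_def
proof (rule measurable_restrict_space2)
  let ?L = "arc_len \<gamma> 1"
  show "arc_param \<gamma> \<in> space (restrict_space borel {0..?L}) \<rightarrow> A"
    using arc_param_mem[OF \<gamma>] by (auto simp: space_restrict_space)
  show "arc_param \<gamma> \<in> restrict_space borel {0..?L} \<rightarrow>\<^sub>M sigma M {U. openin mtopology U}"
  proof (rule measurable_sigma_sets[OF sets_measure_of])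
    show "{U. openin mtopology U} \<subseteq> Pow M" using openin_subset by fastforce
    then show "{U. openin mtopology U} \<subseteq> Pow M" .
    show "arc_param \<gamma> \<in> space (restrict_space borel {0..?L}) \<rightarrow> M"
      using arc_param_mem[OF \<gamma>] by (auto simp: space_restrict_space)
    fix U assume "U \<in> {U. openin mtopology U}"
    then have U: "openin mtopology U" by simp
    have "openin (top_of_set {0..?L}) (arc_param \<gamma> -` U \<inter> {0..?L})"
      unfolding openin_euclidean_subtopology_iff
    proof safe
      fix x assume x: "x \<in> {0..?L}" "arc_param \<gamma> x \<in> U"
      then obtain r where r: "r > 0" "mball (arc_param \<gamma> x) r \<subseteq> U"
        using U unfolding openin_mtopology by blast
      have "arc_param \<gamma> y \<in> U" if "y \<in> {0..?L}" "dist y x < r" for y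
        using r(2) arc_param_Lipschitz[OF \<gamma> x(1) that(1)] arc_param_mem(2)[OF \<gamma>] x(1) that
        by (auto simp: dist_real_def subset_iff abs_minus_commute)
      then show "\<exists>e>0. \<forall>x'\<in>{0..?L}. dist x' x < e \<longrightarrow> x' \<in> arc_param \<gamma> -` U \<inter> {0..?L}"
        using r(1) by auto
    qed
    then obtain V where "open V" "arc_param \<gamma> -` U \<inter> {0..?L} = {0..?L} \<inter> V"
      unfolding openin_open by blast
    then show "arc_param \<gamma> -` U \<inter> space (restrict_space borel {0..?L}) \<in> sets (restrict_space borel {0..?L})"
      by (auto simp: space_restrict_space sets_restrict_space)
  qed
qed

definition seg_integral :: "('a \<Rightarrow> ennreal) \<Rightarrow> (real \<Rightarrow> 'a) \<Rightarrow> real \<Rightarrow> real \<Rightarrow> ennreal" where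
  "seg_integral g \<gamma> s t = (\<integral>\<^sup>+ x \<in> {s..t}. g (arc_param \<gamma> x) \<partial>lborel)"

lemma line_integral_eq_seg: "line_integral g \<gamma> = seg_integral g \<gamma> 0 (arc_len \<gamma> 1)"
  by (simp add: line_integral_eq seg_integral_def)

lemma borel_measurable_arc_param:
  fixes g :: "'a \<Rightarrow> ennreal"
  assumes \<gamma>: "\<gamma> \<in> rect_paths A" and g: "g \<in> borel_measurable (borel_on A)" and st: "0 \<le> s" "t \<le> arc_len \<gamma> 1"
  shows "(\<lambda>x. g (arc_param \<gamma> x) * indicator {s..t} x) \<in> borel_measurable lborel"
proof -
  let ?L = "arc_len \<gamma> 1"
  have "(\<lambda>x. g (arc_param \<gamma> x)) \<in> borel_measurable (restrict_space borel {0..?L})"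
    using measurable_comp[OF arc_param_measurable[OF \<gamma>] g] by (simp add: comp_def)
  then have [measurable]: "(\<lambda>x. g (arc_param \<gamma> x) * indicator {0..?L} x) \<in> borel_measurable borel"
    by (subst (asm) borel_measurable_restrict_space_iff_ennreal) auto
  have "(\<lambda>x. (g (arc_param \<gamma> x) * indicator {0..?L} x) * indicator {s..t} x) \<in> borel_measurable borel"
    by measurable
  also have "(\<lambda>x. (g (arc_param \<gamma> x) * indicator {0..?L} x) * indicator {s..t} x) = (\<lambda>x. g (arc_param \<gamma> x) * indicator {s..t} x)"
    using st by (auto simp: indicator_def)
  finally show ?thesis by simp
qed

lemma seg_integral_mono:
  assumes "s' \<le> s" "t \<le> t'" "\<And>x. x \<in> {s..t} \<Longrightarrow> g (arc_param \<gamma> x) \<le> g' (arc_param \<gamma> x)"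
  shows "seg_integral g \<gamma> s t \<le> seg_integral g' \<gamma> s' t'"
  unfolding seg_integral_def by (rule nn_integral_mono) (use assms in \<open>auto simp: indicator_def\<close>)

lemma line_integral_subpath:
  assumes \<gamma>: "\<gamma> \<in> rect_paths A" and g: "g \<in> borel_measurable (borel_on A)" and st: "0 \<le> s" "s < t" "t \<le> arc_len \<gamma> 1"
    and \<gamma>': "arc_len \<gamma>' 1 = t - s" "\<And>x. x \<in> {0..t - s} \<Longrightarrow> arc_param \<gamma>' x = arc_param \<gamma> (s + x)"
  shows "line_integral g \<gamma>' = seg_integral g \<gamma> s t"
proof -
  have "seg_integral g \<gamma> s t = (\<integral>\<^sup>+x. g (arc_param \<gamma> (s + x)) * indicator {s..t} (s + x) \<partial>lborel)"
    using nn_integral_real_affine[OF borel_measurable_arc_param[OF \<gamma> g st(1,3), simplified], of 1 s]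
    by (simp add: seg_integral_def)
  also have "\<dots> = line_integral g \<gamma>'"
    unfolding line_integral_eq \<gamma>'(1) by (rule nn_integral_cong) (auto simp: indicator_def \<gamma>'(2))
  finally show ?thesis by simp
qed

end

section \<open>Weak upper gradients\<close>

lemma epowr_0 [simp]: "epowr 0 r = 0"
  by (simp add: epowr_def)

lemma epowr_top [simp]: "epowr top r = top"
  by (simp add: epowr_def)

lemma epowr_ennreal [simp]: "0 \<le> x \<Longrightarrow> epowr (ennreal x) r = ennreal (x powr r)"
  by (simp add: epowr_def)

lemma epowr_eq_top_iff [simp]: "epowr x r = top \<longleftrightarrow> x = top"
  by (simp add: epowr_def)

lemma epowr_mono: "0 \<le> r \<Longrightarrow> x \<le> y \<Longrightarrow> epowr x r \<le> epowr y r"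
  by (cases x; cases y) (auto simp: powr_mono2 top_unique)

lemma epowr_mult: "epowr (ennreal c * x) r = ennreal (c powr r) * epowr x r" if "0 < c"
  using that by (cases x) (auto simp: ennreal_mult[symmetric] powr_mult ennreal_mult_top)

lemma epowr_epowr:
  assumes "0 < r"
  shows "epowr (epowr x r) (1 / r) = x" "epowr (epowr x (1 / r)) r = x"
  using assms by (cases x; simp add: powr_powr)+

lemma epowr_le_iff: "0 < r \<Longrightarrow> epowr x r \<le> epowr y r \<longleftrightarrow> x \<le> y"
  using epowr_mono[of r x y] epowr_mono[of "1 / r" "epowr x r" "epowr y r"] by (auto simp: epowr_epowr)

lemma epowr_SUP_le:
  assumes "0 < r"
  shows "epowr (SUP i\<in>I. f i) r \<le> (SUP i\<in>I. epowr (f i) r)"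
proof -
  have "f i \<le> epowr (SUP i\<in>I. epowr (f i) r) (1 / r)" if "i \<in> I" for i
    using epowr_mono[OF _ SUP_upper[OF that, of "\<lambda>i. epowr (f i) r"], of "1 / r"] assms by (simp add: epowr_epowr)
  then have "(SUP i\<in>I. f i) \<le> epowr (SUP i\<in>I. epowr (f i) r) (1 / r)" by (rule SUP_least)
  from epowr_mono[OF _ this, of r] assms show ?thesis by (simp add: epowr_epowr)
qed

lemma borel_measurable_epowr [measurable]: "(\<lambda>x. epowr x r) \<in> borel_measurable borel"
  unfolding epowr_def by measurable

context borel_regular_space
begin

lemma open_subset: "openin mtopology A \<Longrightarrow> A \<subseteq> X"
  using openin_subset by fastforce

lemma sets_sigma_subset: "sets (sigma X {U. openin mtopology U}) \<subseteq> sets \<mu>"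
proof -
  have "sigma_sets (space \<mu>) {U. openin mtopology U} \<subseteq> sets \<mu>"
    by (rule sets.sigma_sets_subset) (use open_measurable in auto)
  moreover have "{U. openin mtopology U} \<subseteq> Pow X" using open_subset by auto
  ultimately show ?thesis by (simp add: space_mu)
qed

lemma mball_measurable [measurable]: "mball x r \<in> sets \<mu>"
  by (rule open_measurable) simp

text \<open>Upper gradients are Borel on their domain, whereas \<mu> may live on a larger
  sigma-algebra. Openness of \<open>A\<close> makes the extension by zero Borel on the whole space,
  and therefore measurable for \<mu>.\<close>

lemma borel_on_extend:
  fixes f :: "'a \<Rightarrow> ennreal"
  assumes "openin mtopology A" "f \<in> borel_measurable (borel_on A)"
  shows "(\<lambda>x. f x * indicator A x) \<in> borel_measurable (borel_on B)"
    and "(\<lambda>x. f x * indicator A x) \<in> borel_measurable \<mu>"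
proof -
  have 1: "{U. openin mtopology U} \<subseteq> Pow X" using open_subset by auto
  have "A \<inter> space (sigma X {U. openin mtopology U}) \<in> sets (sigma X {U. openin mtopology U})"
    using assms(1) open_subset[OF assms(1)] 1 by (auto simp: space_measure_of_conv inf_absorb1)
  then have 2: "(\<lambda>x. f x * indicator A x) \<in> borel_measurable (sigma X {U. openin mtopology U})"
    using assms(2) unfolding borel_on_def by (subst (asm) borel_measurable_restrict_space_iff_ennreal) auto
  then show "(\<lambda>x. f x * indicator A x) \<in> borel_measurable (borel_on B)"
    unfolding borel_on_def by (rule measurable_restrict_space1)
  have "measurable (sigma X {U. openin mtopology U}) borel \<subseteq> measurable \<mu> borel"
    using sets_sigma_subset by (intro measurable_mono) (auto simp: space_mu space_measure_of_conv)
  with 2 show "(\<lambda>x. f x * indicator A x) \<in> borel_measurable \<mu>" by blast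
qed

lemma epowr_indicator: "epowr (f x) r * indicator A x = epowr (f x * indicator A x) r"
  by (auto simp: indicator_def)

lemma measurable_epowr_indicator:
  assumes "openin mtopology A" "f \<in> borel_measurable (borel_on A)"
  shows "(\<lambda>x. epowr (f x) r * indicator A x) \<in> borel_measurable \<mu>"
  unfolding epowr_indicator using borel_on_extend(2)[OF assms] by measurable

lemma mball_in_borel_on: "mball x r \<inter> A \<in> sets (borel_on A)"
  unfolding borel_on_def sets_restrict_space
proof
  show "mball x r \<inter> A = A \<inter> mball x r" by auto
  show "mball x r \<in> sets (sigma X {U. openin mtopology U})"
    using open_subset by (subst sets_measure_of) auto
qed

text \<open>Families of modulus zero are those on which the line integral of a single such function is
  infinite. Suprema of scaled potentials replace sums, which spares Minkowski's inequality.\<close>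

definition potential :: "real \<Rightarrow> 'a set \<Rightarrow> ('a \<Rightarrow> ennreal) \<Rightarrow> bool" where
  "potential q A \<rho> \<longleftrightarrow> \<rho> \<in> borel_measurable (borel_on A) \<and> (\<integral>\<^sup>+x\<in>A. epowr (\<rho> x) q \<partial>\<mu>) < \<infinity>"

lemma line_integral_cmult:
  assumes "\<gamma> \<in> rect_paths A" "\<rho> \<in> borel_measurable (borel_on A)"
  shows "line_integral (\<lambda>x. c * \<rho> x) \<gamma> = c * line_integral \<rho> \<gamma>"
  using nn_integral_cmult[OF borel_measurable_arc_param[OF assms, of 0 "arc_len \<gamma> 1"], of c]
  by (simp add: line_integral_eq mult.assoc)

lemma line_integral_mono:
  assumes "\<And>x. f x \<le> g x"
  shows "line_integral f \<gamma> \<le> line_integral g \<gamma>"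
  unfolding line_integral_eq by (rule nn_integral_mono) (auto simp: assms indicator_def)

lemma nn_integral_epowr_SUP_le:
  assumes "0 < q" "openin mtopology A" "\<And>n::nat. f n \<in> borel_measurable (borel_on A)"
  shows "(\<integral>\<^sup>+x\<in>A. epowr (SUP n. f n x) q \<partial>\<mu>) \<le> (\<Sum>n. \<integral>\<^sup>+x\<in>A. epowr (f n x) q \<partial>\<mu>)"
proof -
  have "(\<integral>\<^sup>+x\<in>A. epowr (SUP n. f n x) q \<partial>\<mu>) \<le> (\<integral>\<^sup>+x. (\<Sum>n. epowr (f n x) q * indicator A x) \<partial>\<mu>)"
  proof (rule nn_integral_mono)
    fix x
    have "(SUP n. epowr (f n x) q) \<le> (\<Sum>n. epowr (f n x) q)"
    proof (rule SUP_least)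
      fix n show "epowr (f n x) q \<le> (\<Sum>n. epowr (f n x) q)"
        using sum_le_suminf[of "\<lambda>n. epowr (f n x) q" "{n}"] by simp
    qed
    then show "epowr (SUP n. f n x) q * indicator A x \<le> (\<Sum>n. epowr (f n x) q * indicator A x)"
      using epowr_SUP_le[OF assms(1), of "\<lambda>n. f n x" UNIV] by (auto simp: indicator_def)
  qed
  also have "\<dots> = (\<Sum>n. \<integral>\<^sup>+x\<in>A. epowr (f n x) q \<partial>\<mu>)"
    by (rule nn_integral_suminf) (use measurable_epowr_indicator assms in auto)
  finally show ?thesis .
qed

lemma exists_small_factor:
  assumes "0 < q" "x < (\<infinity>::ennreal)" "0 < (e::real)"
  shows "\<exists>c>0. ennreal (c powr q) * x \<le> ennreal e"
proof -
  obtain r where r: "x = ennreal r" "0 \<le> r" using assms(2) by (cases x) auto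
  have "ennreal (((e / (1 + r)) powr (1/q)) powr q) * x \<le> ennreal e"
    using assms r by (auto simp: powr_powr ennreal_mult[symmetric] field_simps intro!: ennreal_leI)
  then show ?thesis using assms r by (intro exI[of _ "(e / (1 + r)) powr (1/q)"]) auto
qed

lemma suminf_half: "(\<Sum>n. ennreal ((1/2) ^ n)) < \<infinity>"
  by (subst suminf_ennreal2) auto

lemma nn_integral_epowr_cmult:
  assumes "openin mtopology A" "f \<in> borel_measurable (borel_on A)" "0 < c"
  shows "(\<integral>\<^sup>+x\<in>A. epowr (ennreal c * f x) q \<partial>\<mu>) = ennreal (c powr q) * (\<integral>\<^sup>+x\<in>A. epowr (f x) q \<partial>\<mu>)"
  using nn_integral_cmult[OF measurable_epowr_indicator[OF assms(1,2)], of "ennreal (c powr q)" q] assms(3)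
  by (simp add: epowr_mult mult.assoc)

text \<open>Each \<open>f n\<close> is scaled by a positive \<open>c n\<close> until its energy is
  at most \<open>(1/2) ^ n\<close>. The supremum of the scaled functions then has finite energy, and
  it dominates each of them, so that a path on which it has finite integral is good for all
  \<open>n\<close>.\<close>

lemma potential_countable:
  assumes "0 < q" "openin mtopology A" "\<And>n::nat. potential q A (f n)"
  shows "\<exists>\<rho>. potential q A \<rho> \<and> (\<forall>\<gamma>\<in>rect_paths A. line_integral \<rho> \<gamma> < \<infinity> \<longrightarrow> (\<forall>n. line_integral (f n) \<gamma> < \<infinity>))"
proof -
  have meas: "\<And>n. f n \<in> borel_measurable (borel_on A)" and fin: "\<And>n. (\<integral>\<^sup>+x\<in>A. epowr (f n x) q \<partial>\<mu>) < \<infinity>"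
    using assms(3) by (auto simp: potential_def)
  have "\<exists>c>0. ennreal (c powr q) * (\<integral>\<^sup>+x\<in>A. epowr (f n x) q \<partial>\<mu>) \<le> ennreal ((1/2)^n)" for n
    by (rule exists_small_factor) (use assms(1) fin in auto)
  then obtain c where c: "\<And>n. 0 < c n" "\<And>n. ennreal (c n powr q) * (\<integral>\<^sup>+x\<in>A. epowr (f n x) q \<partial>\<mu>) \<le> ennreal ((1/2)^n)"
    by metis
  define \<rho> where "\<rho> x = (SUP n. ennreal (c n) * f n x)" for x
  have m: "\<And>n. (\<lambda>x. ennreal (c n) * f n x) \<in> borel_measurable (borel_on A)" using meas by measurable
  then have "\<rho> \<in> borel_measurable (borel_on A)" unfolding \<rho>_def by measurable
  moreover have "(\<integral>\<^sup>+x\<in>A. epowr (\<rho> x) q \<partial>\<mu>) \<le> (\<Sum>n. ennreal ((1/2)^n))"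
    unfolding \<rho>_def
    by (rule order_trans[OF nn_integral_epowr_SUP_le[OF assms(1,2) m]])
       (auto intro!: suminf_le simp: nn_integral_epowr_cmult[OF assms(2) meas c(1)] c(2))
  ultimately have "potential q A \<rho>" using suminf_half by (auto simp: potential_def intro: le_less_trans)
  moreover have "line_integral (f n) \<gamma> < \<infinity>" if "\<gamma> \<in> rect_paths A" "line_integral \<rho> \<gamma> < \<infinity>" for \<gamma> n
  proof -
    have "ennreal (c n) * line_integral (f n) \<gamma> \<le> line_integral \<rho> \<gamma>"
      unfolding line_integral_cmult[OF that(1) meas, symmetric]
      by (rule line_integral_mono) (auto simp: \<rho>_def intro: SUP_upper)
    then have "ennreal (c n) * line_integral (f n) \<gamma> < \<infinity>" using that(2) by (rule le_less_trans)
    then show ?thesis using c(1)[of n] by (auto simp: ennreal_mult_less_top)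
  qed
  ultimately show ?thesis by auto
qed

text \<open>Modulus zero supplies admissible functions of arbitrarily small energy. The
  \<open>n\<close>-th one is chosen with energy small enough to be multiplied by
  \<open>n + 1\<close>; the supremum of these multiples still has finite energy, but line integral
  at least \<open>n\<close> for every \<open>n\<close>.\<close>

lemma potential_of_modulus_0:
  assumes "0 < q" "openin mtopology A" "\<Gamma> \<subseteq> rect_paths A" "modulus q A \<Gamma> = 0"
  shows "\<exists>\<rho>. potential q A \<rho> \<and> (\<forall>\<gamma>\<in>\<Gamma>. line_integral \<rho> \<gamma> = \<infinity>)"
proof -
  define c where "c n = real n + 1" for n
  have c: "0 < c n" "real n \<le> c n" for n by (auto simp: c_def)
  have "\<exists>\<rho>. \<rho> \<in> borel_measurable (borel_on A) \<and> (\<forall>\<gamma>\<in>\<Gamma>. 1 \<le> line_integral \<rho> \<gamma>) \<and>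
    (\<integral>\<^sup>+ x \<in> A. epowr (\<rho> x) q \<partial>\<mu>) < ennreal ((1/2)^n / (c n) powr q)" for n
  proof -
    have "0 < (1/2)^n / (c n) powr q" using c(1)[of n] by simp
    then have "modulus q A \<Gamma> < ennreal ((1/2)^n / (c n) powr q)"
      unfolding assms(4) by (simp only: ennreal_less_zero_iff)
    then show ?thesis unfolding modulus_def INF_less_iff by blast
  qed
  then obtain f where f: "\<And>n. f n \<in> borel_measurable (borel_on A)" "\<And>n \<gamma>. \<gamma> \<in> \<Gamma> \<Longrightarrow> 1 \<le> line_integral (f n) \<gamma>"
    "\<And>n. (\<integral>\<^sup>+ x \<in> A. epowr (f n x) q \<partial>\<mu>) < ennreal ((1/2)^n / (c n) powr q)"
    by metis
  define \<rho> where "\<rho> x = (SUP n. ennreal (c n) * f n x)" for x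
  have m: "\<And>n. (\<lambda>x. ennreal (c n) * f n x) \<in> borel_measurable (borel_on A)" using f by measurable
  then have "\<rho> \<in> borel_measurable (borel_on A)" unfolding \<rho>_def by measurable
  moreover have "(\<integral>\<^sup>+x\<in>A. epowr (\<rho> x) q \<partial>\<mu>) \<le> (\<Sum>n. ennreal ((1/2)^n))"
  proof -
    have *: "(\<integral>\<^sup>+x\<in>A. epowr (ennreal (c n) * f n x) q \<partial>\<mu>) \<le> ennreal ((1/2)^n)" for n
    proof -
      have "(\<integral>\<^sup>+x\<in>A. epowr (ennreal (c n) * f n x) q \<partial>\<mu>)
        \<le> ennreal ((c n) powr q) * ennreal ((1/2)^n / (c n) powr q)"
        unfolding nn_integral_epowr_cmult[OF assms(2) f(1) c(1)]
        by (intro mult_left_mono less_imp_le[OF f(3)]) auto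
      also have "\<dots> = ennreal ((1/2)^n)" using c(1)[of n] by (subst ennreal_mult[symmetric]) auto
      finally show ?thesis .
    qed
    show ?thesis unfolding \<rho>_def
      by (rule order_trans[OF nn_integral_epowr_SUP_le[OF assms(1,2) m]]) (auto intro!: suminf_le *)
  qed
  ultimately have "potential q A \<rho>" using suminf_half by (auto simp: potential_def intro: le_less_trans)
  moreover have "line_integral \<rho> \<gamma> = \<infinity>" if \<gamma>: "\<gamma> \<in> \<Gamma>" for \<gamma>
  proof -
    have "of_nat n \<le> line_integral \<rho> \<gamma>" for n
    proof -
      have "of_nat n \<le> ennreal (c n) * 1" using c(2)[of n] by (simp add: ennreal_of_nat_eq_real_of_nat ennreal_leI)
      also have "\<dots> \<le> ennreal (c n) * line_integral (f n) \<gamma>" by (intro mult_left_mono f(2) \<gamma>) auto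
      also have "\<dots> = line_integral (\<lambda>x. ennreal (c n) * f n x) \<gamma>"
        by (rule line_integral_cmult[symmetric]) (use \<gamma> assms f in auto)
      also have "\<dots> \<le> line_integral \<rho> \<gamma>" unfolding \<rho>_def by (rule line_integral_mono) (rule SUP_upper, simp)
      finally show ?thesis .
    qed
    then show ?thesis by (metis ennreal_Ex_less_of_nat infinity_ennreal_def leD less_top)
  qed
  ultimately show ?thesis by auto
qed

text \<open>Minima of gradients and truncations require an argument on small pieces of a path,
  whereas a weak upper gradient is tested only at endpoints; hence the condition at all intermediate
  parameters. Finiteness of \<open>u\<close> excludes the default value of
  \<open>real_of_ereal\<close> at infinity.\<close>

definition ug_along :: "('a \<Rightarrow> ereal) \<Rightarrow> ('a \<Rightarrow> ennreal) \<Rightarrow> (real \<Rightarrow> 'a) \<Rightarrow> bool" where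
  "ug_along u g \<gamma> \<longleftrightarrow> line_integral g \<gamma> < \<infinity> \<and>
     (\<forall>s\<in>{0..arc_len \<gamma> 1}. \<bar>u (arc_param \<gamma> s)\<bar> \<noteq> \<infinity>) \<and>
     (\<forall>s t. 0 \<le> s \<and> s \<le> t \<and> t \<le> arc_len \<gamma> 1 \<longrightarrow>
       ennreal \<bar>real_of_ereal (u (arc_param \<gamma> s)) - real_of_ereal (u (arc_param \<gamma> t))\<bar> \<le> seg_integral g \<gamma> s t)"

lemma e2ennreal_abs_diff:
  assumes "\<bar>x\<bar> \<noteq> \<infinity>" "\<bar>y\<bar> \<noteq> \<infinity>"
  shows "e2ennreal \<bar>x - y\<bar> = ennreal \<bar>real_of_ereal x - real_of_ereal y\<bar>"
  using assms by (cases x; cases y) (auto simp: e2ennreal_ereal)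

text \<open>One potential excludes all bad paths: those with a subpath in the exceptional family,
  and those along which \<open>g\<close> has infinite integral. If the potential of the exceptional
  family has finite integral along a path, then also along its subpaths, which are therefore not
  exceptional.\<close>

lemma weak_upper_gradient_potential:
  assumes q: "0 < q" and A: "openin mtopology A" and g: "weak_upper_gradient q A u g" "q_integrable_bdd q A g"
  shows "\<exists>\<rho>. potential q A \<rho> \<and> (\<forall>\<gamma>\<in>rect_paths A. line_integral \<rho> \<gamma> < \<infinity> \<longrightarrow> ug_along u g \<gamma>)"
proof -
  from g(1) obtain \<Gamma> where g_meas: "g \<in> borel_measurable (borel_on A)" and \<Gamma>: "\<Gamma> \<subseteq> rect_paths A" "modulus q A \<Gamma> = 0"
    and ug: "\<And>\<gamma>. \<gamma> \<in> rect_paths A - \<Gamma> \<Longrightarrow>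
         (if \<bar>u (\<gamma> 0)\<bar> = \<infinity> \<or> \<bar>u (\<gamma> 1)\<bar> = \<infinity> then line_integral g \<gamma> = \<infinity>
          else e2ennreal \<bar>u (\<gamma> 0) - u (\<gamma> 1)\<bar> \<le> line_integral g \<gamma>)"
    unfolding weak_upper_gradient_def by blast
  obtain \<rho>\<^sub>0 where \<rho>\<^sub>0: "potential q A \<rho>\<^sub>0" "\<And>\<gamma>. \<gamma> \<in> \<Gamma> \<Longrightarrow> line_integral \<rho>\<^sub>0 \<gamma> = \<infinity>"
    using potential_of_modulus_0[OF q A \<Gamma>] by blast
  define x\<^sub>0 where "x\<^sub>0 = (SOME x. x \<in> A)"
  \<comment> \<open>\<open>g\<close> is \<open>q\<close>-integrable only on bounded sets, so it
    enters through its restrictions to balls. A rectifiable path lies in one of them.\<close>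
  define h where "h n x = g x * indicator (mball x\<^sub>0 (real n) \<inter> A) x" for n x
  have h: "potential q A (h n)" for n
  proof -
    have "h n \<in> borel_measurable (borel_on A)"
      unfolding h_def using g_meas mball_in_borel_on by measurable
    moreover have "(\<integral>\<^sup>+x\<in>A. epowr (h n x) q \<partial>\<mu>) = (\<integral>\<^sup>+x\<in>mball x\<^sub>0 (real n) \<inter> A. epowr (g x) q \<partial>\<mu>)"
      by (rule nn_integral_cong) (auto simp: h_def indicator_def)
    moreover have "\<dots> < \<infinity>"
    proof -
      have "mball x\<^sub>0 (real n) \<inter> A \<in> sets \<mu>" using open_measurable[OF A] by measurable
      moreover have "mbounded (mball x\<^sub>0 (real n) \<inter> A)" by (meson mbounded_mball mbounded_subset inf_le1)
      ultimately show ?thesis using g(2) unfolding q_integrable_bdd_def by simp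
    qed
    ultimately show ?thesis by (simp add: potential_def)
  qed
  define f where "f n = (case n of 0 \<Rightarrow> \<rho>\<^sub>0 | Suc n \<Rightarrow> h n)" for n
  have "potential q A (f n)" for n using \<rho>\<^sub>0 h by (auto simp: f_def split: nat.split)
  then obtain \<rho> where \<rho>: "potential q A \<rho>"
    and fin: "\<And>\<gamma> n. \<gamma> \<in> rect_paths A \<Longrightarrow> line_integral \<rho> \<gamma> < \<infinity> \<Longrightarrow> line_integral (f n) \<gamma> < \<infinity>"
    using potential_countable[OF q A, of f] by metis
  have "ug_along u g \<gamma>" if \<gamma>: "\<gamma> \<in> rect_paths A" "line_integral \<rho> \<gamma> < \<infinity>" for \<gamma>
  proof -
    let ?L = "arc_len \<gamma> 1"
    have fin\<^sub>0: "line_integral \<rho>\<^sub>0 \<gamma> < \<infinity>" using fin[OF \<gamma>, of 0] by (simp add: f_def)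
    have "A \<noteq> {}" using rect_paths_mem(1)[OF \<gamma>(1), of 0] by auto
    then have x\<^sub>0: "x\<^sub>0 \<in> A" "x\<^sub>0 \<in> X" using open_subset[OF A] unfolding x\<^sub>0_def by (auto intro: someI)
    obtain n where n: "d x\<^sub>0 (arc_param \<gamma> 0) + ?L < real n" using reals_Archimedean2 by blast
    have eq: "h n (arc_param \<gamma> t) = g (arc_param \<gamma> t)" if "t \<in> {0..?L}" for t
    proof -
      have "d x\<^sub>0 (arc_param \<gamma> t) \<le> d x\<^sub>0 (arc_param \<gamma> 0) + d (arc_param \<gamma> 0) (arc_param \<gamma> t)"
        by (rule triangle) (use x\<^sub>0 arc_param_mem[OF \<gamma>(1)] that in auto)
      also have "d (arc_param \<gamma> 0) (arc_param \<gamma> t) \<le> ?L" using arc_param_Lipschitz[OF \<gamma>(1), of 0 t] that by auto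
      finally show ?thesis using n arc_param_mem[OF \<gamma>(1) that] x\<^sub>0 by (auto simp: h_def)
    qed
    have "line_integral g \<gamma> = line_integral (h n) \<gamma>"
      unfolding line_integral_eq by (rule nn_integral_cong) (auto simp: indicator_def eq)
    with fin[OF \<gamma>, of "Suc n"] have g_fin: "line_integral g \<gamma> < \<infinity>" by (simp add: f_def)
    have main: "\<bar>u (arc_param \<gamma> s)\<bar> \<noteq> \<infinity> \<and> \<bar>u (arc_param \<gamma> t)\<bar> \<noteq> \<infinity> \<and>
       ennreal \<bar>real_of_ereal (u (arc_param \<gamma> s)) - real_of_ereal (u (arc_param \<gamma> t))\<bar> \<le> seg_integral g \<gamma> s t"
      if st: "0 \<le> s" "s < t" "t \<le> ?L" for s t
    proof -
      obtain \<gamma>' where \<gamma>': "\<gamma>' \<in> rect_paths A" "\<gamma>' 0 = arc_param \<gamma> s" "\<gamma>' 1 = arc_param \<gamma> t"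
        "arc_len \<gamma>' 1 = t - s" "\<And>x. x \<in> {0..t - s} \<Longrightarrow> arc_param \<gamma>' x = arc_param \<gamma> (s + x)"
        by (rule subpath[OF \<gamma>(1) st, of A]) (use arc_param_mem[OF \<gamma>(1)] st in auto)
      have seg: "line_integral k \<gamma>' = seg_integral k \<gamma> s t" if "k \<in> borel_measurable (borel_on A)" for k
        by (rule line_integral_subpath[OF \<gamma>(1) that st \<gamma>'(4,5)])
      have le: "seg_integral k \<gamma> s t \<le> line_integral k \<gamma>" for k
        unfolding line_integral_eq_seg by (rule seg_integral_mono) (use st in auto)
      have "line_integral \<rho>\<^sub>0 \<gamma>' < \<infinity>"
        using seg[of \<rho>\<^sub>0] le[of \<rho>\<^sub>0] \<rho>\<^sub>0(1) fin\<^sub>0 by (auto simp: potential_def)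
      then have "\<gamma>' \<in> rect_paths A - \<Gamma>" using \<rho>\<^sub>0(2)[of \<gamma>'] \<gamma>'(1) by auto
      note ug[OF this]
      moreover have "line_integral g \<gamma>' < \<infinity>" using seg[OF g_meas] le[of g] g_fin by auto
      ultimately have "\<bar>u (\<gamma>' 0)\<bar> \<noteq> \<infinity>" "\<bar>u (\<gamma>' 1)\<bar> \<noteq> \<infinity>" "e2ennreal \<bar>u (\<gamma>' 0) - u (\<gamma>' 1)\<bar> \<le> line_integral g \<gamma>'"
        by (auto split: if_splits)
      then show ?thesis using seg[OF g_meas] by (simp add: \<gamma>' e2ennreal_abs_diff)
    qed
    \<comment> \<open>\<open>main\<close> speaks of segments of positive length, constant paths
      being excluded. Every point is an endpoint of such a segment, as the whole path has positive
      length.\<close>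
    have "\<bar>u (arc_param \<gamma> s)\<bar> \<noteq> \<infinity>" if "s \<in> {0..?L}" for s
      using main[of 0 s] main[of s ?L] arc_len_pos[OF \<gamma>(1)] that by (cases "s = 0") force+
    moreover have "ennreal \<bar>real_of_ereal (u (arc_param \<gamma> s)) - real_of_ereal (u (arc_param \<gamma> t))\<bar> \<le> seg_integral g \<gamma> s t"
      if "0 \<le> s" "s \<le> t" "t \<le> ?L" for s t
      using main[of s t] that by (cases "s = t") auto
    ultimately show ?thesis unfolding ug_along_def using g_fin by (intro conjI ballI allI impI) simp_all
  qed
  with \<rho> show ?thesis by (intro exI[of _ \<rho>] conjI ballI impI)
qed

text \<open>The paths on which \<rho> has infinite line integral form a family of modulus zero:
  every positive multiple of \<rho> is admissible for it, and small multiples have small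
  energy.\<close>

lemma weak_upper_gradientI:
  assumes q: "0 < q" and A: "openin mtopology A" and g: "g \<in> borel_measurable (borel_on A)" and \<rho>: "potential q A \<rho>"
    and ug: "\<And>\<gamma>. \<gamma> \<in> rect_paths A \<Longrightarrow> line_integral \<rho> \<gamma> < \<infinity> \<Longrightarrow>
      \<bar>u (\<gamma> 0)\<bar> \<noteq> \<infinity> \<and> \<bar>u (\<gamma> 1)\<bar> \<noteq> \<infinity> \<and>
      ennreal \<bar>real_of_ereal (u (\<gamma> 0)) - real_of_ereal (u (\<gamma> 1))\<bar> \<le> line_integral g \<gamma>"
  shows "weak_upper_gradient q A u g"
proof -
  define \<Gamma> where "\<Gamma> = {\<gamma> \<in> rect_paths A. line_integral \<rho> \<gamma> = \<infinity>}"
  have m: "\<rho> \<in> borel_measurable (borel_on A)" and fin: "(\<integral>\<^sup>+x\<in>A. epowr (\<rho> x) q \<partial>\<mu>) < \<infinity>"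
    using \<rho> by (auto simp: potential_def)
  have "modulus q A \<Gamma> \<le> 0 + ennreal e" if e: "0 < e" for e
  proof -
    obtain c where c: "0 < c" "ennreal (c powr q) * (\<integral>\<^sup>+x\<in>A. epowr (\<rho> x) q \<partial>\<mu>) \<le> ennreal e"
      using exists_small_factor[OF q fin e] by blast
    have "modulus q A \<Gamma> \<le> (\<integral>\<^sup>+x\<in>A. epowr (ennreal c * \<rho> x) q \<partial>\<mu>)"
      unfolding modulus_def
    proof (rule INF_lower, safe)
      show "(\<lambda>x. ennreal c * \<rho> x) \<in> borel_measurable (borel_on A)" using m by measurable
      fix \<gamma> assume "\<gamma> \<in> \<Gamma>"
      then show "1 \<le> line_integral (\<lambda>x. ennreal c * \<rho> x) \<gamma>"
        using line_integral_cmult[OF _ m, of \<gamma> "ennreal c"] c by (simp add: \<Gamma>_def ennreal_mult_top)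
    qed
    also have "\<dots> \<le> ennreal e" unfolding nn_integral_epowr_cmult[OF A m c(1)] by (rule c(2))
    finally show ?thesis by simp
  qed
  then have "modulus q A \<Gamma> \<le> 0" by (rule ennreal_le_epsilon)
  then have "modulus q A \<Gamma> = 0" by simp
  moreover have "\<Gamma> \<subseteq> rect_paths A" by (auto simp: \<Gamma>_def)
  moreover have "if \<bar>u (\<gamma> 0)\<bar> = \<infinity> \<or> \<bar>u (\<gamma> 1)\<bar> = \<infinity> then line_integral g \<gamma> = \<infinity>
      else e2ennreal \<bar>u (\<gamma> 0) - u (\<gamma> 1)\<bar> \<le> line_integral g \<gamma>" if "\<gamma> \<in> rect_paths A - \<Gamma>" for \<gamma>
  proof -
    have "\<gamma> \<in> rect_paths A" "line_integral \<rho> \<gamma> < \<infinity>" using that by (auto simp: \<Gamma>_def less_top)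
    note ug[OF this]
    then show ?thesis by (simp add: e2ennreal_abs_diff)
  qed
  ultimately show ?thesis unfolding weak_upper_gradient_def
    using g by (intro conjI exI[of _ \<Gamma>] ballI)
qed

text \<open>Outside one exceptional family both inequalities hold on all segments of the path, which
  is what \<open>dist_le_integral_min\<close> requires of \<open>u\<close> along the arc length
  parametrization.\<close>

lemma weak_upper_gradient_min:
  assumes q: "0 < q" and A: "openin mtopology A" and "weak_upper_gradient q A u g\<^sub>1" "q_integrable_bdd q A g\<^sub>1"
    and "weak_upper_gradient q A u g\<^sub>2" "q_integrable_bdd q A g\<^sub>2"
  shows "weak_upper_gradient q A u (\<lambda>x. min (g\<^sub>1 x) (g\<^sub>2 x))"
proof -
  obtain \<rho>\<^sub>1 where 1: "potential q A \<rho>\<^sub>1" "\<And>\<gamma>. \<gamma>\<in>rect_paths A \<Longrightarrow> line_integral \<rho>\<^sub>1 \<gamma> < \<infinity> \<Longrightarrow> ug_along u g\<^sub>1 \<gamma>"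
    using weak_upper_gradient_potential[OF q A assms(3,4)] by blast
  obtain \<rho>\<^sub>2 where 2: "potential q A \<rho>\<^sub>2" "\<And>\<gamma>. \<gamma>\<in>rect_paths A \<Longrightarrow> line_integral \<rho>\<^sub>2 \<gamma> < \<infinity> \<Longrightarrow> ug_along u g\<^sub>2 \<gamma>"
    using weak_upper_gradient_potential[OF q A assms(5,6)] by blast
  define f where "f n = (if n = (0::nat) then \<rho>\<^sub>1 else \<rho>\<^sub>2)" for n
  have "potential q A (f n)" for n using 1(1) 2(1) by (simp add: f_def)
  then obtain \<rho> where \<rho>: "potential q A \<rho>"
    and fin: "\<And>\<gamma> n. \<gamma> \<in> rect_paths A \<Longrightarrow> line_integral \<rho> \<gamma> < \<infinity> \<Longrightarrow> line_integral (f n) \<gamma> < \<infinity>"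
    using potential_countable[OF q A, of f] by metis
  have m: "g\<^sub>1 \<in> borel_measurable (borel_on A)" "g\<^sub>2 \<in> borel_measurable (borel_on A)"
    using assms(3,5) by (auto simp: weak_upper_gradient_def)
  show ?thesis
  proof (rule weak_upper_gradientI[OF q A _ \<rho>])
    show "(\<lambda>x. min (g\<^sub>1 x) (g\<^sub>2 x)) \<in> borel_measurable (borel_on A)" using m by measurable
    fix \<gamma> assume \<gamma>: "\<gamma> \<in> rect_paths A" "line_integral \<rho> \<gamma> < \<infinity>"
    let ?L = "arc_len \<gamma> 1"
    let ?f = "\<lambda>t. real_of_ereal (u (arc_param \<gamma> t))"
    have ug: "ug_along u g\<^sub>1 \<gamma>" "ug_along u g\<^sub>2 \<gamma>"
      using 1(2)[OF \<gamma>(1)] 2(2)[OF \<gamma>(1)] fin[OF \<gamma>, of 0] fin[OF \<gamma>, of 1] by (auto simp: f_def)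
    have L: "0 \<le> ?L" using arc_len_pos[OF \<gamma>(1)] by simp
    have "ennreal \<bar>?f 0 - ?f ?L\<bar> \<le> (\<integral>\<^sup>+x\<in>{0..?L}. min (g\<^sub>1 (arc_param \<gamma> x)) (g\<^sub>2 (arc_param \<gamma> x)) \<partial>lborel)"
      by (rule dist_le_integral_min[where f="?f"])
         (use ug L in \<open>auto simp: ug_along_def line_integral_eq_seg seg_integral_def
            intro!: borel_measurable_arc_param[OF \<gamma>(1), simplified] m\<close>)
    then show "\<bar>u (\<gamma> 0)\<bar> \<noteq> \<infinity> \<and> \<bar>u (\<gamma> 1)\<bar> \<noteq> \<infinity> \<and>
      ennreal \<bar>real_of_ereal (u (\<gamma> 0)) - real_of_ereal (u (\<gamma> 1))\<bar> \<le> line_integral (\<lambda>x. min (g\<^sub>1 x) (g\<^sub>2 x)) \<gamma>"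
      using ug(1) L arc_param_endpoints[OF \<gamma>(1)] unfolding ug_along_def line_integral_eq
      by (metis atLeastAtMost_iff order_refl)
  qed
qed

text \<open>Along almost every path \<open>g 0\<close> has finite integral, so that monotone
  convergence for decreasing sequences carries the line integrals to the limit, while the endpoint
  values of \<open>u\<close> do not depend on \<open>n\<close>.\<close>

lemma weak_upper_gradient_INF:
  assumes q: "0 < q" and A: "openin mtopology A" and g: "\<And>n::nat. weak_upper_gradient q A u (g n)" "\<And>n. q_integrable_bdd q A (g n)"
    and dec: "\<And>n x. g (Suc n) x \<le> g n x"
  shows "weak_upper_gradient q A u (\<lambda>x. INF n. g n x)"
proof -
  obtain f where f: "\<And>n. potential q A (f n)" "\<And>n \<gamma>. \<gamma>\<in>rect_paths A \<Longrightarrow> line_integral (f n) \<gamma> < \<infinity> \<Longrightarrow> ug_along u (g n) \<gamma>"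
    using weak_upper_gradient_potential[OF q A g] by metis
  obtain \<rho> where \<rho>: "potential q A \<rho>"
    and fin: "\<And>\<gamma> n. \<gamma> \<in> rect_paths A \<Longrightarrow> line_integral \<rho> \<gamma> < \<infinity> \<Longrightarrow> line_integral (f n) \<gamma> < \<infinity>"
    using potential_countable[of q A f, OF q A f(1)] by metis
  have m: "g n \<in> borel_measurable (borel_on A)" for n
    using g by (auto simp: weak_upper_gradient_def)
  show ?thesis
  proof (rule weak_upper_gradientI[OF q A _ \<rho>])
    show "(\<lambda>x. INF n. g n x) \<in> borel_measurable (borel_on A)" using m by measurable
    fix \<gamma> assume \<gamma>: "\<gamma> \<in> rect_paths A" "line_integral \<rho> \<gamma> < \<infinity>"
    let ?L = "arc_len \<gamma> 1"
    have L: "0 \<le> ?L" using arc_len_pos[OF \<gamma>(1)] by simp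
    have ug: "ug_along u (g n) \<gamma>" for n by (rule f(2)[OF \<gamma>(1) fin[OF \<gamma>]])
    have "line_integral (\<lambda>x. INF n. g n x) \<gamma> = (\<integral>\<^sup>+t. (INF n. g n (arc_param \<gamma> t) * indicator {0..?L} t) \<partial>lborel)"
      unfolding line_integral_eq
    proof (rule nn_integral_cong)
      fix t show "(INF n. g n (arc_param \<gamma> t)) * indicator {0..?L} t = (INF n. g n (arc_param \<gamma> t) * indicator {0..?L} t)"
        by (cases "t \<in> {0..?L}") simp_all
    qed
    also have "\<dots> = (INF n. line_integral (g n) \<gamma>)"
      unfolding line_integral_eq
    proof (rule nn_integral_monotone_convergence_INF_decseq[where f="\<lambda>n t. g n (arc_param \<gamma> t) * indicator {0..?L} t" and i=0])
      show "decseq (\<lambda>n t. g n (arc_param \<gamma> t) * indicator {0..?L} t)"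
        by (intro decseq_SucI le_funI mult_right_mono dec) simp
      show "(\<lambda>t. g i (arc_param \<gamma> t) * indicator {0..?L} t) \<in> borel_measurable lborel" for i
        using borel_measurable_arc_param[OF \<gamma>(1) m, of 0 ?L] by simp
      show "(\<integral>\<^sup>+t. g 0 (arc_param \<gamma> t) * indicator {0..?L} t \<partial>lborel) < \<infinity>"
        using ug[of 0] by (simp add: ug_along_def line_integral_eq)
    qed
    finally have eq: "line_integral (\<lambda>x. INF n. g n x) \<gamma> = (INF n. line_integral (g n) \<gamma>)" .
    have ends: "\<bar>u (\<gamma> 0)\<bar> \<noteq> \<infinity> \<and> \<bar>u (\<gamma> 1)\<bar> \<noteq> \<infinity> \<and>
      ennreal \<bar>real_of_ereal (u (\<gamma> 0)) - real_of_ereal (u (\<gamma> 1))\<bar> \<le> line_integral (g n) \<gamma>" for n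
      using ug[of n] L arc_param_endpoints[OF \<gamma>(1)] unfolding ug_along_def line_integral_eq_seg
      by (metis atLeastAtMost_iff order_refl)
    have "ennreal \<bar>real_of_ereal (u (\<gamma> 0)) - real_of_ereal (u (\<gamma> 1))\<bar> \<le> (INF n. line_integral (g n) \<gamma>)"
      by (rule INF_greatest) (use ends in blast)
    with ends[of 0] show "\<bar>u (\<gamma> 0)\<bar> \<noteq> \<infinity> \<and> \<bar>u (\<gamma> 1)\<bar> \<noteq> \<infinity> \<and>
      ennreal \<bar>real_of_ereal (u (\<gamma> 0)) - real_of_ereal (u (\<gamma> 1))\<bar> \<le> line_integral (\<lambda>x. INF n. g n x) \<gamma>"
      unfolding eq by (elim conjE) (intro conjI)
  qed
qed

lemma q_integrable_bdd_mono:
  assumes "0 < q" "q_integrable_bdd q A g" "\<And>x. x \<in> A \<Longrightarrow> f x \<le> g x"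
  shows "q_integrable_bdd q A f"
  unfolding q_integrable_bdd_def
proof (intro ballI impI)
  fix E assume E: "E \<in> sets \<mu>" "E \<subseteq> A \<and> mbounded E"
  have "(\<integral>\<^sup>+x\<in>E. epowr (f x) q \<partial>\<mu>) \<le> (\<integral>\<^sup>+x\<in>E. epowr (g x) q \<partial>\<mu>)"
    by (rule nn_integral_mono) (use E assms in \<open>auto simp: indicator_def intro!: epowr_mono\<close>)
  also have "\<dots> < \<infinity>" using assms(2) E by (simp add: q_integrable_bdd_def)
  finally show "(\<integral>\<^sup>+x\<in>E. epowr (f x) q \<partial>\<mu>) < \<infinity>" .
qed

end

lemma ennreal_le_suminf: "f n \<le> (\<Sum>n. f n)" for f :: "nat \<Rightarrow> ennreal"
  using sum_le_suminf[of f "{n}"] by simp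

context borel_regular_space
begin

text \<open>A decreasing sequence that minimizes the \<open>q\<close>-energy with respect to a weight \<open>w\<close> for which
  \<open>g\<^sub>0\<close> has finite energy.\<close>

lemma exists_minimal_weak_ug:
  assumes q: "0 < q" and A: "openin mtopology A" and g\<^sub>0: "weak_upper_gradient q A u g\<^sub>0" "q_integrable_bdd q A g\<^sub>0"
  shows "\<exists>g. minimal_weak_ug q A u g"
proof -
  define x\<^sub>0 where "x\<^sub>0 = (SOME x. x \<in> A)"
  define E where "E n = mball x\<^sub>0 (real n) \<inter> A" for n
  have E: "E n \<in> sets \<mu>" "E n \<subseteq> A" "mbounded (E n)" for n
    using open_measurable[OF A] by (auto simp: E_def intro: mbounded_subset[OF mbounded_mball])
  have cover: "\<exists>n. x \<in> E n" if x: "x \<in> A" for x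
  proof -
    have "x\<^sub>0 \<in> A" unfolding x\<^sub>0_def by (rule someI[where P="\<lambda>x. x \<in> A"]) (rule x)
    moreover obtain n where "d x\<^sub>0 x < real n" using reals_Archimedean2 by blast
    ultimately show ?thesis using x open_subset[OF A] by (auto simp: E_def)
  qed
  have fin: "(\<integral>\<^sup>+x\<in>E n. epowr (g\<^sub>0 x) q \<partial>\<mu>) < \<infinity>" for n
    using g\<^sub>0(2) E[of n] unfolding q_integrable_bdd_def by blast
  have "\<exists>c>0. ennreal c * (\<integral>\<^sup>+x\<in>E n. epowr (g\<^sub>0 x) q \<partial>\<mu>) \<le> ennreal ((1/2)^n) \<and> c \<le> (1/2)^n" for n
  proof -
    have "\<exists>c>0. ennreal (c powr 1) * (\<integral>\<^sup>+x\<in>E n. epowr (g\<^sub>0 x) q \<partial>\<mu>) \<le> ennreal ((1/2)^n)"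
      by (rule exists_small_factor) (simp_all add: fin[unfolded infinity_ennreal_def])
    then obtain c where c: "0 < c" "ennreal (c powr 1) * (\<integral>\<^sup>+x\<in>E n. epowr (g\<^sub>0 x) q \<partial>\<mu>) \<le> ennreal ((1/2)^n)"
      by (elim exE conjE)
    let ?c = "min c ((1/2)^n)"
    have "ennreal ?c * (\<integral>\<^sup>+x\<in>E n. epowr (g\<^sub>0 x) q \<partial>\<mu>) \<le> ennreal c * (\<integral>\<^sup>+x\<in>E n. epowr (g\<^sub>0 x) q \<partial>\<mu>)"
      by (intro mult_right_mono ennreal_leI) auto
    also have "\<dots> \<le> ennreal ((1/2)^n)" using c by simp
    finally show ?thesis using c(1) by (intro exI[of _ ?c] conjI) simp_all
  qed
  then obtain c where c: "\<And>n. 0 < c n" "\<And>n. ennreal (c n) * (\<integral>\<^sup>+x\<in>E n. epowr (g\<^sub>0 x) q \<partial>\<mu>) \<le> ennreal ((1/2)^n)"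
    "\<And>n. c n \<le> (1/2)^n"
    by metis
  \<comment> \<open>The weight is positive on \<open>A\<close>, so that energies still detect
    pointwise differences, and finite, so that it can be cancelled.\<close>
  define w where "w x = (\<Sum>n. ennreal (c n) * indicator (E n) x)" for x
  have w_meas [measurable]: "w \<in> borel_measurable \<mu>" unfolding w_def using E(1) by measurable
  have w_fin: "w x < \<infinity>" for x
  proof -
    have "w x \<le> (\<Sum>n. ennreal ((1/2)^n))"
      unfolding w_def by (intro suminf_le) (auto simp: indicator_def c(3) ennreal_leI)
    then show ?thesis using suminf_half by (rule le_less_trans)
  qed
  have w_pos: "0 < w x" if x: "x \<in> A" for x
  proof -
    obtain n where n: "x \<in> E n" using cover[OF x] by blast
    have "0 < ennreal (c n) * indicator (E n) x" using n c(1)[of n] by simp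
    also have "\<dots> \<le> w x" unfolding w_def by (rule ennreal_le_suminf)
    finally show ?thesis .
  qed
  have w_0: "w x = 0" if "x \<notin> A" for x
  proof -
    have "indicator (E n) x = (0::ennreal)" for n using E(2)[of n] that by (auto simp: indicator_def)
    then show ?thesis by (simp add: w_def)
  qed
  define J where "J g = (\<integral>\<^sup>+x. epowr (g x) q * indicator A x * w x \<partial>\<mu>)" for g
  have "J g\<^sub>0 = (\<integral>\<^sup>+x. (\<Sum>n. ennreal (c n) * (epowr (g\<^sub>0 x) q * indicator A x * indicator (E n) x)) \<partial>\<mu>)"
    unfolding J_def w_def by (rule nn_integral_cong) (simp add: ennreal_suminf_cmult[symmetric] mult_ac)
  also have "\<dots> = (\<Sum>n. \<integral>\<^sup>+x. ennreal (c n) * (epowr (g\<^sub>0 x) q * indicator A x * indicator (E n) x) \<partial>\<mu>)"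
    by (rule nn_integral_suminf)
       (use E(1) measurable_epowr_indicator[OF A, of g\<^sub>0 q] g\<^sub>0(1) in \<open>simp add: weak_upper_gradient_def\<close>)
  also have "\<dots> \<le> (\<Sum>n. ennreal ((1/2)^n))"
  proof (rule suminf_le)
    fix n
    have "(\<integral>\<^sup>+x. ennreal (c n) * (epowr (g\<^sub>0 x) q * indicator A x * indicator (E n) x) \<partial>\<mu>) =
      ennreal (c n) * (\<integral>\<^sup>+x. epowr (g\<^sub>0 x) q * indicator A x * indicator (E n) x \<partial>\<mu>)"
      by (rule nn_integral_cmult)
         (use E(1) measurable_epowr_indicator[OF A, of g\<^sub>0 q] g\<^sub>0(1) in \<open>simp add: weak_upper_gradient_def\<close>)
    also have "(\<integral>\<^sup>+x. epowr (g\<^sub>0 x) q * indicator A x * indicator (E n) x \<partial>\<mu>) = (\<integral>\<^sup>+x\<in>E n. epowr (g\<^sub>0 x) q \<partial>\<mu>)"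
      by (rule nn_integral_cong) (use E(2)[of n] in \<open>auto simp: indicator_def\<close>)
    finally show "(\<integral>\<^sup>+x. ennreal (c n) * (epowr (g\<^sub>0 x) q * indicator A x * indicator (E n) x) \<partial>\<mu>) \<le> ennreal ((1/2)^n)"
      using c(2)[of n] by simp
  qed auto
  finally have J_fin: "J g\<^sub>0 < \<infinity>" using suminf_half by (rule le_less_trans)
  \<comment> \<open>Competitors below \<open>g\<^sub>0\<close> have finite weighted energy. Any
    other competitor enters through its minimum with a member of \<open>G\<close>.\<close>
  define G where "G = {g. weak_upper_gradient q A u g \<and> (\<forall>x. g x \<le> g\<^sub>0 x)}"
  have G_int: "q_integrable_bdd q A g" if "g \<in> G" for g
    by (rule q_integrable_bdd_mono[OF q g\<^sub>0(2)]) (use that in \<open>simp add: G_def\<close>)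
  have G_min: "(\<lambda>x. min (g x) (g' x)) \<in> G" if g: "g \<in> G" and g': "weak_upper_gradient q A u g'" "q_integrable_bdd q A g'" for g g'
  proof -
    have "weak_upper_gradient q A u (\<lambda>x. min (g x) (g' x))"
      by (rule weak_upper_gradient_min[OF q A _ G_int[OF g] g']) (use g in \<open>simp add: G_def\<close>)
    then show ?thesis using g by (simp add: G_def min.coboundedI1)
  qed
  have J_mono: "J g \<le> J g'" if "\<And>x. g x \<le> g' x" for g g'
    unfolding J_def using that q by (intro nn_integral_mono mult_right_mono epowr_mono) auto
  have "g\<^sub>0 \<in> G" using g\<^sub>0 by (simp add: G_def)
  then have "G \<noteq> {}" by auto
  from ennreal_Inf_countable_INF[of "J ` G"] this
  obtain a :: "nat \<Rightarrow> ennreal" where a: "decseq a" "range a \<subseteq> J ` G" "Inf (J ` G) = (INF i. a i)"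
    by auto
  from a(2) have "\<exists>g\<in>G. a n = J g" for n by auto
  then obtain f where f: "\<And>n. f n \<in> G" "\<And>n. a n = J (f n)" by metis
  \<comment> \<open>Running minima turn the minimizing sequence into a decreasing one, whose
    energies are no larger.\<close>
  define h where "h = rec_nat (f 0) (\<lambda>n g x. min (g x) (f (Suc n) x))"
  have h_Suc: "h (Suc n) = (\<lambda>x. min (h n x) (f (Suc n) x))" for n by (simp add: h_def)
  have h: "h n \<in> G" for n
  proof (induction n)
    case 0 show ?case using f by (simp add: h_def)
  next
    case (Suc n)
    have "weak_upper_gradient q A u (f (Suc n))" using f(1)[of "Suc n"] by (simp add: G_def)
    from G_min[OF Suc this G_int[OF f(1)]] show ?case by (simp add: h_Suc)
  qed
  have h_le: "h n x \<le> f n x" for n x by (cases n) (simp_all add: h_Suc, simp add: h_def)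
  define k where "k x = (INF n. h n x)" for x
  have k_ug: "weak_upper_gradient q A u k"
    unfolding k_def by (rule weak_upper_gradient_INF[OF q A _ G_int[OF h]]) (use h in \<open>auto simp: G_def h_Suc\<close>)
  have k_le: "k x \<le> h n x" for n x unfolding k_def by (rule INF_lower) simp
  have kG: "k \<in> G" using k_ug order_trans[OF k_le[of _ 0]] h[of 0] by (simp add: G_def)
  have "J k \<le> a n" for n unfolding f(2) by (rule J_mono) (rule order_trans[OF k_le h_le])
  then have "J k \<le> (INF n. a n)" by (rule INF_greatest)
  then have k_min: "J k \<le> J g" if "g \<in> G" for g
    unfolding a(3)[symmetric] by (rule order_trans) (rule INF_lower[OF that])
  have "AE x in \<mu>. x \<in> A \<longrightarrow> k x \<le> g' x" if g': "weak_upper_gradient q A u g'" "q_integrable_bdd q A g'" for g'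
  proof -
    \<comment> \<open>As \<open>k\<close> minimizes the energy and \<open>m\<close> is a competitor
      below \<open>k\<close>, their finite energies agree, which forces \<open>k = m\<close> almost
      everywhere on \<open>A\<close>.\<close>
    define m where "m x = min (k x) (g' x)" for x
    have m: "m \<in> G" unfolding m_def by (rule G_min[OF kG g'])
    have meas: "(\<lambda>x. epowr (k x) q * indicator A x) \<in> borel_measurable \<mu>" "(\<lambda>x. epowr (m x) q * indicator A x) \<in> borel_measurable \<mu>"
      using kG m by (auto simp: G_def weak_upper_gradient_def intro!: measurable_epowr_indicator[OF A])
    have Jm: "J m \<le> J k" by (rule J_mono) (simp add: m_def)
    have "J m < \<infinity>" using J_mono[of m g\<^sub>0] m J_fin by (auto simp: G_def)
    have "(\<integral>\<^sup>+x. (epowr (k x) q * indicator A x * w x - epowr (m x) q * indicator A x * w x) \<partial>\<mu>) = J k - J m"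
      unfolding J_def
    proof (rule nn_integral_diff)
      show "(\<integral>\<^sup>+x. epowr (m x) q * indicator A x * w x \<partial>\<mu>) \<noteq> \<infinity>" using \<open>J m < \<infinity>\<close> by (simp add: J_def less_top)
      show "AE x in \<mu>. epowr (m x) q * indicator A x * w x \<le> epowr (k x) q * indicator A x * w x"
        by (intro AE_I2 mult_right_mono epowr_mono) (use q in \<open>auto simp: m_def\<close>)
    qed (use meas in measurable)
    also have "\<dots> = 0" using k_min[OF m] by (simp add: diff_eq_0_iff_ennreal Jm le_less_trans[OF k_min[OF m] \<open>J m < \<infinity>\<close>[unfolded infinity_ennreal_def]])
    finally have "AE x in \<mu>. epowr (k x) q * indicator A x * w x - epowr (m x) q * indicator A x * w x = 0"
      using meas by (subst (asm) nn_integral_0_iff_AE) auto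
    moreover have "AE x in \<mu>. epowr (m x) q * indicator A x * w x \<noteq> \<infinity>"
      by (rule nn_integral_noteq_infinite) (use meas \<open>J m < \<infinity>\<close> in \<open>auto simp: J_def less_top\<close>)
    ultimately show ?thesis
    proof eventually_elim
      case (elim x)
      show ?case
      proof
        assume x: "x \<in> A"
        have "epowr (k x) q * w x \<le> epowr (m x) q * w x"
          using elim x by (auto simp: diff_eq_0_iff_ennreal top_unique)
        then have "epowr (k x) q \<le> epowr (m x) q"
          using w_pos[OF x] w_fin[of x] by (simp add: ennreal_mult_le_mult_iff mult.commute[of _ "w x"])
        then have "k x \<le> m x" using q by (simp add: epowr_le_iff)
        then show "k x \<le> g' x" by (simp add: m_def)
      qed
    qed
  qed
  then show ?thesis using k_ug G_int[OF kG] unfolding minimal_weak_ug_def by (intro exI[of _ k]) blast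
qed

end

section \<open>Truncations\<close>

text \<open>The gradient of a truncation is set to zero away from the superlevel set, so that
  oscillation bounds are available only on segments where \<open>f\<close> is positive. Up to its
  first zero \<open>f\<close> is positive, which bounds \<open>f 0\<close> itself by
  \<open>c\<close>; without a zero the whole interval is such a segment.\<close>

lemma diff_le_of_positive_segments:
  fixes f :: "real \<Rightarrow> real"
  assumes "0 \<le> L" "continuous_on {0..L} f" "\<And>x. x \<in> {0..L} \<Longrightarrow> 0 \<le> f x" "0 \<le> c"
    and seg: "\<And>s t. 0 \<le> s \<Longrightarrow> s \<le> t \<Longrightarrow> t \<le> L \<Longrightarrow> (\<And>x. x \<in> {s..t} \<Longrightarrow> 0 < f x) \<Longrightarrow> \<bar>f s - f t\<bar> \<le> c"
  shows "f 0 - f L \<le> c"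
proof -
  define Z where "Z = {x \<in> {0..L}. f x = 0}"
  show ?thesis
  proof (cases "Z = {}")
    case True
    then have "0 < f x" if "x \<in> {0..L}" for x using assms(3)[OF that] that by (force simp: Z_def)
    from seg[of 0 L, OF _ _ _ this] assms(1) show ?thesis by simp
  next
    case False
    have "closed Z" unfolding Z_def
      using continuous_closed_preimage_constant[OF assms(2), of 0] by simp
    moreover have bdd: "bdd_below Z" by (rule bdd_belowI[of _ 0]) (simp add: Z_def)
    ultimately have T: "Inf Z \<in> Z" using closed_contains_Inf[OF False] by blast
    define T where "T = Inf Z"
    have T': "T \<in> {0..L}" "f T = 0" using T by (auto simp: Z_def T_def)
    have pos: "0 < f x" if "0 \<le> x" "x < T" for x
    proof -
      have "x \<notin> Z" using that cInf_lower[OF _ bdd, of x] by (auto simp: T_def)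
      then show ?thesis using assms(3)[of x] that T'(1) by (force simp: Z_def)
    qed
    have "f 0 \<le> c"
    proof (rule ccontr)
      assume "\<not> f 0 \<le> c"
      then have gt: "c < f 0" by simp
      \<comment> \<open>This value is positive, so that it is attained before the first zero, and
        \<open>f 0\<close> exceeds it by \<open>(f 0 + c) / 2\<close>, which is more than
        \<open>c\<close>.\<close>
      have "\<exists>t\<ge>0. t \<le> T \<and> f t = (f 0 - c) / 2"
      proof (rule IVT2')
        show "continuous_on {0..T} f" by (rule continuous_on_subset[OF assms(2)]) (use T' in auto)
      qed (use T' gt assms(4) in auto)
      then obtain t where t: "0 \<le> t" "t \<le> T" "f t = (f 0 - c) / 2" by blast
      have "t < T" using t T'(2) gt by (cases "t = T") auto
      have "\<bar>f 0 - f t\<bar> \<le> c"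
        by (rule seg) (use t(1) \<open>t < T\<close> T' in \<open>auto intro!: pos\<close>)
      then show False using t(3) gt by (auto simp: field_simps)
    qed
    then show ?thesis using assms(3)[of L] assms(1) by simp
  qed
qed

lemma abs_diff_le_of_positive_segments:
  fixes f :: "real \<Rightarrow> real"
  assumes L: "0 \<le> L" and cont: "continuous_on {0..L} f" and nonneg: "\<And>x. x \<in> {0..L} \<Longrightarrow> 0 \<le> f x" and "0 \<le> c"
    and seg: "\<And>s t. 0 \<le> s \<Longrightarrow> s \<le> t \<Longrightarrow> t \<le> L \<Longrightarrow> (\<And>x. x \<in> {s..t} \<Longrightarrow> 0 < f x) \<Longrightarrow> \<bar>f s - f t\<bar> \<le> c"
  shows "\<bar>f 0 - f L\<bar> \<le> c"
proof -
  have "f 0 - f L \<le> c" by (rule diff_le_of_positive_segments[of L f c]) (use assms in auto)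
  \<comment> \<open>Running through the interval backwards gives the other sign.\<close>
  moreover have "f (L - 0) - f (L - L) \<le> c"
  proof (rule diff_le_of_positive_segments[of L "\<lambda>x. f (L - x)" c])
    show "continuous_on {0..L} (\<lambda>x. f (L - x))"
      by (rule continuous_on_compose2[OF cont]) (auto intro!: continuous_intros)
    fix s t assume st: "0 \<le> s" "s \<le> t" "t \<le> L" and pos: "\<And>x. x \<in> {s..t} \<Longrightarrow> 0 < f (L - x)"
    have "\<bar>f (L - t) - f (L - s)\<bar> \<le> c"
    proof (rule seg)
      fix x assume "x \<in> {L - t..L - s}"
      then show "0 < f x" using pos[of "L - x"] by auto
    qed (use st in auto)
    then show "\<bar>f (L - s) - f (L - t)\<bar> \<le> c" by (simp add: abs_minus_commute)
  qed (use assms in auto)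
  ultimately show ?thesis by (simp add: abs_le_iff)
qed

lemma abs_max_min_diff_le:
  fixes a b a' b' :: real
  shows "\<bar>max 0 (min a b) - max 0 (min a' b')\<bar> \<le> \<bar>a - a'\<bar> + \<bar>b - b'\<bar>"
  by (auto simp: max_def min_def)

context Metric_space
begin

definition cutoff :: "'a \<Rightarrow> real \<Rightarrow> real \<Rightarrow> 'a \<Rightarrow> real" where
  "cutoff y \<rho> R x = max 0 (min 1 ((R - d x y) / (R - \<rho>)))"

lemma cutoff_eq_1: "\<rho> < R \<Longrightarrow> d x y \<le> \<rho> \<Longrightarrow> cutoff y \<rho> R x = 1"
  by (simp add: cutoff_def field_simps)

lemma cutoff_eq_0: "\<rho> < R \<Longrightarrow> R \<le> d x y \<Longrightarrow> cutoff y \<rho> R x = 0"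
  by (simp add: cutoff_def field_simps)

lemma cutoff_bounds: "0 \<le> cutoff y \<rho> R x" "cutoff y \<rho> R x \<le> 1"
  by (auto simp: cutoff_def)

lemma cutoff_Lipschitz:
  assumes "\<rho> < R" "x \<in> M" "z \<in> M" "y \<in> M"
  shows "\<bar>cutoff y \<rho> R x - cutoff y \<rho> R z\<bar> \<le> d x z / (R - \<rho>)"
proof -
  have "\<bar>cutoff y \<rho> R x - cutoff y \<rho> R z\<bar> \<le> \<bar>(R - d x y) / (R - \<rho>) - (R - d z y) / (R - \<rho>)\<bar>"
    unfolding cutoff_def using abs_max_min_diff_le[of 1 "(R - d x y) / (R - \<rho>)" 1 "(R - d z y) / (R - \<rho>)"] by simp
  also have "\<dots> = \<bar>d z y - d x y\<bar> / (R - \<rho>)" using assms(1) by (simp add: diff_divide_distrib[symmetric])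
  also have "\<dots> \<le> d x z / (R - \<rho>)"
    using assms triangle[of x z y] triangle[of z x y] by (intro divide_right_mono) (auto simp: commute abs_le_iff)
  finally show ?thesis .
qed

end

context borel_regular_space
begin

lemma ug_along_endpoints:
  assumes "ug_along u g \<gamma>" "\<gamma> \<in> rect_paths A"
  shows "line_integral g \<gamma> < \<infinity>" "\<bar>u (arc_param \<gamma> 0)\<bar> \<noteq> \<infinity>" "\<bar>u (arc_param \<gamma> (arc_len \<gamma> 1))\<bar> \<noteq> \<infinity>"
    "ennreal \<bar>real_of_ereal (u (arc_param \<gamma> 0)) - real_of_ereal (u (arc_param \<gamma> (arc_len \<gamma> 1)))\<bar> \<le> line_integral g \<gamma>"
  using assms(1) arc_len_pos[OF assms(2)] unfolding ug_along_def line_integral_eq_seg by (simp_all del: abs_ereal_less0)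

text \<open>For \<open>k \<le> h\<close> the argument of \<open>real_of_ereal\<close> lies between 0
  and \<open>h - k\<close> even where \<open>u\<close> is infinite, so that nothing is lost. Values
  of \<open>u\<close> are meaningful only on \<Omega>, hence the explicit zero outside the ball, to
  which the cutoff leads continuously.\<close>

definition truncation :: "('a \<Rightarrow> ereal) \<Rightarrow> real \<Rightarrow> real \<Rightarrow> 'a \<Rightarrow> real \<Rightarrow> real \<Rightarrow> 'a \<Rightarrow> real" where
  "truncation u k h y \<rho> R x = (if x \<in> mball y R
     then real_of_ereal (max 0 (min (u x - ereal k) (ereal ((h - k) * cutoff y \<rho> R x)))) else 0)"

lemma truncation_bounds:
  assumes "k \<le> h"
  shows "0 \<le> truncation u k h y \<rho> R x" "truncation u k h y \<rho> R x \<le> h - k"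
proof -
  let ?c = "(h - k) * cutoff y \<rho> R x"
  have c: "0 \<le> ?c" "?c \<le> h - k" using assms cutoff_bounds[of y \<rho> R x] mult_left_mono[of _ 1 "h - k"] by auto
  have "0 \<le> real_of_ereal (max 0 (min v (ereal ?c))) \<and> real_of_ereal (max 0 (min v (ereal ?c))) \<le> h - k" for v
    using c assms by (cases v) (auto simp: min_def max_def)
  then show "0 \<le> truncation u k h y \<rho> R x" "truncation u k h y \<rho> R x \<le> h - k"
    using assms by (auto simp: truncation_def)
qed

lemma truncation_eq_top:
  assumes "k < h" "\<rho> < R" "x \<in> mball y \<rho>" "ereal h \<le> u x"
  shows "truncation u k h y \<rho> R x = h - k"
proof -
  have "x \<in> mball y R" "cutoff y \<rho> R x = 1"
    using assms by (auto simp: commute intro!: cutoff_eq_1)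
  then show ?thesis using assms by (cases "u x") (auto simp: truncation_def min_def max_def)
qed

lemma truncation_pos:
  assumes "0 < truncation u k h y \<rho> R x"
  shows "x \<in> mball y R" "ereal k < u x"
  using assms by (cases "u x"; auto simp: truncation_def min_def max_def split: if_splits)+

lemma truncation_real:
  assumes "\<rho> < R" "x \<in> X" "y \<in> X" "\<bar>u x\<bar> \<noteq> \<infinity>"
  shows "truncation u k h y \<rho> R x = max 0 (min (real_of_ereal (u x) - k) ((h - k) * cutoff y \<rho> R x))"
proof (cases "x \<in> mball y R")
  case True
  then show ?thesis using assms by (cases "u x") (auto simp: truncation_def min_def max_def)
next
  case False
  then have "cutoff y \<rho> R x = 0" using assms by (intro cutoff_eq_0) (auto simp: commute)
  then show ?thesis unfolding truncation_def if_not_P[OF False] by simp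
qed

text \<open>The superlevel set need not be Borel, as \<open>u\<close> is only measurable; hence the Borel set \<open>B\<close>.
  Taking a minimum with the cutoff, instead of a product, makes a Leibniz rule unnecessary.\<close>

lemma weak_upper_gradient_truncation:
  assumes q: "0 < q" and \<Omega>: "openin mtopology \<Omega>" and y: "y \<in> X" and R: "\<rho> < R" "R < R'" "mball y R' \<subseteq> \<Omega>" and kh: "k < h"
    and g: "weak_upper_gradient q \<Omega> u g" "q_integrable_bdd q \<Omega> g"
    and B: "B \<in> sets (borel_on X)" "{x \<in> mball y R. ereal k < u x} \<subseteq> B"
  shows "weak_upper_gradient q X (\<lambda>x. ereal (truncation u k h y \<rho> R x))
    (\<lambda>x. (g x * indicator \<Omega> x + ennreal ((h - k) / (R - \<rho>))) * indicator B x)"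
proof -
  let ?w = "truncation u k h y \<rho> R"
  let ?L = "(h - k) / (R - \<rho>)"
  let ?g = "\<lambda>x. g x * indicator \<Omega> x"
  let ?G = "\<lambda>x. (?g x + ennreal ?L) * indicator B x"
  have L: "0 < ?L" using kh R by simp
  have X: "openin mtopology X" using openin_topspace[of mtopology] by simp
  obtain \<rho>\<^sub>0 where \<rho>\<^sub>0: "potential q \<Omega> \<rho>\<^sub>0" "\<And>\<gamma>. \<gamma>\<in>rect_paths \<Omega> \<Longrightarrow> line_integral \<rho>\<^sub>0 \<gamma> < \<infinity> \<Longrightarrow> ug_along u g \<gamma>"
    using weak_upper_gradient_potential[OF q \<Omega> g] by metis
  \<comment> \<open>Paths in the whole space may leave \<Omega>. On their segments inside \<Omega>
    the extension by zero has the same integral as the potential for \<Omega>.\<close>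
  define \<rho>\<^sub>1 where "\<rho>\<^sub>1 x = \<rho>\<^sub>0 x * indicator \<Omega> x" for x
  have \<rho>\<^sub>1_meas: "\<rho>\<^sub>1 \<in> borel_measurable (borel_on X)"
    unfolding \<rho>\<^sub>1_def using borel_on_extend(1)[OF \<Omega>] \<rho>\<^sub>0(1) by (simp add: potential_def)
  have "(\<integral>\<^sup>+x\<in>X. epowr (\<rho>\<^sub>1 x) q \<partial>\<mu>) = (\<integral>\<^sup>+x\<in>\<Omega>. epowr (\<rho>\<^sub>0 x) q \<partial>\<mu>)"
    by (rule nn_integral_cong) (use open_subset[OF \<Omega>] in \<open>auto simp: \<rho>\<^sub>1_def indicator_def\<close>)
  then have \<rho>\<^sub>1: "potential q X \<rho>\<^sub>1" using \<rho>\<^sub>1_meas \<rho>\<^sub>0(1) by (simp add: potential_def)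
  have g_meas: "?g \<in> borel_measurable (borel_on X)"
    by (rule borel_on_extend(1)[OF \<Omega>]) (use g in \<open>simp add: weak_upper_gradient_def\<close>)
  show ?thesis
  proof (rule weak_upper_gradientI[OF q X _ \<rho>\<^sub>1])
    show "?G \<in> borel_measurable (borel_on X)" using g_meas B(1) by measurable
    fix \<gamma> assume \<gamma>: "\<gamma> \<in> rect_paths X" "line_integral \<rho>\<^sub>1 \<gamma> < \<infinity>"
    define \<sigma> where "\<sigma> = arc_param \<gamma>"
    let ?l = "arc_len \<gamma> 1"
    have l: "0 < ?l" by (rule arc_len_pos[OF \<gamma>(1)])
    have \<sigma>X: "\<sigma> t \<in> X" if "t \<in> {0..?l}" for t using arc_param_mem[OF \<gamma>(1) that] by (simp add: \<sigma>_def)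
    have Lip: "d (\<sigma> s) (\<sigma> t) \<le> \<bar>s - t\<bar>" if "s \<in> {0..?l}" "t \<in> {0..?l}" for s t
      using arc_param_Lipschitz[OF \<gamma>(1) that] by (simp add: \<sigma>_def)
    define U where "U t = real_of_ereal (u (\<sigma> t))" for t
    have seg: "seg_integral ?g \<gamma> s t < \<infinity> \<and> \<bar>u (\<sigma> s)\<bar> \<noteq> \<infinity> \<and> \<bar>u (\<sigma> t)\<bar> \<noteq> \<infinity> \<and> ennreal \<bar>U s - U t\<bar> \<le> seg_integral ?g \<gamma> s t"
      if st: "0 \<le> s" "s < t" "t \<le> ?l" and in_\<Omega>: "\<And>x. x \<in> {s..t} \<Longrightarrow> \<sigma> x \<in> \<Omega>" for s t
    proof -
      obtain \<gamma>' where \<gamma>': "\<gamma>' \<in> rect_paths \<Omega>" "\<gamma>' 0 = arc_param \<gamma> s" "\<gamma>' 1 = arc_param \<gamma> t"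
        "arc_len \<gamma>' 1 = t - s" "\<And>x. x \<in> {0..t - s} \<Longrightarrow> arc_param \<gamma>' x = arc_param \<gamma> (s + x)"
        by (rule subpath[OF \<gamma>(1) st, of \<Omega>]) (use in_\<Omega> in \<open>auto simp: \<sigma>_def\<close>)
      have ext: "line_integral k \<gamma>' = seg_integral (\<lambda>x. k x * indicator \<Omega> x) \<gamma> s t"
        if "(\<lambda>x. k x * indicator \<Omega> x) \<in> borel_measurable (borel_on X)" for k
      proof -
        have "line_integral k \<gamma>' = line_integral (\<lambda>x. k x * indicator \<Omega> x) \<gamma>'"
          unfolding line_integral_eq
          by (rule nn_integral_cong) (use arc_param_mem(1)[OF \<gamma>'(1)] in \<open>auto simp: indicator_def\<close>)
        also have "\<dots> = seg_integral (\<lambda>x. k x * indicator \<Omega> x) \<gamma> s t"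
          by (rule line_integral_subpath[OF \<gamma>(1) that st \<gamma>'(4,5)])
        finally show ?thesis .
      qed
      have "line_integral \<rho>\<^sub>0 \<gamma>' = seg_integral \<rho>\<^sub>1 \<gamma> s t"
        using ext[of \<rho>\<^sub>0] \<rho>\<^sub>1_meas unfolding \<rho>\<^sub>1_def by simp
      also have "\<dots> \<le> line_integral \<rho>\<^sub>1 \<gamma>"
        unfolding line_integral_eq_seg by (rule seg_integral_mono) (use st in auto)
      finally have "ug_along u g \<gamma>'" using \<rho>\<^sub>0(2)[OF \<gamma>'(1)] \<gamma>(2) by simp
      moreover have "arc_param \<gamma>' 0 = \<sigma> s" "arc_param \<gamma>' (t - s) = \<sigma> t"
        using \<gamma>'(5)[of 0] \<gamma>'(5)[of "t - s"] st by (auto simp: \<sigma>_def)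
      ultimately show ?thesis
        using ext[OF g_meas] \<gamma>'(4) ug_along_endpoints[OF _ \<gamma>'(1), of u g] unfolding U_def by simp
    qed
    define f where "f t = ?w (\<sigma> t)" for t
    have f_eq: "f t = max 0 (min (U t - k) ((h - k) * cutoff y \<rho> R (\<sigma> t)))"
      if "t \<in> {0..?l}" "\<bar>u (\<sigma> t)\<bar> \<noteq> \<infinity>" for t
      unfolding f_def U_def by (rule truncation_real) (use R y \<sigma>X that in auto)
    have cut: "\<bar>(h - k) * cutoff y \<rho> R (\<sigma> s) - (h - k) * cutoff y \<rho> R (\<sigma> t)\<bar> \<le> ?L * \<bar>s - t\<bar>"
      if "s \<in> {0..?l}" "t \<in> {0..?l}" for s t
    proof -
      have "\<bar>cutoff y \<rho> R (\<sigma> s) - cutoff y \<rho> R (\<sigma> t)\<bar> \<le> d (\<sigma> s) (\<sigma> t) / (R - \<rho>)"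
        by (rule cutoff_Lipschitz) (use R y \<sigma>X that in auto)
      also have "\<dots> \<le> \<bar>s - t\<bar> / (R - \<rho>)" using Lip[OF that] R by (simp add: divide_right_mono)
      finally have "(h - k) * \<bar>cutoff y \<rho> R (\<sigma> s) - cutoff y \<rho> R (\<sigma> t)\<bar> \<le> (h - k) * (\<bar>s - t\<bar> / (R - \<rho>))"
        using kh by (intro mult_left_mono) auto
      then show ?thesis using kh by (simp add: right_diff_distrib[symmetric] abs_mult)
    qed
    have step: "\<bar>f s - f t\<bar> \<le> \<bar>U s - U t\<bar> + ?L * \<bar>s - t\<bar>"
      if "0 \<le> s" "s < t" "t \<le> ?l" and "\<And>x. x \<in> {s..t} \<Longrightarrow> \<sigma> x \<in> \<Omega>" for s t
      using seg[OF that] f_eq[of s] f_eq[of t] cut[of s t] that(1-3)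
        abs_max_min_diff_le[of "U s - k" "(h - k) * cutoff y \<rho> R (\<sigma> s)" "U t - k" "(h - k) * cutoff y \<rho> R (\<sigma> t)"]
      by simp
    \<comment> \<open>The increments of \<open>f\<close> are dominated by those of a continuous
      function, an indefinite integral of the gradient plus a linear term; this makes
      \<open>f\<close> continuous along the segment.\<close>
    have cont_seg: "continuous_on {s..t} f" if st: "0 \<le> s" "s < t" "t \<le> ?l" and in_\<Omega>: "\<And>x. x \<in> {s..t} \<Longrightarrow> \<sigma> x \<in> \<Omega>" for s t
    proof -
      note I = nn_integral_interval_real[OF borel_measurable_arc_param[OF \<gamma>(1) g_meas st(1,3)]]
      have fin: "(\<integral>\<^sup>+x\<in>{s..t}. ?g (arc_param \<gamma> x) \<partial>lborel) < \<infinity>"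
        using seg[OF that] unfolding seg_integral_def by blast
      define H where "H x = enn2real (?g (arc_param \<gamma> x))" for x
      have H: "H integrable_on {s..t}" using I(1)[OF fin order_refl order_refl] by (simp add: H_def[abs_def])
      have ci: "continuous_on {s..t} (\<lambda>x. integral {s..x} H + ?L * x)"
        by (intro continuous_intros indefinite_integral_continuous_1[OF H])
      show ?thesis
        unfolding continuous_on_iff
      proof (intro ballI allI impI)
        fix x e assume x: "x \<in> {s..t}" "0 < (e::real)"
        have "\<exists>\<delta>>0. \<forall>x'\<in>{s..t}. dist x' x < \<delta> \<longrightarrow>
          dist (integral {s..x'} H + ?L * x') (integral {s..x} H + ?L * x) < e"
          using ci x unfolding continuous_on_iff by blast
        then obtain \<delta> where \<delta>: "\<delta> > 0" "\<And>x'. x'\<in>{s..t} \<Longrightarrow> dist x' x < \<delta> \<Longrightarrow>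
          dist (integral {s..x'} H + ?L * x') (integral {s..x} H + ?L * x) < e" by blast
        have *: "\<bar>f a - f b\<bar> \<le> (integral {s..b} H + ?L * b) - (integral {s..a} H + ?L * a)"
          if ab: "s \<le> a" "a < b" "b \<le> t" for a b
        proof -
          have "ennreal \<bar>U a - U b\<bar> \<le> seg_integral ?g \<gamma> a b"
            using seg[of a b] ab st in_\<Omega> by auto
          also have "\<dots> = ennreal (integral {a..b} H)" using I(2)[OF fin ab(1,3)] by (simp add: seg_integral_def H_def[abs_def])
          finally have le: "ennreal \<bar>U a - U b\<bar> \<le> ennreal (integral {a..b} H)" .
          have "0 \<le> integral {a..b} H"
            by (rule integral_nonneg[OF integrable_on_subinterval[OF H]]) (use ab in \<open>auto simp: H_def\<close>)
          then have "\<bar>U a - U b\<bar> \<le> integral {a..b} H" using le by simp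
          moreover have "integral {s..a} H + integral {a..b} H = integral {s..b} H"
            by (rule Henstock_Kurzweil_Integration.integral_combine) (use ab integrable_on_subinterval[OF H, of s b] in auto)
          moreover have "\<bar>f a - f b\<bar> \<le> \<bar>U a - U b\<bar> + ?L * \<bar>a - b\<bar>"
            by (rule step) (use ab st in_\<Omega> in auto)
          moreover have "?L * \<bar>a - b\<bar> = ?L * b - ?L * a" using ab by (simp add: algebra_simps diff_divide_distrib)
          ultimately show ?thesis by linarith
        qed
        show "\<exists>\<delta>>0. \<forall>x'\<in>{s..t}. dist x' x < \<delta> \<longrightarrow> dist (f x') (f x) < e"
        proof (intro exI[of _ \<delta>] conjI \<delta>(1) ballI impI)
          fix x' assume x': "x' \<in> {s..t}" "dist x' x < \<delta>"
          consider "x' < x" | "x' = x" | "x < x'" by linarith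
          then show "dist (f x') (f x) < e"
          proof cases
            case 1
            then show ?thesis using *[of x' x] \<delta>(2)[OF x'] x x' unfolding dist_real_def by auto
          next
            case 3
            then show ?thesis using *[of x x'] \<delta>(2)[OF x'] x x' unfolding dist_real_def by auto
          qed (use x in auto)
        qed
      qed
    qed
    have cont: "continuous_on {0..?l} f"
      unfolding continuous_on_iff
    proof (intro ballI allI impI)
      fix t e assume t: "t \<in> {0..?l}" and e: "0 < (e::real)"
      show "\<exists>\<delta>>0. \<forall>x'\<in>{0..?l}. dist x' t < \<delta> \<longrightarrow> dist (f x') (f t) < e"
      proof (cases "\<sigma> t \<in> \<Omega>")
        case True
        then obtain r where r: "0 < r" "mball (\<sigma> t) r \<subseteq> \<Omega>" using \<Omega> unfolding openin_mtopology by blast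
        define a b where "a = max 0 (t - r/2)" and "b = min ?l (t + r/2)"
        have ab: "0 \<le> a" "a < b" "b \<le> ?l" "t \<in> {a..b}" using t r l by (auto simp: a_def b_def)
        have "\<sigma> x \<in> \<Omega>" if x: "x \<in> {a..b}" for x
        proof -
          have "x \<in> {0..?l}" "\<bar>t - x\<bar> < r" using x r t ab by (auto simp: a_def b_def abs_less_iff)
          then have "\<sigma> x \<in> mball (\<sigma> t) r" using Lip[OF t, of x] \<sigma>X t by auto
          then show ?thesis using r by auto
        qed
        from cont_seg[OF ab(1-3) this] ab(4) e obtain \<delta> where \<delta>: "\<delta> > 0" "\<And>x'. x'\<in>{a..b} \<Longrightarrow> dist x' t < \<delta> \<Longrightarrow> dist (f x') (f t) < e"
          unfolding continuous_on_iff by blast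
        show ?thesis
        proof (intro exI[of _ "min \<delta> (r/2)"] conjI ballI impI)
          fix x' assume x': "x' \<in> {0..?l}" "dist x' t < min \<delta> (r/2)"
          then have "t - r/2 \<le> x'" "x' \<le> t + r/2" unfolding dist_real_def by linarith+
          with x' show "dist (f x') (f t) < e" by (intro \<delta>(2)) (auto simp: a_def b_def)
        qed (use \<delta> r in auto)
      next
        case False
        \<comment> \<open>The margin \<open>R < R'\<close> makes the truncation vanish near every
          parameter at which the path is outside \<Omega>.\<close>
        have "\<sigma> t \<notin> mball y R'" using False R(3) by auto
        then have far: "R' \<le> d y (\<sigma> t)" using y \<sigma>X[OF t] by simp
        have "f x = 0" if "x \<in> {0..?l}" "\<bar>x - t\<bar> < R' - R" for x
        proof -
          have "d y (\<sigma> t) \<le> d y (\<sigma> x) + d (\<sigma> x) (\<sigma> t)" by (rule triangle) (use y \<sigma>X t that in auto)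
          then have "R < d y (\<sigma> x)" using far Lip[OF that(1) t] that(2) by simp
          then show ?thesis by (simp add: f_def truncation_def)
        qed
        then show ?thesis using R(2) e t by (intro exI[of _ "R' - R"]) (auto simp: dist_real_def)
      qed
    qed
    have main: "ennreal \<bar>f 0 - f ?l\<bar> \<le> line_integral ?G \<gamma>"
    proof (cases "line_integral ?G \<gamma>")
      case (real c)
      have "\<bar>f 0 - f ?l\<bar> \<le> c"
      proof (rule abs_diff_le_of_positive_segments[OF _ cont])
        fix s t assume st: "0 \<le> s" "s \<le> t" "t \<le> ?l" and pos: "\<And>x. x \<in> {s..t} \<Longrightarrow> 0 < f x"
        show "\<bar>f s - f t\<bar> \<le> c"
        proof (cases "s = t")
          case False
          then have st': "s < t" using st by simp
          \<comment> \<open>Positivity of the truncation puts the point into the superlevel set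
            within the smaller ball, hence into both \<open>B\<close> and \<Omega>.\<close>
          have in_B: "\<sigma> x \<in> B" and in_\<Omega>: "\<sigma> x \<in> \<Omega>" if "x \<in> {s..t}" for x
            using truncation_pos[OF pos[OF that, unfolded f_def]] B(2) R mball_subset_concentric[of R R' y] by (auto simp: subset_iff)
          have meas: "(\<lambda>x. ?g (arc_param \<gamma> x) * indicator {s..t} x) \<in> borel_measurable lborel"
            by (rule borel_measurable_arc_param[OF \<gamma>(1) g_meas st(1,3)])
          have "ennreal \<bar>f s - f t\<bar> \<le> ennreal (\<bar>U s - U t\<bar> + ?L * \<bar>s - t\<bar>)"
            by (rule ennreal_leI[OF step[OF st(1) st' st(3) in_\<Omega>]])
          also have "\<dots> = ennreal \<bar>U s - U t\<bar> + ennreal (?L * (t - s))"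
            using mult_nonneg_nonneg[OF less_imp_le[OF L], of "t - s"] st by (subst ennreal_plus) auto
          also have "\<dots> \<le> seg_integral ?g \<gamma> s t + ennreal (?L * (t - s))"
            using seg[OF st(1) st' st(3) in_\<Omega>] by (intro add_right_mono) blast
          also have "ennreal (?L * (t - s)) = (\<integral>\<^sup>+x. ennreal ?L * indicator {s..t} x \<partial>lborel)"
            using st by (subst ennreal_mult[OF less_imp_le[OF L]]) (auto simp: nn_integral_cmult_indicator)
          also have "seg_integral ?g \<gamma> s t + \<dots> = (\<integral>\<^sup>+x. ?g (arc_param \<gamma> x) * indicator {s..t} x + ennreal ?L * indicator {s..t} x \<partial>lborel)"
            unfolding seg_integral_def by (rule nn_integral_add[symmetric]) (use meas in auto)
          also have "\<dots> \<le> seg_integral ?G \<gamma> 0 ?l"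
            unfolding seg_integral_def
            by (rule nn_integral_mono) (use in_B st in \<open>auto simp: indicator_def \<sigma>_def split: if_splits\<close>)
          also have "\<dots> = ennreal c" using real(2) by (simp add: line_integral_eq_seg)
          finally show ?thesis using real(1) by simp
        qed (use real in simp)
      qed (use l real kh truncation_bounds(1)[of k h u y \<rho> R] in \<open>auto simp: f_def\<close>)
      then show ?thesis unfolding real(2) by (rule ennreal_leI)
    qed simp
    then show "\<bar>ereal (?w (\<gamma> 0))\<bar> \<noteq> \<infinity> \<and> \<bar>ereal (?w (\<gamma> 1))\<bar> \<noteq> \<infinity> \<and>
      ennreal \<bar>real_of_ereal (ereal (?w (\<gamma> 0))) - real_of_ereal (ereal (?w (\<gamma> 1)))\<bar> \<le> line_integral ?G \<gamma>"
      using arc_param_endpoints[OF \<gamma>(1)] by (simp add: f_def \<sigma>_def)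
  qed
qed

end

section \<open>Nets and averages in doubling spaces\<close>

context borel_regular_space
begin

lemma doubling_mono:
  assumes "doubling Cd" "Cd \<le> C"
  shows "doubling C"
  using assms mult_right_mono[OF ennreal_leI[OF assms(2)]] unfolding doubling_def by (meson order_trans zero_le)

lemma mball_in_fmeasurable [intro]:
  assumes "doubling Cd" "y \<in> X"
  shows "mball y r \<in> fmeasurable \<mu>"
proof (cases "0 < r")
  case True
  then show ?thesis using assms unfolding doubling_def by (intro fmeasurableI) auto
next
  case False
  then have "mball y r = {}" by (auto simp: not_less) (meson nonneg order_trans leD)
  then show ?thesis by simp
qed

lemma measure_mball_pos:
  assumes "doubling Cd" "y \<in> X" "0 < r"
  shows "0 < measure \<mu> (mball y r)"
proof -
  have "0 < r / 2" using assms(3) by simp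
  then have "0 < emeasure \<mu> (mball y (2 * (r / 2)))" using assms(1,2) unfolding doubling_def by blast
  then show ?thesis using mball_in_fmeasurable[OF assms(1,2), of r]
    by (simp add: measure_eq_emeasure_eq_ennreal measure_def fmeasurable_def enn2real_positive_iff)
qed

lemma emeasure_mball:
  assumes "doubling Cd" "y \<in> X"
  shows "emeasure \<mu> (mball y r) = ennreal (measure \<mu> (mball y r))"
  by (rule emeasure_eq_measure2[OF mball_in_fmeasurable[OF assms]])

lemma measure_mball_double:
  assumes "doubling Cd" "y \<in> X" "0 < r" "0 \<le> Cd"
  shows "measure \<mu> (mball y (2 * r)) \<le> Cd * measure \<mu> (mball y r)"
proof -
  have "emeasure \<mu> (mball y (2 * r)) \<le> ennreal Cd * emeasure \<mu> (mball y r)"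
    using assms unfolding doubling_def by blast
  then show ?thesis using assms(4) by (simp add: emeasure_mball[OF assms(1,2)] ennreal_mult[symmetric])
qed

lemma measure_mball_mono:
  assumes "doubling Cd" "y \<in> X" "A \<subseteq> mball y r" "A \<in> sets \<mu>"
  shows "measure \<mu> A \<le> measure \<mu> (mball y r)"
  by (rule measure_mono_fmeasurable[OF assms(3,4) mball_in_fmeasurable[OF assms(1,2)]])

lemma measure_mball_pow:
  assumes "doubling Cd" "y \<in> X" "0 < r" "0 \<le> Cd"
  shows "measure \<mu> (mball y (2 ^ n * r)) \<le> Cd ^ n * measure \<mu> (mball y r)"
proof (induction n)
  case (Suc n)
  have "measure \<mu> (mball y (2 * (2 ^ n * r))) \<le> Cd * measure \<mu> (mball y (2 ^ n * r))"
    by (rule measure_mball_double) (use assms in auto)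
  also have "\<dots> \<le> Cd * (Cd ^ n * measure \<mu> (mball y r))" by (rule mult_left_mono[OF Suc assms(4)])
  finally show ?case by (simp add: mult_ac)
qed simp

definition separated :: "real \<Rightarrow> 'a set \<Rightarrow> bool" where
  "separated r N \<longleftrightarrow> (\<forall>x\<in>N. \<forall>y\<in>N. x \<noteq> y \<longrightarrow> r \<le> d x y)"

text \<open>Volume packing: the balls of radius \<open>r / 2\<close> about the points of
  \<open>N\<close> are disjoint subsets of \<open>mball z (D + r)\<close>, and each of them,
  enlarged \<open>2 ^ n\<close> times, contains that ball. The enlarged radius must be at least
  \<open>2 * D + r\<close>, which is the condition on \<open>n\<close>.\<close>

lemma card_separated_le:
  assumes dbl: "doubling Cd" "0 \<le> Cd" and z: "z \<in> X" and N: "finite N" "separated r N" "N \<subseteq> mball z D" and r: "0 < r"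
    and n: "4 * D + 2 * r \<le> 2 ^ n * r"
  shows "real (card N) \<le> Cd ^ n"
proof (cases "N = {}")
  case False
  then obtain x\<^sub>0 where "x\<^sub>0 \<in> N" by auto
  then have D: "0 < D" using N(3) z by (auto simp: subset_iff) (metis nonneg le_less_trans)
  let ?B = "mball z (D + r)"
  have NX: "x \<in> X" "d z x < D" if "x \<in> N" for x using N(3) that by auto
  have m: "measure \<mu> ?B \<le> Cd ^ n * measure \<mu> (mball x (r/2))" if x: "x \<in> N" for x
  proof -
    have "?B \<subseteq> mball x (2 ^ n * (r/2))"
    proof
      fix w assume w: "w \<in> ?B"
      then have "d x w \<le> d x z + d z w" using NX[OF x] z by (intro triangle) auto
      also have "\<dots> < D + (D + r)" using w NX[OF x] by (auto simp: commute)
      finally show "w \<in> mball x (2 ^ n * (r/2))" using w NX[OF x] n by auto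
    qed
    then have "measure \<mu> ?B \<le> measure \<mu> (mball x (2 ^ n * (r/2)))"
      by (intro measure_mball_mono[OF dbl(1) NX(1)[OF x]]) auto
    also have "\<dots> \<le> Cd ^ n * measure \<mu> (mball x (r/2))"
      by (rule measure_mball_pow[OF dbl(1) NX(1)[OF x] _ dbl(2)]) (use r in auto)
    finally show ?thesis .
  qed
  have disj: "disjoint_family_on (\<lambda>x. mball x (r/2)) N"
    unfolding disjoint_family_on_def
  proof (intro ballI impI)
    fix x x' assume x: "x \<in> N" "x' \<in> N" "x \<noteq> x'"
    then have "r \<le> d x x'" using N(2) by (auto simp: separated_def)
    then show "mball x (r/2) \<inter> mball x' (r/2) = {}"
      using triangle[of x _ x'] by (fastforce simp: commute)
  qed
  have "(\<Sum>x\<in>N. measure \<mu> (mball x (r/2))) = measure \<mu> (\<Union>x\<in>N. mball x (r/2))"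
    by (rule measure_finite_Union[symmetric])
       (use N(1) disj mball_in_fmeasurable[OF dbl(1) NX(1)] in \<open>auto simp: fmeasurable_def less_top\<close>)
  also have "\<dots> \<le> measure \<mu> ?B"
  proof (rule measure_mball_mono[OF dbl(1) z])
    show "(\<Union>x\<in>N. mball x (r/2)) \<subseteq> ?B"
    proof safe
      fix x w assume "x \<in> N" "w \<in> mball x (r/2)"
      then show "w \<in> ?B" using triangle[of z x w] NX[of x] z r by auto
    qed
  qed (use N(1) in auto)
  finally have *: "(\<Sum>x\<in>N. measure \<mu> (mball x (r/2))) \<le> measure \<mu> ?B" .
  have "real (card N) * measure \<mu> ?B = (\<Sum>x\<in>N. measure \<mu> ?B)" by simp
  also have "\<dots> \<le> (\<Sum>x\<in>N. Cd ^ n * measure \<mu> (mball x (r/2)))" by (rule sum_mono) (rule m)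
  also have "\<dots> \<le> Cd ^ n * measure \<mu> ?B"
    unfolding sum_distrib_left[symmetric] by (intro mult_left_mono *) (use dbl in simp)
  finally show ?thesis using measure_mball_pos[OF dbl(1) z, of "D + r"] D r by simp
qed (use dbl in simp)

text \<open>A separated subset of largest cardinality is a net, as an uncovered point could be added
  to it. The packing bound guarantees that a largest one exists.\<close>

lemma exists_net:
  assumes dbl: "doubling Cd" "0 \<le> Cd" and z: "z \<in> X" and A: "A \<subseteq> mball z D" and r: "0 < r"
  obtains N where "finite N" "N \<subseteq> A" "separated r N" "A \<subseteq> (\<Union>x\<in>N. mball x r)"
proof -
  obtain n where "(4 * D + 2 * r) / r < 2 ^ n" using real_arch_pow[of 2 "(4 * D + 2 * r) / r"] by auto
  then have n: "4 * D + 2 * r \<le> 2 ^ n * r" using r by (simp add: divide_less_eq)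
  let ?P = "\<lambda>N. finite N \<and> N \<subseteq> A \<and> separated r N"
  have "?P {}" by (simp add: separated_def)
  moreover have "\<forall>N. ?P N \<longrightarrow> card N < nat \<lceil>Cd ^ n\<rceil> + 1"
  proof (intro allI impI)
    fix N assume "?P N"
    then have "real (card N) \<le> Cd ^ n"
      by (intro card_separated_le[OF dbl z _ _ _ r n]) (use A in auto)
    then show "card N < nat \<lceil>Cd ^ n\<rceil> + 1" by linarith
  qed
  ultimately have "\<exists>N. ?P N \<and> (\<forall>N'. ?P N' \<longrightarrow> card N' \<le> card N)"
    by (rule ex_has_greatest_nat)
  then obtain N where N': "?P N \<and> (\<forall>N'. ?P N' \<longrightarrow> card N' \<le> card N)" by (rule exE)
  note N = conjunct1[OF N'] conjunct2[OF N']
  have "A \<subseteq> (\<Union>x\<in>N. mball x r)"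
  proof
    fix a assume a: "a \<in> A"
    show "a \<in> (\<Union>x\<in>N. mball x r)"
    proof (rule ccontr)
      assume no: "a \<notin> (\<Union>x\<in>N. mball x r)"
      have X: "N \<subseteq> X" "a \<in> X" using N A a by auto
      then have far: "r \<le> d x a" if "x \<in> N" for x using no that by (force simp: not_less)
      have "a \<notin> N" using far[of a] r X by auto
      moreover have "?P (insert a N)"
        using N(1) a far by (auto simp: separated_def commute)
      ultimately show False using N(2)[rule_format, of "insert a N"] N(1) by simp
    qed
  qed
  then show ?thesis using N(1) that by blast
qed

text \<open>The centres of the balls through a given point are separated and within
  \<open>l * r\<close> of it, so that the packing bound limits their number by
  \<open>Cd ^ n\<close>, with \<open>n\<close> independent of \<open>r\<close>. The measure \<nu> is
  free because the bound serves for energies of gradients as well as for \<mu>.\<close>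

lemma sum_emeasure_overlap:
  assumes dbl: "doubling Cd" "0 \<le> Cd" and N: "finite N" "N \<subseteq> X" "separated r N" and r: "0 < r"
    and n: "4 * l + 2 \<le> 2 ^ n" and \<nu>: "sets \<nu> = sets \<mu>" and V: "V \<in> sets \<mu>" "\<And>x. x \<in> N \<Longrightarrow> mball x (l * r) \<subseteq> V"
  shows "(\<Sum>x\<in>N. emeasure \<nu> (mball x (l * r))) \<le> ennreal (Cd ^ n) * emeasure \<nu> V"
proof -
  have "(\<Sum>x\<in>N. emeasure \<nu> (mball x (l * r))) = (\<Sum>x\<in>N. \<integral>\<^sup>+w. indicator (mball x (l * r)) w \<partial>\<nu>)"
    by (rule sum.cong) (auto simp: \<nu>)
  also have "\<dots> = (\<integral>\<^sup>+w. (\<Sum>x\<in>N. indicator (mball x (l * r)) w) \<partial>\<nu>)"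
    by (rule nn_integral_sum[symmetric]) (auto simp: \<nu> intro!: borel_measurable_indicator)
  also have "\<dots> \<le> (\<integral>\<^sup>+w. ennreal (Cd ^ n) * indicator V w \<partial>\<nu>)"
  proof (rule nn_integral_mono)
    fix w
    let ?N = "{x \<in> N. w \<in> mball x (l * r)}"
    have eq: "(\<Sum>x\<in>N. indicator (mball x (l * r)) w) = (of_nat (card ?N) :: ennreal)"
      using N(1) by (simp add: indicator_def sum.If_cases Int_def)
    show "(\<Sum>x\<in>N. indicator (mball x (l * r)) w) \<le> ennreal (Cd ^ n) * indicator V w"
    proof (cases "?N = {}")
      case True
      show ?thesis unfolding eq True by simp
    next
      case False
      then obtain x where x: "x \<in> N" "w \<in> mball x (l * r)" by blast
      then have w: "w \<in> V" "w \<in> X" using V(2)[OF x(1)] by (blast, simp)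
      have "real (card ?N) \<le> Cd ^ n"
      proof (rule card_separated_le[OF dbl w(2)])
        show "?N \<subseteq> mball w (l * r)" by (auto simp: commute)
        show "separated r ?N" using N(3) by (simp add: separated_def)
        have "(4 * l + 2) * r \<le> 2 ^ n * r" using n r by (intro mult_right_mono) auto
        then show "4 * (l * r) + 2 * r \<le> 2 ^ n * r" by (simp add: algebra_simps)
      qed (use N r in auto)
      then show ?thesis unfolding eq using w by (simp add: ennreal_of_nat_eq_real_of_nat ennreal_leI)
    qed
  qed
  also have "\<dots> = ennreal (Cd ^ n) * emeasure \<nu> V"
    by (rule nn_integral_cmult_indicator) (use V \<nu> in auto)
  finally show ?thesis .
qed

section \<open>Averages over balls and the weak type estimate\<close>

definition average :: "('a \<Rightarrow> real) \<Rightarrow> 'a \<Rightarrow> real \<Rightarrow> real" where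
  "average v z s = (LINT x:mball z s|\<mu>. v x) / measure \<mu> (mball z s)"

text \<open>Left undivided by the measure of the ball, so that contributions of several balls can be
  added.\<close>

definition oscillation :: "('a \<Rightarrow> real) \<Rightarrow> 'a \<Rightarrow> real \<Rightarrow> real" where
  "oscillation v z s = (LINT x:mball z s|\<mu>. \<bar>v x - average v z s\<bar>)"

lemma set_integrable_bounded:
  fixes v :: "'a \<Rightarrow> real"
  assumes "B \<in> fmeasurable \<mu>" "v \<in> borel_measurable \<mu>" "\<And>x. \<bar>v x\<bar> \<le> c"
  shows "set_integrable \<mu> B v"
  unfolding set_integrable_def
proof (rule Bochner_Integration.integrable_bound)
  show "integrable \<mu> (\<lambda>x. c * indicator B x)" using assms(1) by (auto simp: fmeasurable_def)
  show "(\<lambda>x. indicat_real B x *\<^sub>R v x) \<in> borel_measurable \<mu>" using assms by auto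
  have "0 \<le> c" using assms(3) abs_ge_zero order_trans by blast
  then show "AE x in \<mu>. norm (indicat_real B x *\<^sub>R v x) \<le> norm (c * indicat_real B x)"
    using assms(3) by (auto simp: indicator_def)
qed

text \<open>The half ball has at least the fraction \<open>1 / Cd\<close> of the measure, so that
  passing from its mean deviation to the one over the full ball costs a factor
  \<open>Cd\<close>.\<close>

lemma average_half_diff:
  assumes dbl: "doubling Cd" "0 \<le> Cd" and z: "z \<in> X" and s: "0 < s"
    and v: "v \<in> borel_measurable \<mu>" "\<And>x. \<bar>v x\<bar> \<le> c"
  shows "\<bar>average v z (s / 2) - average v z s\<bar> \<le> Cd * oscillation v z s / measure \<mu> (mball z s)"
proof -
  let ?B = "mball z s" and ?B' = "mball z (s / 2)" and ?a = "average v z s"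
  have fm: "?B \<in> fmeasurable \<mu>" "?B' \<in> fmeasurable \<mu>" using dbl z by auto
  have pos: "0 < measure \<mu> ?B" "0 < measure \<mu> ?B'" using measure_mball_pos[OF dbl(1) z] s by auto
  have b: "\<bar>v x - ?a\<bar> \<le> c + \<bar>?a\<bar>" "\<bar>\<bar>v x - ?a\<bar>\<bar> \<le> c + \<bar>?a\<bar>" for x using v(2)[of x] by auto
  have i: "set_integrable \<mu> ?B' v" "set_integrable \<mu> ?B' (\<lambda>x. v x - ?a)" "set_integrable \<mu> ?B (\<lambda>x. \<bar>v x - ?a\<bar>)" "set_integrable \<mu> ?B' (\<lambda>x. ?a)"
    using set_integrable_bounded[OF fm(2) _ b(1)] set_integrable_bounded[OF fm(1) _ b(2)] set_integrable_bounded[OF fm(2) v]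
      set_integrable_bounded[OF fm(2), of "\<lambda>_. ?a" "\<bar>?a\<bar>"] v(1) by auto
  have "(LINT x:?B'|\<mu>. v x - ?a) = (LINT x:?B'|\<mu>. v x) - measure \<mu> ?B' * ?a"
    using i(1,4) fm(2) by (subst set_integral_diff) (auto simp: set_lebesgue_integral_def fmeasurable_def)
  then have "average v z (s / 2) - ?a = (LINT x:?B'|\<mu>. v x - ?a) / measure \<mu> ?B'"
    using pos by (simp add: average_def[of v z "s/2"] field_simps)
  also have "\<bar>\<dots>\<bar> = \<bar>LINT x:?B'|\<mu>. v x - ?a\<bar> / measure \<mu> ?B'" using pos by simp
  also have "\<dots> \<le> oscillation v z s / measure \<mu> ?B'"
  proof (rule divide_right_mono)
    have "\<bar>LINT x:?B'|\<mu>. v x - ?a\<bar> \<le> (LINT x:?B'|\<mu>. \<bar>v x - ?a\<bar>)"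
      using set_integral_norm_bound[OF i(2)] by simp
    also have "\<dots> \<le> oscillation v z s"
      unfolding oscillation_def set_lebesgue_integral_def
    proof (rule integral_mono)
      have "?B' \<subseteq> ?B" using s by (intro mball_subset_concentric) simp
      then show "indicat_real ?B' x *\<^sub>R \<bar>v x - ?a\<bar> \<le> indicat_real ?B x *\<^sub>R \<bar>v x - ?a\<bar>" for x
        by (auto simp: indicator_def)
      from \<open>?B' \<subseteq> ?B\<close> show "integrable \<mu> (\<lambda>x. indicat_real ?B' x *\<^sub>R \<bar>v x - ?a\<bar>)"
        using set_integrable_subset[OF i(3), of ?B'] by (simp add: set_integrable_def)
      show "integrable \<mu> (\<lambda>x. indicat_real ?B x *\<^sub>R \<bar>v x - ?a\<bar>)"
        using i(3) by (simp add: set_integrable_def)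
    qed
    finally show "\<bar>LINT x:?B'|\<mu>. v x - ?a\<bar> \<le> oscillation v z s" .
  qed simp
  also have "\<dots> \<le> Cd * oscillation v z s / measure \<mu> ?B"
  proof -
    have "measure \<mu> ?B \<le> Cd * measure \<mu> ?B'" using measure_mball_double[OF dbl(1) z _ dbl(2), of "s/2"] s by simp
    moreover have "0 \<le> oscillation v z s" unfolding oscillation_def set_lebesgue_integral_def by (rule integral_nonneg_AE) auto
    ultimately have "oscillation v z s * measure \<mu> ?B \<le> oscillation v z s * (Cd * measure \<mu> ?B')" by (rule mult_left_mono)
    then show ?thesis using pos by (simp add: field_simps)
  qed
  finally show ?thesis .
qed

end

lemma powr_inverse_le:
  assumes "1 \<le> \<kappa>" "0 \<le> x"
  shows "x powr (1 / \<kappa>) \<le> 1 + (x::real)"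
proof (cases "x \<le> 1")
  case True
  then have "x powr (1 / \<kappa>) \<le> 1 powr (1 / \<kappa>)" using assms by (intro powr_mono2) auto
  then show ?thesis using assms by simp
next
  case False
  then have "x powr (1 / \<kappa>) \<le> x powr 1" using assms by (intro powr_mono) auto
  then show ?thesis using assms by simp
qed

lemma sum_geometric_le:
  fixes x :: real
  assumes "0 \<le> x" "x < 1"
  shows "(\<Sum>j<n. x ^ j) \<le> 1 / (1 - x)"
proof -
  have "(\<Sum>j<n. x ^ j) \<le> (\<Sum>j. x ^ j)" by (rule sum_le_suminf) (use assms in auto)
  also have "\<dots> = 1 / (1 - x)" by (rule suminf_geometric) (use assms in auto)
  finally show ?thesis .
qed

context borel_regular_space
begin

text \<open>Here \<nu> stands for the energy measure, whose density is the gradient to the power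
  \<kappa>. Keeping it abstract reduces the covering argument to the bounded overlap of balls, for
  which a measure is all that matters.\<close>

definition poincare_at :: "real \<Rightarrow> real \<Rightarrow> real \<Rightarrow> ('a \<Rightarrow> real) \<Rightarrow> 'a measure \<Rightarrow> bool" where
  "poincare_at \<kappa> K l v \<nu> \<longleftrightarrow> (\<forall>z\<in>X. \<forall>s>0. oscillation v z s \<le>
     K * s * measure \<mu> (mball z s) * (measure \<nu> (mball z (l * s)) / measure \<mu> (mball z (l * s))) powr (1 / \<kappa>))"

text \<open>Points where the averages over the balls of radius \<open>r / 2 ^ j\<close> jump by more than
  \<open>\<tau> (3 / 4) ^ j / 16\<close> at some scale \<open>j\<close> are covered scale by scale, the measures of these covers
  being summable. At all other points the averages stay below \<open>3 \<tau> / 4\<close>, so that the oscillation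
  at small scales bounds the measure of this remainder by a multiple of \<open>r / 2 ^ j\<close>. Neither the
  Lebesgue differentiation theorem nor a Vitali covering is needed.\<close>

lemma measure_level_set_le:
  assumes dbl: "doubling Cd" "0 \<le> Cd" and l: "1 \<le> l" and n: "4 * l + 2 \<le> 2 ^ n" and K: "0 < K" and \<kappa>: "1 \<le> \<kappa>"
    and v: "v \<in> borel_measurable \<mu>" "\<And>x. 0 \<le> v x" "\<And>x. v x \<le> \<tau>" and \<tau>: "0 < \<tau>"
    and \<nu>: "sets \<nu> = sets \<mu>" "finite_measure \<nu>" and PI: "poincare_at \<kappa> K l v \<nu>"
    and y: "y \<in> X" and A: "A \<in> sets \<mu>" "A \<subseteq> mball y D" "\<And>z. z \<in> A \<Longrightarrow> v z = \<tau>"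
    and r: "0 < r" and avg: "\<And>z. z \<in> A \<Longrightarrow> average v z r \<le> \<tau> / 2"
  shows "measure \<mu> A \<le> 3 * Cd ^ n * (16 * Cd * K * r / \<tau>) powr \<kappa> * measure \<nu> X"
proof -
  interpret \<nu>: finite_measure \<nu> by (rule \<nu>(2))
  have space_\<nu>: "space \<nu> = X" using sets_eq_imp_space_eq[OF \<nu>(1)] by (simp add: space_mu)
  have vabs: "\<bar>v x\<bar> \<le> \<tau>" for x using v(2,3)[of x] by simp
  have AX: "z \<in> X" if "z \<in> A" for z using A(2) that by auto
  define R where "R j = r / 2 ^ j" for j
  have R: "0 < R j" "R (Suc j) = R j / 2" for j using r by (auto simp: R_def)
  define m where "m j z = average v z (R j)" for j z
  define X' where "X' j z = measure \<nu> (mball z (l * R j)) / measure \<mu> (mball z (l * R j))" for j z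
  have X'0: "0 \<le> X' j z" for j z by (simp add: X'_def)
  have osc: "oscillation v z (R j) \<le> K * R j * measure \<mu> (mball z (R j)) * X' j z powr (1 / \<kappa>)" if "z \<in> X" for j z
    using PI R that unfolding poincare_at_def X'_def by blast
  have ball_l: "measure \<mu> (mball z (R j)) \<le> measure \<mu> (mball z (l * R j))" if "z \<in> X" for z j
  proof (rule measure_mball_mono[OF dbl(1) that])
    have "1 * R j \<le> l * R j" using l R(1)[of j] by (intro mult_right_mono) auto
    then show "mball z (R j) \<subseteq> mball z (l * R j)" by (intro mball_subset_concentric) simp
  qed simp
  have lR: "0 < l * R j" for j using l R(1)[of j] by simp
  have ballX': "measure \<mu> (mball z (R j)) * X' j z \<le> measure \<nu> (mball z (l * R j))" if "z \<in> X" for z j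
  proof -
    have "measure \<mu> (mball z (R j)) * X' j z \<le> measure \<mu> (mball z (l * R j)) * X' j z"
      by (rule mult_right_mono[OF ball_l[OF that] X'0])
    also have "\<dots> = measure \<nu> (mball z (l * R j))"
      using measure_mball_pos[OF dbl(1) that lR[of j]] by (simp add: X'_def)
    finally show ?thesis .
  qed
  \<comment> \<open>These thresholds sum to at most \<open>\<tau> / 4\<close>, the gap between the
    initial bound \<open>\<tau> / 2\<close> for the averages and \<open>3 * \<tau> / 4\<close>.
    Their ratio \<open>3/4\<close> exceeds the ratio \<open>1/2\<close> of the radii, which leaves
    the summable factor \<open>(2/3) ^ j\<close> in \<open>c j\<close>.\<close>
  define \<epsilon> where "\<epsilon> j = \<tau> * (3/4) ^ j / 16" for j :: nat
  define c where "c j = (16 * Cd * K * r / \<tau> * (2/3) ^ j) powr \<kappa>" for j :: nat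
  define S where "S j = {z \<in> A. \<epsilon> j < \<bar>m (Suc j) z - m j z\<bar>}" for j
  define F where "F J = {z \<in> A. \<forall>j<J. z \<notin> S j}" for J :: nat
  \<comment> \<open>A jump at scale \<open>j\<close> needs a large energy density near
    \<open>z\<close>. Raising the Poincare inequality to the power \<kappa> turns this into a bound
    for the measure of the ball by the energy of the enlarged ball.\<close>
  have stop: "measure \<mu> (mball z (R j)) \<le> c j * measure \<nu> (mball z (l * R j))" if z: "z \<in> S j" for z j
  proof -
    have zX: "z \<in> X" using z AX by (simp add: S_def)
    have "\<epsilon> j < \<bar>m (Suc j) z - m j z\<bar>" using z by (simp add: S_def)
    also have "\<dots> \<le> Cd * oscillation v z (R j) / measure \<mu> (mball z (R j))"
      unfolding m_def R(2) by (rule average_half_diff[OF dbl zX R(1) v(1) vabs])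
    also have "\<dots> \<le> Cd * (K * R j * measure \<mu> (mball z (R j)) * X' j z powr (1 / \<kappa>)) / measure \<mu> (mball z (R j))"
      by (intro divide_right_mono mult_left_mono osc zX) (use dbl in auto)
    also have "\<dots> = Cd * K * R j * X' j z powr (1 / \<kappa>)"
      using measure_mball_pos[OF dbl(1) zX R(1)[of j]] by simp
    finally have "\<tau> * (3/4) ^ j / 16 < Cd * K * R j * X' j z powr (1 / \<kappa>)" by (simp add: \<epsilon>_def)
    then have "1 < Cd * K * R j * X' j z powr (1 / \<kappa>) * (16 / (\<tau> * (3/4) ^ j))"
      using \<tau> by (simp add: field_simps)
    also have "\<dots> = (16 * Cd * K * r / \<tau> * (1 / (2 ^ j * (3/4) ^ j))) * X' j z powr (1 / \<kappa>)"
      by (simp add: R_def field_simps)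
    also have "1 / (2 ^ j * (3/4) ^ j) = (2/3 :: real) ^ j"
      by (simp add: power_mult_distrib[symmetric] power_one_over[symmetric] del: power_mult_distrib)
    finally have "1 \<le> (16 * Cd * K * r / \<tau> * (2/3) ^ j) * X' j z powr (1 / \<kappa>)" by simp
    then have "1 powr \<kappa> \<le> ((16 * Cd * K * r / \<tau> * (2/3) ^ j) * X' j z powr (1 / \<kappa>)) powr \<kappa>"
      by (intro powr_mono2) (use \<kappa> in auto)
    also have "\<dots> = c j * X' j z"
      unfolding c_def using \<kappa> dbl K r \<tau> X'0[of j z] by (subst powr_mult) (auto simp: powr_powr)
    finally have "measure \<mu> (mball z (R j)) * 1 \<le> measure \<mu> (mball z (R j)) * (c j * X' j z)"
      by (intro mult_left_mono) auto
    also have "\<dots> \<le> c j * measure \<nu> (mball z (l * R j))"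
      using mult_left_mono[OF ballX'[OF zX], of "c j" j] by (simp add: c_def mult_ac)
    finally show ?thesis by simp
  qed
  have S_A: "S j \<subseteq> A" for j by (auto simp: S_def)
  have F_A: "F J \<subseteq> A" for J by (auto simp: F_def)
  have "\<exists>N. finite N \<and> N \<subseteq> S j \<and> separated (R j) N \<and> S j \<subseteq> (\<Union>x\<in>N. mball x (R j))" for j
    by (rule exists_net[OF dbl y order_trans[OF S_A A(2)] R(1)]) blast
  then obtain N where N: "\<And>j. finite (N j)" "\<And>j. N j \<subseteq> S j" "\<And>j. separated (R j) (N j)" "\<And>j. S j \<subseteq> (\<Union>x\<in>N j. mball x (R j))"
    by metis
  have "\<exists>N. finite N \<and> N \<subseteq> F J \<and> separated (R J) N \<and> F J \<subseteq> (\<Union>x\<in>N. mball x (R J))" for J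
    by (rule exists_net[OF dbl y order_trans[OF F_A A(2)] R(1)]) blast
  then obtain N' where N': "\<And>j. finite (N' j)" "\<And>j. N' j \<subseteq> F j" "\<And>j. separated (R j) (N' j)" "\<And>j. F j \<subseteq> (\<Union>x\<in>N' j. mball x (R j))"
    by metis
  have NX: "N j \<subseteq> X" "N' j \<subseteq> X" for j using N(2)[of j] N'(2)[of j] S_A F_A AX by blast+
  have overlap\<nu>: "(\<Sum>x\<in>N. measure \<nu> (mball x (l * R j))) \<le> Cd ^ n * measure \<nu> X"
    if "finite N" "N \<subseteq> X" "separated (R j) N" for N j
  proof -
    have "(\<Sum>x\<in>N. emeasure \<nu> (mball x (l * R j))) \<le> ennreal (Cd ^ n) * emeasure \<nu> X"
      by (rule sum_emeasure_overlap[OF dbl that R(1) n \<nu>(1)]) (use sets.top[of \<mu>, unfolded space_mu] mball_subset_mspace in auto)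
    then show ?thesis
      using dbl by (simp add: \<nu>.emeasure_eq_measure sum_nonneg ennreal_mult[symmetric])
  qed
  have overlap\<mu>: "(\<Sum>x\<in>N' j. measure \<mu> (mball x (R j))) \<le> Cd ^ n * measure \<mu> (mball y (D + r))" for j
  proof -
    have "(\<Sum>x\<in>N' j. emeasure \<mu> (mball x (1 * R j))) \<le> ennreal (Cd ^ n) * emeasure \<mu> (mball y (D + r))"
    proof (rule sum_emeasure_overlap[OF dbl N'(1) NX(2) N'(3) R(1)])
      show "4 * 1 + 2 \<le> (2::real) ^ n" using n l by simp
      fix x assume "x \<in> N' j"
      then have "x \<in> mball y D" using N'(2) F_A A(2) by blast
      then have x: "d y x < D" "x \<in> X" by auto
      have "R j \<le> r" using r by (simp add: R_def field_simps)
      then show "mball x (1 * R j) \<subseteq> mball y (D + r)"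
        using x y by (intro mball_subset) (auto simp: commute)
    qed auto
    then show ?thesis
      using dbl by (simp add: emeasure_mball[OF dbl(1)] y NX(2)[THEN subsetD] sum_nonneg ennreal_mult[symmetric])
  qed
  have mono_avg: "m J z \<le> \<tau> * (3/4)" if z: "z \<in> F J" for J z
  proof -
    have zA: "z \<in> A" using z by (simp add: F_def)
    have step: "m (Suc j) z \<le> m j z + \<epsilon> j" if "j < J" for j
      using z that by (auto simp: F_def S_def)
    have "m i z \<le> \<tau> / 2 + (\<Sum>j<i. \<epsilon> j)" if "i \<le> J" for i
      using that
    proof (induction i)
      case 0
      then show ?case using avg[OF zA] by (simp add: m_def R_def)
    next
      case (Suc i)
      then show ?case using step[of i] by simp
    qed
    from this[of J] have "m J z \<le> \<tau> / 2 + \<tau> / 16 * (\<Sum>j<J. (3/4) ^ j)"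
      by (simp add: \<epsilon>_def sum_distrib_left)
    also have "\<dots> \<le> \<tau> / 2 + \<tau> / 16 * (1 / (1 - 3/4))"
      using \<tau> by (intro add_left_mono mult_left_mono sum_geometric_le) auto
    finally show ?thesis by simp
  qed
  \<comment> \<open>On \<open>A\<close> the function equals \<tau>, while the average at this scale
    is at most \<open>3 * \<tau> / 4\<close>, so that \<open>v\<close> deviates from it by at least
    \<open>\<tau> / 4\<close> there.\<close>
  have small: "\<tau> / 4 * measure \<mu> (A \<inter> mball z (R J)) \<le> K * R J * (measure \<mu> (mball z (R J)) + measure \<nu> (mball z (l * R J)))"
    if z: "z \<in> F J" for z J
  proof -
    have zX: "z \<in> X" using z F_A AX by blast
    let ?B = "mball z (R J)"
    have "\<tau> / 4 * measure \<mu> (A \<inter> ?B) = (\<integral>x. \<tau> / 4 * indicator (A \<inter> ?B) x \<partial>\<mu>)"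
      using A(1) by simp
    also have "\<dots> \<le> oscillation v z (R J)"
      unfolding oscillation_def set_lebesgue_integral_def
    proof (rule integral_mono)
      have fm: "?B \<in> fmeasurable \<mu>" using mball_in_fmeasurable[OF dbl(1) zX] .
      then have "A \<inter> ?B \<in> fmeasurable \<mu>" using A(1) by (rule fmeasurable_Int_fmeasurable[of ?B \<mu> A, unfolded Int_commute[of ?B]])
      then show "integrable \<mu> (\<lambda>x. \<tau> / 4 * indicator (A \<inter> ?B) x)" by (simp add: fmeasurable_def)
      have "set_integrable \<mu> ?B (\<lambda>x. \<bar>v x - average v z (R J)\<bar>)"
        by (rule set_integrable_bounded[OF fm, of _ "\<tau> + \<bar>average v z (R J)\<bar>"]) (use v(1) vabs in \<open>auto intro: order_trans[OF abs_triangle_ineq4] add_mono\<close>)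
      then show "integrable \<mu> (\<lambda>x. indicat_real ?B x *\<^sub>R \<bar>v x - average v z (R J)\<bar>)" by (simp add: set_integrable_def)
      show "\<tau> / 4 * indicator (A \<inter> ?B) x \<le> indicat_real ?B x *\<^sub>R \<bar>v x - average v z (R J)\<bar>" for x
      proof (cases "x \<in> A \<inter> ?B")
        case True
        then have "\<tau> / 4 \<le> \<bar>v x - average v z (R J)\<bar>"
          using mono_avg[OF z] A(3)[of x] abs_ge_self[of "v x - average v z (R J)"] by (simp add: m_def)
        then show ?thesis using True by simp
      qed simp
    qed
    also have "\<dots> \<le> K * R J * measure \<mu> ?B * X' J z powr (1 / \<kappa>)" by (rule osc[OF zX])
    \<comment> \<open>The power \<open>1 / \<kappa>\<close> does not add up over balls, but
      \<open>1 + X' J z\<close> does. The crude bound is harmless because the factor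
      \<open>R J\<close> tends to zero.\<close>
    also have "\<dots> \<le> K * R J * measure \<mu> ?B * (1 + X' J z)"
      by (rule mult_left_mono[OF powr_inverse_le[OF \<kappa> X'0]]) (use K R(1)[of J] in auto)
    also have "\<dots> = K * R J * (measure \<mu> ?B + measure \<mu> ?B * X' J z)" by (simp add: algebra_simps)
    also have "\<dots> \<le> K * R J * (measure \<mu> ?B + measure \<nu> (mball z (l * R J)))"
      by (intro mult_left_mono add_left_mono ballX' zX) (use K R(1)[of J] in auto)
    finally show ?thesis .
  qed
  let ?C = "3 * Cd ^ n * (16 * Cd * K * r / \<tau>) powr \<kappa> * measure \<nu> X"
  \<comment> \<open>Whatever its size, \<open>?E\<close> does not depend on \<open>J\<close>, and it
    disappears in the limit.\<close>
  let ?E = "4 * K / \<tau> * (Cd ^ n * measure \<mu> (mball y (D + r)) + Cd ^ n * measure \<nu> X)"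
  have bound: "measure \<mu> A \<le> ?C + R J * ?E" for J
  proof -
    let ?V = "\<lambda>j. \<Union>x\<in>N j. mball x (R j)" and ?W = "\<Union>x\<in>N' J. A \<inter> mball x (R J)"
    have fmV: "?V j \<in> fmeasurable \<mu>" for j
      by (rule fmeasurable.finite_UN[OF N(1)]) (rule mball_in_fmeasurable[OF dbl(1) NX(1)[THEN subsetD]])
    have fmA: "A \<inter> mball x (R J) \<in> fmeasurable \<mu>" if "x \<in> N' J" for x
      using fmeasurable_Int_fmeasurable[OF mball_in_fmeasurable[OF dbl(1) NX(2)[THEN subsetD, OF that]] A(1)] by (simp add: Int_commute)
    then have fmW: "?W \<in> fmeasurable \<mu>"
      by (intro fmeasurable.finite_UN[OF N'(1)])
    have fmVV: "(\<Union>j<J. ?V j) \<in> fmeasurable \<mu>" by (rule fmeasurable.finite_UN[OF finite_lessThan fmV])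
    have cover: "A \<subseteq> (\<Union>j<J. ?V j) \<union> ?W"
    proof
      fix z assume z: "z \<in> A"
      show "z \<in> (\<Union>j<J. ?V j) \<union> ?W"
      proof (cases "z \<in> F J")
        case True
        then show ?thesis using N'(4)[of J] z by blast
      next
        case False
        then show ?thesis using N(4) z by (fastforce simp: F_def)
      qed
    qed
    have "measure \<mu> A \<le> measure \<mu> ((\<Union>j<J. ?V j) \<union> ?W)"
      by (rule measure_mono_fmeasurable[OF cover A(1)]) (use fmVV fmW in auto)
    also have "\<dots> \<le> measure \<mu> (\<Union>j<J. ?V j) + measure \<mu> ?W"
      by (rule measure_Un_le) (use fmVV fmW in \<open>auto dest: fmeasurableD\<close>)
    also have "measure \<mu> (\<Union>j<J. ?V j) \<le> (\<Sum>j<J. measure \<mu> (?V j))"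
      by (rule measure_UNION_le) (use fmV in \<open>auto dest: fmeasurableD\<close>)
    also have "\<dots> \<le> (\<Sum>j<J. c j * (Cd ^ n * measure \<nu> X))"
    proof (rule sum_mono)
      fix j
      have "measure \<mu> (?V j) \<le> (\<Sum>x\<in>N j. measure \<mu> (mball x (R j)))"
        by (rule measure_UNION_le) (use N(1) in auto)
      also have "\<dots> \<le> (\<Sum>x\<in>N j. c j * measure \<nu> (mball x (l * R j)))"
        by (rule sum_mono) (use stop N(2) in blast)
      also have "\<dots> \<le> c j * (Cd ^ n * measure \<nu> X)"
        unfolding sum_distrib_left[symmetric] by (rule mult_left_mono[OF overlap\<nu>[OF N(1) NX(1) N(3)]]) (simp add: c_def)
      finally show "measure \<mu> (?V j) \<le> c j * (Cd ^ n * measure \<nu> X)" .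
    qed
    also have "\<dots> = (\<Sum>j<J. c j) * (Cd ^ n * measure \<nu> X)" by (simp add: sum_distrib_right)
    also have "\<dots> \<le> ((16 * Cd * K * r / \<tau>) powr \<kappa> * 3) * (Cd ^ n * measure \<nu> X)"
    proof (rule mult_right_mono)
      \<comment> \<open>As \<kappa> \<ge> 1, the factor \<open>((2/3) ^ j) powr \<kappa>\<close> is
        at most \<open>(2/3) ^ j\<close>. The geometric series is the source of the 3.\<close>
      have "c j \<le> (16 * Cd * K * r / \<tau>) powr \<kappa> * (2/3) ^ j" for j
      proof -
        have "c j = (16 * Cd * K * r / \<tau>) powr \<kappa> * ((2/3) ^ j) powr \<kappa>"
          unfolding c_def using dbl K r \<tau> by (subst powr_mult) auto
        also have "((2/3::real) ^ j) powr \<kappa> \<le> ((2/3) ^ j) powr 1"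
          by (rule powr_mono') (use \<kappa> in \<open>auto simp: power_le_one\<close>)
        finally show ?thesis by (simp add: mult_left_mono)
      qed
      then have "(\<Sum>j<J. c j) \<le> (\<Sum>j<J. (16 * Cd * K * r / \<tau>) powr \<kappa> * (2/3) ^ j)" by (rule sum_mono)
      also have "\<dots> \<le> (16 * Cd * K * r / \<tau>) powr \<kappa> * (1 / (1 - 2/3))"
        unfolding sum_distrib_left[symmetric] by (intro mult_left_mono sum_geometric_le) auto
      finally show "(\<Sum>j<J. c j) \<le> (16 * Cd * K * r / \<tau>) powr \<kappa> * 3" by simp
    qed (use dbl in simp)
    also have "measure \<mu> ?W \<le> R J * ?E"
    proof -
      have "\<tau> / 4 * measure \<mu> ?W \<le> \<tau> / 4 * (\<Sum>x\<in>N' J. measure \<mu> (A \<inter> mball x (R J)))"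
        using \<tau> by (intro mult_left_mono measure_UNION_le) (use N'(1) A(1) in auto)
      also have "\<dots> \<le> (\<Sum>x\<in>N' J. K * R J * (measure \<mu> (mball x (R J)) + measure \<nu> (mball x (l * R J))))"
        unfolding sum_distrib_left by (rule sum_mono) (use small N'(2) in blast)
      also have "\<dots> = K * R J * ((\<Sum>x\<in>N' J. measure \<mu> (mball x (R J))) + (\<Sum>x\<in>N' J. measure \<nu> (mball x (l * R J))))"
        by (simp only: sum_distrib_left[symmetric] sum.distrib)
      also have "\<dots> \<le> K * R J * (Cd ^ n * measure \<mu> (mball y (D + r)) + Cd ^ n * measure \<nu> X)"
        by (intro mult_left_mono add_mono overlap\<mu> overlap\<nu> N' NX) (use K R(1)[of J] in auto)
      finally show ?thesis using \<tau> by (simp add: field_simps)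
    qed
    finally show ?thesis by (simp add: mult_ac)
  qed
  have "(\<lambda>J. ?C + R J * ?E) \<longlonglongrightarrow> ?C + 0 * ?E"
    unfolding R_def by (intro tendsto_intros LIMSEQ_divide_realpow_zero) simp
  then have "measure \<mu> A \<le> ?C + 0 * ?E" by (rule LIMSEQ_le_const) (use bound in blast)
  then show ?thesis by simp
qed

end

section \<open>Decay of superlevel sets\<close>

lemma epowr_add_le:
  assumes "0 < r"
  shows "epowr (x + y) r \<le> ennreal (2 powr r) * (epowr x r + epowr y r)"
proof -
  have *: "epowr (x + y) r \<le> ennreal (2 powr r) * (epowr x r + epowr y r)" if "x \<le> y" for x y
  proof -
    have "x + y \<le> ennreal 2 * y" using add_right_mono[OF that, of y] by (simp add: mult_2)
    then have "epowr (x + y) r \<le> epowr (ennreal 2 * y) r" using assms by (intro epowr_mono) auto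
    also have "\<dots> = ennreal (2 powr r) * epowr y r" by (rule epowr_mult) simp
    also have "\<dots> \<le> ennreal (2 powr r) * (epowr x r + epowr y r)" by (intro mult_left_mono) auto
    finally show ?thesis .
  qed
  show ?thesis using *[of x y] *[of y x] by (cases "x \<le> y") (auto simp: add.commute not_le)
qed

text \<open>Below the level \<open>t\<close> the first term dominates; above it the quotient
  \<open>x / t\<close> is at least 1, and the larger exponent wins.\<close>

lemma epowr_le_add_scaled:
  assumes "0 < p" "p \<le> \<kappa>" "0 < t"
  shows "epowr x p \<le> ennreal (t powr p) + ennreal (t powr (p - \<kappa>)) * epowr x \<kappa>"
proof (cases x)
  case (real r)
  have "r powr p \<le> t powr p + t powr (p - \<kappa>) * r powr \<kappa>"
  proof (cases "r \<le> t")
    case True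
    then have "r powr p \<le> t powr p" using real assms by (intro powr_mono2) auto
    then show ?thesis by (simp add: add_increasing2)
  next
    case False
    then have "(r / t) powr p \<le> (r / t) powr \<kappa>" using assms by (intro powr_mono) auto
    then have "r powr p / t powr p * t powr p \<le> r powr \<kappa> / t powr \<kappa> * t powr p"
      using real assms by (intro mult_right_mono) (auto simp: powr_divide)
    then have "r powr p \<le> t powr (p - \<kappa>) * r powr \<kappa>" using assms by (simp add: powr_diff mult_ac)
    then show ?thesis by (simp add: add_increasing)
  qed
  then show ?thesis using real by (simp add: ennreal_mult[symmetric] ennreal_plus[symmetric] del: ennreal_plus)
next
  case top
  then show ?thesis using assms by (simp add: ennreal_mult_top)
qed

text \<open>Hoelder's inequality holds with \<open>1\<close> in place of \<open>2\<close>; splitting the integrand at a level \<open>t\<close>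
  is enough here.\<close>

lemma nn_integral_epowr_Hoelder:
  assumes p: "0 < p" "p \<le> \<kappa>" and B: "B \<in> sets M" "emeasure M B = ennreal m" "0 < m"
    and f: "(\<lambda>x. f x * indicator B x) \<in> borel_measurable M" and A: "0 \<le> A" "(\<integral>\<^sup>+x\<in>B. epowr (f x) \<kappa> \<partial>M) \<le> ennreal (A * m)"
  shows "(\<integral>\<^sup>+x\<in>B. epowr (f x) p \<partial>M) \<le> ennreal (2 * A powr (p / \<kappa>) * m)"
proof -
  have eq: "epowr (f x) r * indicator B x = epowr (f x * indicator B x) r" for x r by (auto simp: indicator_def)
  have meas: "(\<lambda>x. epowr (f x) r * indicator B x) \<in> borel_measurable M" for r unfolding eq using f by measurable
  show ?thesis
  proof (cases "A = 0")
    case True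
    then have "(\<integral>\<^sup>+x\<in>B. epowr (f x) \<kappa> \<partial>M) = 0" using A(2) by simp
    then have "AE x in M. epowr (f x) \<kappa> * indicator B x = 0"
      by (simp add: nn_integral_0_iff_AE[OF meas])
    then have "AE x in M. epowr (f x) p * indicator B x = 0"
    proof eventually_elim
      case (elim x)
      then show ?case by (cases "f x") (auto simp: indicator_def split: if_splits)
    qed
    then have "(\<integral>\<^sup>+x\<in>B. epowr (f x) p \<partial>M) = 0" by (subst nn_integral_0_iff_AE) (use meas in auto)
    then show ?thesis by simp
  next
    case False
    \<comment> \<open>This level balances the two terms, each of which contributes
      \<open>A powr (p / \<kappa>) * m\<close>. It must be positive, hence the separate case
      \<open>A = 0\<close>.\<close>
    define t where "t = A powr (1 / \<kappa>)"
    have t: "0 < t" "t powr p = A powr (p / \<kappa>)" "t powr (p - \<kappa>) * A = A powr (p / \<kappa>)"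
    proof -
      show "0 < t" "t powr p = A powr (p / \<kappa>)" using False A by (auto simp: t_def powr_powr)
      have "t powr (p - \<kappa>) * A powr 1 = A powr ((p - \<kappa>) / \<kappa> + 1)" by (simp add: t_def powr_powr powr_add)
      also have "(p - \<kappa>) / \<kappa> + 1 = p / \<kappa>" using p by (simp add: field_simps)
      finally show "t powr (p - \<kappa>) * A = A powr (p / \<kappa>)" using A by simp
    qed
    have "(\<integral>\<^sup>+x\<in>B. epowr (f x) p \<partial>M) \<le> (\<integral>\<^sup>+x. ennreal (t powr p) * indicator B x + ennreal (t powr (p - \<kappa>)) * (epowr (f x) \<kappa> * indicator B x) \<partial>M)"
      by (rule nn_integral_mono) (use epowr_le_add_scaled[OF p t(1)] in \<open>auto simp: indicator_def\<close>)
    also have "\<dots> = ennreal (t powr p) * ennreal m + ennreal (t powr (p - \<kappa>)) * (\<integral>\<^sup>+x\<in>B. epowr (f x) \<kappa> \<partial>M)"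
      by (subst nn_integral_add) (use B meas in \<open>auto simp: nn_integral_cmult nn_integral_cmult_indicator\<close>)
    also have "\<dots> \<le> ennreal (t powr p) * ennreal m + ennreal (t powr (p - \<kappa>)) * ennreal (A * m)"
      by (intro add_left_mono mult_left_mono A(2)) simp
    also have "\<dots> = ennreal (t powr p * m + t powr (p - \<kappa>) * A * m)"
      using A B by (simp add: ennreal_mult[symmetric] ennreal_plus[symmetric] mult.assoc del: ennreal_plus)
    also have "\<dots> = ennreal (2 * A powr (p / \<kappa>) * m)" unfolding t(2,3) by (simp add: mult_ac)
    finally show ?thesis .
  qed
qed

lemma ennreal_pos_mult_top: "0 < c \<Longrightarrow> ennreal c * \<infinity> = \<infinity>"
  by (simp add: ennreal_mult_top)

context borel_regular_space
begin

text \<open>The inequality is given for the minimal gradient and the exponent \<open>p\<close>. The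
  weak upper gradient \<open>G\<close> dominates the minimal one almost everywhere, and Hoelder's
  inequality raises the exponent to \<kappa>; its constant 2 survives as
  \<open>2 powr (1 / p)\<close>, which is at most 2.\<close>

lemma poincare_at_of_weak_poincare:
  assumes q: "0 < q" and PI: "weak_poincare q p C l" and dbl: "doubling Cd" and p: "1 \<le> p" "p \<le> \<kappa>"
    and v: "v \<in> borel_measurable \<mu>" "\<And>x. 0 \<le> v x" "\<And>x. v x \<le> c"
    and G: "weak_upper_gradient q X (\<lambda>x. ereal (v x)) G" "q_integrable_bdd q X G" "G \<in> borel_measurable \<mu>"
    and fin: "(\<integral>\<^sup>+x. epowr (G x) \<kappa> \<partial>\<mu>) < \<infinity>"
  shows "poincare_at \<kappa> (2 * C) l v (density \<mu> (\<lambda>x. epowr (G x) \<kappa>))"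
  unfolding poincare_at_def
proof (intro ballI allI impI)
  fix z s assume z: "z \<in> X" and s: "0 < (s::real)"
  have C: "0 < C" "1 \<le> l" using PI by (auto simp: weak_poincare_def)
  let ?\<nu> = "density \<mu> (\<lambda>x. epowr (G x) \<kappa>)"
  let ?B = "mball z s" and ?L = "mball z (l * s)"
  obtain g where g: "minimal_weak_ug q X (\<lambda>x. ereal (v x)) g"
    using exists_minimal_weak_ug[OF q _ G(1,2)] openin_topspace[of mtopology] by auto
  have gG: "AE x in \<mu>. x \<in> X \<longrightarrow> g x \<le> G x" using g G(1,2) by (simp add: minimal_weak_ug_def)
  have vL: "(\<lambda>x. ereal (v x)) \<in> L1_loc"
    unfolding L1_loc_def
  proof (intro CollectI conjI ballI)
    show "(\<lambda>x. ereal (v x)) \<in> borel_measurable \<mu>" using v(1) by measurable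
    fix x assume x: "x \<in> X"
    have "(\<integral>\<^sup>+w\<in>mball x 1. e2ennreal \<bar>ereal (v w)\<bar> \<partial>\<mu>) \<le> (\<integral>\<^sup>+w\<in>mball x 1. ennreal c \<partial>\<mu>)"
      by (rule nn_integral_mono) (use v(2,3) in \<open>auto simp: indicator_def e2ennreal_ereal intro!: ennreal_leI\<close>)
    also have "\<dots> < \<infinity>"
      by (subst nn_integral_cmult_indicator) (auto simp: emeasure_mball[OF dbl x] ennreal_mult_less_top)
    finally show "\<exists>r>0. (\<integral>\<^sup>+w\<in>mball x r. e2ennreal \<bar>ereal (v w)\<bar> \<partial>\<mu>) < \<infinity>" by (intro exI[of _ 1]) simp
  qed
  define m where "m = measure \<mu> ?B"
  define m' where "m' = measure \<mu> ?L"
  have m: "0 < m" "emeasure \<mu> ?B = ennreal m" using measure_mball_pos[OF dbl z s] emeasure_mball[OF dbl z] by (auto simp: m_def)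
  have m': "0 < m'" "emeasure \<mu> ?L = ennreal m'"
    using measure_mball_pos[OF dbl z, of "l * s"] emeasure_mball[OF dbl z] s C by (auto simp: m'_def)
  define A where "A = measure ?\<nu> ?L / m'"
  have A0: "0 \<le> A" using m' by (simp add: A_def)
  have em\<nu>: "emeasure ?\<nu> ?L = (\<integral>\<^sup>+x\<in>?L. epowr (G x) \<kappa> \<partial>\<mu>)"
    using G(3) by (subst emeasure_density) auto
  have "emeasure ?\<nu> ?L \<le> (\<integral>\<^sup>+x. epowr (G x) \<kappa> \<partial>\<mu>)"
    unfolding em\<nu> by (rule nn_integral_mono) (auto simp: indicator_def)
  then have "emeasure ?\<nu> ?L < \<infinity>" using fin by (rule le_less_trans)
  then have "emeasure ?\<nu> ?L = ennreal (A * m')"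
    using m' by (simp add: A_def emeasure_eq_ennreal_measure less_top)
  then have "(\<integral>\<^sup>+x\<in>?L. epowr (G x) p \<partial>\<mu>) \<le> ennreal (2 * A powr (p / \<kappa>) * m')"
    by (intro nn_integral_epowr_Hoelder[OF _ p(2) _ m'(2,1) _ A0]) (use p G(3) em\<nu> in auto)
  moreover have "(\<integral>\<^sup>+x\<in>?L. epowr (g x) p \<partial>\<mu>) \<le> (\<integral>\<^sup>+x\<in>?L. epowr (G x) p \<partial>\<mu>)"
  proof (rule nn_integral_mono_AE)
    show "AE x in \<mu>. epowr (g x) p * indicator ?L x \<le> epowr (G x) p * indicator ?L x"
      using gG
    proof eventually_elim
      case (elim x)
      then show ?case using p by (auto simp: indicator_def intro!: epowr_mono)
    qed
  qed
  ultimately have "(\<integral>\<^sup>+x\<in>?L. epowr (g x) p \<partial>\<mu>) \<le> ennreal (2 * A powr (p / \<kappa>) * m')" by (rule order_trans[rotated])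
  then have "(\<integral>\<^sup>+x\<in>?L. epowr (g x) p \<partial>\<mu>) / emeasure \<mu> ?L \<le> ennreal (2 * A powr (p / \<kappa>) * m') / ennreal m'"
    unfolding m'(2) by (rule divide_right_mono_ennreal)
  also have "\<dots> = ennreal (2 * A powr (p / \<kappa>))" using m' by (simp add: divide_ennreal)
  finally have "epowr ((\<integral>\<^sup>+x\<in>?L. epowr (g x) p \<partial>\<mu>) / emeasure \<mu> ?L) (1 / p) \<le> epowr (ennreal (2 * A powr (p / \<kappa>))) (1 / p)"
    using p by (intro epowr_mono) auto
  also have "\<dots> = ennreal (2 powr (1 / p) * A powr (1 / \<kappa>))" using A0 p by (simp add: powr_mult powr_powr)
  also have "\<dots> \<le> ennreal (2 * A powr (1 / \<kappa>))"
  proof (intro ennreal_leI mult_right_mono)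
    have "2 powr (1 / p) \<le> (2::real) powr 1" using p by (intro powr_mono) auto
    then show "2 powr (1 / p) \<le> (2::real)" by simp
  qed simp
  finally have R: "epowr ((\<integral>\<^sup>+x\<in>?L. epowr (g x) p \<partial>\<mu>) / emeasure \<mu> ?L) (1 / p) \<le> ennreal (2 * A powr (1 / \<kappa>))" .
  have mean: "mean ?B (\<lambda>x. ereal (v x)) = average v z s" by (simp add: mean_def average_def)
  have osc: "(\<integral>\<^sup>+x\<in>?B. e2ennreal \<bar>ereal (v x) - ereal (average v z s)\<bar> \<partial>\<mu>) = ennreal (oscillation v z s)"
  proof -
    have b: "\<bar>\<bar>v x - average v z s\<bar>\<bar> \<le> c + \<bar>average v z s\<bar>" for x using v(2,3)[of x] by auto
    have "set_integrable \<mu> ?B (\<lambda>x. \<bar>v x - average v z s\<bar>)"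
      by (rule set_integrable_bounded[OF mball_in_fmeasurable[OF dbl z] _ b]) (use v(1) in measurable)
    then have "(\<integral>\<^sup>+x. ennreal (indicat_real ?B x * \<bar>v x - average v z s\<bar>) \<partial>\<mu>) = ennreal (oscillation v z s)"
      unfolding oscillation_def set_lebesgue_integral_def by (subst nn_integral_eq_integral) (auto simp: set_integrable_def)
    moreover have "(\<integral>\<^sup>+x\<in>?B. e2ennreal \<bar>ereal (v x) - ereal (average v z s)\<bar> \<partial>\<mu>) = (\<integral>\<^sup>+x. ennreal (indicat_real ?B x * \<bar>v x - average v z s\<bar>) \<partial>\<mu>)"
      by (rule nn_integral_cong) (auto simp: indicator_def e2ennreal_ereal)
    ultimately show ?thesis by simp
  qed
  have osc0: "0 \<le> oscillation v z s" unfolding oscillation_def set_lebesgue_integral_def by (rule integral_nonneg_AE) auto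
  have "ennreal (oscillation v z s) / ennreal m \<le> ennreal (C * s) *
      epowr ((\<integral>\<^sup>+x\<in>?L. epowr (g x) p \<partial>\<mu>) / emeasure \<mu> ?L) (1 / p)"
    using PI[unfolded weak_poincare_def, THEN conjunct2, THEN conjunct2, rule_format, OF z s vL g]
    unfolding mean osc m(2) .
  also have "\<dots> \<le> ennreal (C * s) * ennreal (2 * A powr (1 / \<kappa>))" by (rule mult_left_mono[OF R]) simp
  finally have "ennreal (oscillation v z s / m) \<le> ennreal (C * s * (2 * A powr (1 / \<kappa>)))"
    using m osc0 C s by (simp add: divide_ennreal ennreal_mult[symmetric])
  then have "oscillation v z s / m \<le> C * s * (2 * A powr (1 / \<kappa>))" using C s by (subst (asm) ennreal_le_iff) auto
  then show "oscillation v z s \<le> 2 * C * s * measure \<mu> ?B * (measure ?\<nu> ?L / measure \<mu> ?L) powr (1 / \<kappa>)"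
    using m(1) unfolding A_def m'_def[symmetric] m_def[symmetric] by (simp add: field_simps)
qed

lemma half_le_powr:
  assumes "0 \<le> g" "g \<le> 1" "1 / 2 < (x::real)"
  shows "1 \<le> 2 * x powr g"
proof -
  have "(1 / 2) powr 1 \<le> (1 / 2 :: real) powr g" using assms by (intro powr_mono') auto
  also have "\<dots> \<le> x powr g" using assms by (intro powr_mono2) auto
  finally show ?thesis by simp
qed

lemma exists_scale:
  assumes "2 \<le> (Cd::real)" "0 < x" "x \<le> 1"
  shows "\<exists>N::nat. x * Cd ^ N \<le> 1 \<and> 1 < x * Cd ^ Suc N"
proof -
  obtain n where "1 / x < Cd ^ n" using real_arch_pow[of Cd "1 / x"] assms by auto
  then have ex: "1 < x * Cd ^ n" using assms by (simp add: divide_less_eq mult.commute)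
  define N where "N = (LEAST n. 1 < x * Cd ^ n)"
  have N: "1 < x * Cd ^ N" unfolding N_def by (rule LeastI[of _ n]) (rule ex)
  have "N \<noteq> 0" using N assms by (cases N) auto
  then obtain M where M: "N = Suc M" by (cases N) auto
  have "\<not> 1 < x * Cd ^ M" using not_less_Least[of M "\<lambda>n. 1 < x * Cd ^ n"] M by (simp add: N_def)
  then show ?thesis using N M by (intro exI[of _ M]) auto
qed

lemma measurable_superlevel:
  assumes \<Omega>: "openin mtopology \<Omega>" and u: "u \<in> borel_measurable (restrict_space \<mu> \<Omega>)" and B: "B \<in> sets \<mu>" "B \<subseteq> \<Omega>"
  shows "{x \<in> B. ereal k < u x} \<in> sets \<mu>" "{x \<in> B. ereal k \<le> u x} \<in> sets \<mu>"
    "f \<in> borel_measurable borel \<Longrightarrow> (\<lambda>x. f (u x) * indicator B x :: ennreal) \<in> borel_measurable \<mu>"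
proof -
  have [measurable]: "\<Omega> \<in> sets \<mu>" "B \<in> sets \<mu>" using open_measurable[OF \<Omega>] B by auto
  have U: "(\<lambda>x. if x \<in> \<Omega> then u x else 0) \<in> borel_measurable \<mu>"
    using u by (subst (asm) measurable_restrict_space_iff[of _ _ 0]) auto
  have "{x \<in> B. ereal k < u x} = {x \<in> space \<mu>. x \<in> B \<and> ereal k < (if x \<in> \<Omega> then u x else 0)}"
    "{x \<in> B. ereal k \<le> u x} = {x \<in> space \<mu>. x \<in> B \<and> ereal k \<le> (if x \<in> \<Omega> then u x else 0)}"
    using B sets.sets_into_space[OF B(1)] by auto
  then show "{x \<in> B. ereal k < u x} \<in> sets \<mu>" "{x \<in> B. ereal k \<le> u x} \<in> sets \<mu>"
    using U by (simp_all, measurable)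
  assume [measurable]: "f \<in> borel_measurable borel"
  have "(\<lambda>x. f (u x) * indicator B x) = (\<lambda>x. f (if x \<in> \<Omega> then u x else 0) * indicator B x)"
  proof
    fix x show "f (u x) * indicator B x = f (if x \<in> \<Omega> then u x else 0) * indicator B x"
      using B(2) by (cases "x \<in> B") auto
  qed
  moreover have "(\<lambda>x. f (if x \<in> \<Omega> then u x else 0) * indicator B x) \<in> borel_measurable \<mu>" using U by measurable
  ultimately show "(\<lambda>x. f (u x) * indicator B x) \<in> borel_measurable \<mu>" by simp
qed

lemma measurable_truncation:
  assumes \<Omega>: "openin mtopology \<Omega>" and u: "u \<in> borel_measurable (restrict_space \<mu> \<Omega>)" and y: "y \<in> X" "mball y R \<subseteq> \<Omega>" and r: "\<rho> < R" "k < h"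
  shows "truncation u k h y \<rho> R \<in> borel_measurable \<mu>"
proof -
  have [measurable]: "\<Omega> \<in> sets \<mu>" using open_measurable[OF \<Omega>] by auto
  have U [measurable]: "(\<lambda>x. if x \<in> \<Omega> then u x else 0) \<in> borel_measurable \<mu>"
    using u by (subst (asm) measurable_restrict_space_iff[of _ _ 0]) auto
  have "{x \<in> space \<mu>. d x y < a} \<in> sets \<mu>" for a
  proof -
    have "{x \<in> space \<mu>. d x y < a} = mball y a" using y by (auto simp: space_mu commute)
    then show ?thesis by simp
  qed
  then have [measurable]: "(\<lambda>x. d x y) \<in> borel_measurable \<mu>" by (simp add: borel_measurable_iff_less)
  have "truncation u k h y \<rho> R = (\<lambda>x. if x \<in> mball y R
     then real_of_ereal (max 0 (min ((if x \<in> \<Omega> then u x else 0) - ereal k) (ereal ((h - k) * max 0 (min 1 ((R - d x y) / (R - \<rho>))))))) else 0)"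
    using y(2) by (auto simp: truncation_def cutoff_def fun_eq_iff)
  also have "\<dots> \<in> borel_measurable \<mu>" by measurable
  finally show ?thesis .
qed

text \<open>At the scale \<open>r\<close>, comparable to \<open>R\<close> times a power of the density of \<open>P\<close>, each ball has at least
  twice the measure of \<open>P\<close>, so that the averages of the truncation are at most half of its maximum.\<close>

lemma level_decay:
  assumes q: "1 \<le> p" "p \<le> \<kappa>" "0 < q" and PI: "weak_poincare q p C l" and dbl: "doubling Cd" "2 \<le> Cd" and n: "4 * l + 2 \<le> 2 ^ n"
    and \<Omega>: "openin mtopology \<Omega>" "y \<in> X" "mball y R \<subseteq> \<Omega>" and R: "0 < \<rho>" "\<rho> < R\<^sub>1" "R\<^sub>1 < R" and kh: "k < h"
    and u: "u \<in> borel_measurable (restrict_space \<mu> \<Omega>)" and g: "weak_upper_gradient q \<Omega> u g" "q_integrable_bdd q \<Omega> g"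
    and P_def: "P = {x \<in> mball y R\<^sub>1. ereal k < u x}"
  shows "emeasure \<mu> {x \<in> mball y \<rho>. ereal h \<le> u x} \<le>
    ennreal (3 * Cd ^ n * (256 * Cd * max 1 C) powr \<kappa> * (R / (h - k) * (measure \<mu> P / measure \<mu> (mball y R)) powr (ln 2 / ln Cd)) powr \<kappa>)
      * (\<integral>\<^sup>+x\<in>P. epowr (g x + ennreal ((h - k) / (R\<^sub>1 - \<rho>))) \<kappa> \<partial>\<mu>)"
proof -
  define A where "A = {x \<in> mball y \<rho>. ereal h \<le> u x}"
  define L where "L = (h - k) / (R\<^sub>1 - \<rho>)"
  define I where "I = (\<integral>\<^sup>+x\<in>P. epowr (g x + ennreal L) \<kappa> \<partial>\<mu>)"
  define \<tau> where "\<tau> = h - k"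
  define x where "x = measure \<mu> P / measure \<mu> (mball y R)"
  define \<theta> where "\<theta> = ln 2 / ln Cd"
  define c where "c = 3 * Cd ^ n * (256 * Cd * max 1 C) powr \<kappa>"
  have \<kappa>: "1 \<le> \<kappa>" "0 < \<kappa>" using q by auto
  have Cd: "0 \<le> Cd" "1 < Cd" using dbl by auto
  have C: "0 < C" "1 \<le> l" using PI by (auto simp: weak_poincare_def)
  have \<tau>: "0 < \<tau>" and L: "0 < L" using kh R by (auto simp: \<tau>_def L_def)
  have \<theta>: "0 \<le> \<theta>" "\<theta> \<le> 1" using Cd dbl by (auto simp: \<theta>_def)
  have sub: "mball y \<rho> \<subseteq> mball y R\<^sub>1" "mball y R\<^sub>1 \<subseteq> mball y R" "mball y R\<^sub>1 \<subseteq> \<Omega>" "mball y \<rho> \<subseteq> \<Omega>"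
    using R \<Omega>(3) mball_subset_concentric[of \<rho> R\<^sub>1 y] mball_subset_concentric[of R\<^sub>1 R y] by auto
  have Am: "A \<in> sets \<mu>" unfolding A_def by (rule measurable_superlevel(2)[OF \<Omega>(1) u]) (use sub in auto)
  have Pm: "P \<in> sets \<mu>" unfolding P_def by (rule measurable_superlevel(1)[OF \<Omega>(1) u]) (use sub in auto)
  have AP: "A \<subseteq> P" using sub kh less_le_trans[of "ereal k" "ereal h"] by (auto simp: A_def P_def)
  have PB: "P \<subseteq> mball y R" using sub by (auto simp: P_def)
  have Pfm: "P \<in> fmeasurable \<mu>" by (rule fmeasurableI2[OF mball_in_fmeasurable[OF dbl(1) \<Omega>(2)] PB Pm])
  have Afm: "A \<in> fmeasurable \<mu>" by (rule fmeasurableI2[OF Pfm AP Am])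
  have mR: "0 < measure \<mu> (mball y R)" by (rule measure_mball_pos[OF dbl(1) \<Omega>(2)]) (use R in simp)
  have x0: "0 \<le> x" "x \<le> 1" using mR measure_mball_mono[OF dbl(1) \<Omega>(2) PB Pm] by (auto simp: x_def)
  have c0: "0 < c" using dbl C by (auto simp: c_def)
  have \<mu>P: "measure \<mu> P = x * measure \<mu> (mball y R)" using mR by (simp add: x_def)
  have AP_le: "measure \<mu> A \<le> measure \<mu> P" by (rule measure_mono_fmeasurable[OF AP Am Pfm])
  have "emeasure \<mu> A \<le> ennreal (c * (R / \<tau> * x powr \<theta>) powr \<kappa>) * I"
  \<comment> \<open>In \<open>ennreal\<close> zero times infinity is zero, so that for
    \<open>x = 0\<close> the right side vanishes even if the energy is infinite. But then
    \<open>A\<close> is a null set, being contained in \<open>P\<close>.\<close>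
  proof (cases "x = 0 \<or> I = \<infinity>")
    case True
    then show ?thesis
    proof
      assume "x = 0"
      then have "measure \<mu> A = 0" using AP_le \<mu>P by (simp add: antisym)
      then show ?thesis using emeasure_eq_measure2[OF Afm] by simp
    next
      assume I: "I = \<infinity>"
      show ?thesis
      proof (cases "x = 0")
        case True
        then have "measure \<mu> A = 0" using AP_le \<mu>P by (simp add: antisym)
        then show ?thesis using emeasure_eq_measure2[OF Afm] by simp
      next
        case False
        then have "0 < c * (R / \<tau> * x powr \<theta>) powr \<kappa>" using c0 R \<tau> x0 by simp
        then have "ennreal (c * (R / \<tau> * x powr \<theta>) powr \<kappa>) * I = \<infinity>"
          unfolding I by (rule ennreal_pos_mult_top)
        then show ?thesis by simp
      qed
    qed
  next
    case False
    then have x1: "0 < x" and Ifin: "I < \<infinity>" using x0 by (auto simp: less_top)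
    then obtain i where i: "I = ennreal i" "0 \<le> i" by (cases I) auto
    have "measure \<mu> A \<le> c * (R / \<tau> * x powr \<theta>) powr \<kappa> * i"
    \<comment> \<open>For large density there need not be balls with twice the measure of
      \<open>P\<close>. Here the constant part \<open>L\<close> of the gradient alone suffices,
      since \<open>1 / L\<close> is at most \<open>R / \<tau>\<close> and
      \<open>x powr \<theta>\<close> is at least \<open>1/2\<close>.\<close>
    proof (cases "1 / 2 < x")
      case True
      have "ennreal (L powr \<kappa> * measure \<mu> P) = (\<integral>\<^sup>+w. ennreal (L powr \<kappa>) * indicator P w \<partial>\<mu>)"
        using Pm by (simp add: nn_integral_cmult_indicator emeasure_eq_measure2[OF Pfm] ennreal_mult)
      also have "\<dots> \<le> I"
        unfolding I_def
      proof (rule nn_integral_mono)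
        fix w
        have "epowr (ennreal L) \<kappa> \<le> epowr (g w + ennreal L) \<kappa>" using \<kappa> by (intro epowr_mono) (auto simp: add_increasing)
        then show "ennreal (L powr \<kappa>) * indicator P w \<le> epowr (g w + ennreal L) \<kappa> * indicator P w"
          using L by (simp add: mult_right_mono)
      qed
      finally have "L powr \<kappa> * measure \<mu> P \<le> i" using i by simp
      then have "measure \<mu> P \<le> i / L powr \<kappa>" using L by (simp add: pos_le_divide_eq mult.commute)
      also have "\<dots> = (1 / L) powr \<kappa> * i" using L by (simp add: powr_divide)
      also have "\<dots> \<le> (2 * (R / \<tau> * x powr \<theta>)) powr \<kappa> * i"
      proof (intro mult_right_mono powr_mono2)
        have "1 / L \<le> R / \<tau> * 1" using R \<tau> by (simp add: L_def \<tau>_def divide_right_mono)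
        also have "\<dots> \<le> R / \<tau> * (2 * x powr \<theta>)"
          by (intro mult_left_mono half_le_powr \<theta> True) (use R \<tau> in auto)
        finally show "1 / L \<le> 2 * (R / \<tau> * x powr \<theta>)" by (simp add: mult_ac)
      qed (use L \<kappa> i in auto)
      also have "\<dots> = 2 powr \<kappa> * (R / \<tau> * x powr \<theta>) powr \<kappa> * i"
        using R \<tau> by (subst powr_mult) auto
      also have "\<dots> \<le> c * (R / \<tau> * x powr \<theta>) powr \<kappa> * i"
      proof (intro mult_right_mono)
        have "2 \<le> 256 * Cd * max 1 C" using mult_mono[of 1 Cd 1 "max 1 C"] Cd by auto
        then have "2 powr \<kappa> \<le> (256 * Cd * max 1 C) powr \<kappa>" using \<kappa> by (intro powr_mono2) auto
        moreover have "1 \<le> 3 * Cd ^ n" using one_le_power[OF less_imp_le[OF Cd(2)], of n] by linarith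
        ultimately have "1 * 2 powr \<kappa> \<le> 3 * Cd ^ n * (256 * Cd * max 1 C) powr \<kappa>" by (intro mult_mono) (use Cd in auto)
        then show "2 powr \<kappa> \<le> c" by (simp add: c_def)
      qed (use i in auto)
      finally show ?thesis using AP_le by simp
    next
      case False
      \<comment> \<open>Doubling \<open>N\<close> times leads from the radius \<open>r\<close> below
        to \<open>2 * R\<close>, so that a ball of radius \<open>r\<close> centred in
        \<open>A\<close> has at least the fraction \<open>1 / Cd ^ N\<close>, hence
        \<open>2 * x\<close>, of the measure of \<open>mball y R\<close>. The maximality of
        \<open>N\<close> keeps \<open>r\<close> small.\<close>
      obtain N where N: "2 * x * Cd ^ N \<le> 1" "1 < 2 * x * Cd ^ Suc N"
        using exists_scale[OF dbl(2), of "2 * x"] x1 False by auto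
      define r where "r = 2 * R / 2 ^ N"
      have r: "0 < r" using R by (simp add: r_def)
      define w where "w = truncation u k h y \<rho> R\<^sub>1"
      have w: "w \<in> borel_measurable \<mu>" "\<And>x. 0 \<le> w x" "\<And>x. w x \<le> \<tau>"
        unfolding w_def \<tau>_def using measurable_truncation[OF \<Omega>(1) u \<Omega>(2) sub(3) R(2) kh] truncation_bounds[of k h] kh by auto
      obtain B\<^sub>0 where B\<^sub>0: "B\<^sub>0 \<in> sigma_sets X {U. openin mtopology U}" "P \<subseteq> B\<^sub>0" "emeasure \<mu> B\<^sub>0 = emeasure \<mu> P"
        using borel_regular[OF Pm] by blast
      \<comment> \<open>Intersecting the Borel hull with the ball keeps it bounded and inside
        \<Omega>. It exceeds \<open>P\<close> by a null set only, so that energies over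
        \<open>B\<close> and \<open>P\<close> agree.\<close>
      define B where "B = B\<^sub>0 \<inter> mball y R\<^sub>1"
      have opens: "{U. openin mtopology U} \<subseteq> Pow X" using open_subset by auto
      have "B\<^sub>0 \<in> sets (sigma X {U. openin mtopology U})" using B\<^sub>0(1) opens by simp
      moreover have "mball y R\<^sub>1 \<in> sets (sigma X {U. openin mtopology U})" using opens by auto
      ultimately have B: "B \<in> sets (sigma X {U. openin mtopology U})" unfolding B_def by (rule sets.Int)
      then have Bm: "B \<in> sets \<mu>" using sets_sigma_subset by blast
      have B\<^sub>0m: "B\<^sub>0 \<in> sets \<mu>" using \<open>B\<^sub>0 \<in> sets (sigma X _)\<close> sets_sigma_subset by blast
      have PB': "P \<subseteq> B" using B\<^sub>0(2) by (auto simp: B_def P_def)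
      have Bb: "B \<in> sets (borel_on X)"
        unfolding borel_on_def sets_restrict_space using B sets.sets_into_space[OF Bm] space_mu by (intro image_eqI[of _ _ B]) auto
      have "emeasure \<mu> (B - P) = 0"
      proof -
        have "emeasure \<mu> (B - P) \<le> emeasure \<mu> (B\<^sub>0 - P)" by (rule emeasure_mono) (use B\<^sub>0m Pm in \<open>auto simp: B_def\<close>)
        also have "\<dots> = emeasure \<mu> B\<^sub>0 - emeasure \<mu> P"
          by (rule emeasure_Diff) (use Pfm Pm B\<^sub>0m B\<^sub>0(2) in \<open>auto simp: fmeasurable_def less_top\<close>)
        also have "\<dots> = 0" by (simp add: B\<^sub>0(3) emeasure_eq_measure2[OF Pfm] ennreal_minus)
        finally show ?thesis by simp
      qed
      then have BP: "AE w in \<mu>. w \<in> B \<longrightarrow> w \<in> P"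
        using Bm Pm by (intro AE_I[of _ _ "B - P"]) auto
      define G where "G w = (g w * indicator \<Omega> w + ennreal L) * indicator B w" for w
      have G_ug: "weak_upper_gradient q X (\<lambda>w'. ereal (w w')) G"
        unfolding w_def G_def L_def
        by (rule weak_upper_gradient_truncation[OF q(3) \<Omega>(1,2) R(2,3) \<Omega>(3) kh g Bb]) (use PB' in \<open>simp add: P_def\<close>)
      have g_meas: "g \<in> borel_measurable (borel_on \<Omega>)" using g by (simp add: weak_upper_gradient_def)
      have Gm: "G \<in> borel_measurable \<mu>"
        unfolding G_def using borel_on_extend(2)[OF \<Omega>(1) g_meas] Bm by measurable
      have B\<Omega>: "B \<subseteq> mball y R\<^sub>1" "B \<subseteq> \<Omega>" using sub by (auto simp: B_def)
      have G_int: "q_integrable_bdd q X G"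
        unfolding q_integrable_bdd_def
      proof (intro ballI impI)
        fix E assume E: "E \<in> sets \<mu>" "E \<subseteq> X \<and> mbounded E"
        have "(\<integral>\<^sup>+w\<in>E. epowr (G w) q \<partial>\<mu>) \<le> (\<integral>\<^sup>+w. ennreal (2 powr q) * (epowr (g w) q * indicator B w) + ennreal (2 powr q) * ennreal (L powr q) * indicator B w \<partial>\<mu>)"
        proof (rule nn_integral_mono)
          fix w show "epowr (G w) q * indicator E w \<le> ennreal (2 powr q) * (epowr (g w) q * indicator B w) + ennreal (2 powr q) * ennreal (L powr q) * indicator B w"
            using epowr_add_le[OF q(3), of "g w" "ennreal L"] B\<Omega>(2) L by (auto simp: G_def indicator_def distrib_left)
        qed
        also have "\<dots> = ennreal (2 powr q) * (\<integral>\<^sup>+w\<in>B. epowr (g w) q \<partial>\<mu>) + ennreal (2 powr q) * ennreal (L powr q) * emeasure \<mu> B"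
        proof -
          have "(\<lambda>w. epowr (g w) q * indicator \<Omega> w * indicator B w) \<in> borel_measurable \<mu>"
            using measurable_epowr_indicator[OF \<Omega>(1) g_meas] Bm by measurable
          moreover have "(\<lambda>w. epowr (g w) q * indicator \<Omega> w * indicator B w) = (\<lambda>w. epowr (g w) q * indicator B w)"
            using B\<Omega>(2) by (auto simp: indicator_def fun_eq_iff)
          ultimately have "(\<lambda>w. epowr (g w) q * indicator B w) \<in> borel_measurable \<mu>" by simp
          then show ?thesis
            by (subst nn_integral_add) (use Bm in \<open>auto simp: nn_integral_cmult nn_integral_cmult_indicator\<close>)
        qed
        also have "\<dots> < \<infinity>"
        proof -
          have "mbounded B" using B\<Omega>(1) by (rule mbounded_subset[OF mbounded_mball])
          then have "(\<integral>\<^sup>+w\<in>B. epowr (g w) q \<partial>\<mu>) < \<infinity>" using g(2) Bm B\<Omega>(2) unfolding q_integrable_bdd_def by blast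
          moreover have "emeasure \<mu> B < \<infinity>"
            using fmeasurableI2[OF mball_in_fmeasurable[OF dbl(1) \<Omega>(2)] B\<Omega>(1) Bm] by (simp add: fmeasurable_def)
          ultimately show ?thesis by (simp add: ennreal_mult_less_top)
        qed
        finally show "(\<integral>\<^sup>+w\<in>E. epowr (G w) q \<partial>\<mu>) < \<infinity>" .
      qed
      have GI: "(\<integral>\<^sup>+w. epowr (G w) \<kappa> \<partial>\<mu>) = I"
        unfolding I_def
      proof (rule nn_integral_cong_AE)
        show "AE w in \<mu>. epowr (G w) \<kappa> = epowr (g w + ennreal L) \<kappa> * indicator P w"
          using BP
        proof eventually_elim
          case (elim w)
          then show ?case using PB' B\<Omega>(2) by (auto simp: G_def indicator_def)
        qed
      qed
      let ?\<nu> = "density \<mu> (\<lambda>w. epowr (G w) \<kappa>)"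
      have "emeasure ?\<nu> X = I"
        using Gm sets.top[of \<mu>] unfolding space_mu by (subst emeasure_density) (auto simp: GI[symmetric] space_mu intro!: nn_integral_cong)
      then have \<nu>X: "measure ?\<nu> X = i" using i by (simp add: measure_def)
      have \<nu>fin: "finite_measure ?\<nu>"
        by (rule finite_measureI) (use \<open>emeasure ?\<nu> X = I\<close> Ifin in \<open>simp add: space_mu less_top\<close>)
      have PIw: "poincare_at \<kappa> (2 * C) l w ?\<nu>"
        by (rule poincare_at_of_weak_poincare[OF q(3) PI dbl(1) q(1,2) w G_ug G_int Gm]) (use GI Ifin in simp)
      have wA: "w z = \<tau>" if "z \<in> A" for z
        unfolding w_def \<tau>_def by (rule truncation_eq_top[OF kh R(2)]) (use that in \<open>auto simp: A_def\<close>)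
      have avg: "average w z r \<le> \<tau> / 2" if z: "z \<in> A" for z
      proof -
        have z': "z \<in> X" "d y z < R" using z R by (auto simp: A_def)
        have "measure \<mu> (mball y R) \<le> measure \<mu> (mball z (2 ^ N * r))"
        proof (rule measure_mball_mono[OF dbl(1) z'(1)])
          show "mball y R \<subseteq> mball z (2 ^ N * r)" using z' \<Omega>(2) by (intro mball_subset) (auto simp: r_def commute)
        qed simp
        also have "\<dots> \<le> Cd ^ N * measure \<mu> (mball z r)" by (rule measure_mball_pow[OF dbl(1) z'(1) r Cd(1)])
        finally have "2 * x * measure \<mu> (mball y R) \<le> 2 * x * (Cd ^ N * measure \<mu> (mball z r))"
          using x1 by (intro mult_left_mono) auto
        also have "\<dots> = (2 * x * Cd ^ N) * measure \<mu> (mball z r)" by simp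
        also have "\<dots> \<le> 1 * measure \<mu> (mball z r)" by (rule mult_right_mono[OF N(1)]) simp
        finally have le: "2 * measure \<mu> P \<le> measure \<mu> (mball z r)" using \<mu>P by simp
        \<comment> \<open>The truncation vanishes off \<open>P\<close> and is at most \<tau> on it,
          while \<open>P\<close> has at most half of the measure of the ball.\<close>
        have "(LINT w':mball z r|\<mu>. w w') \<le> (LINT w'|\<mu>. \<tau> * indicator P w')"
          unfolding set_lebesgue_integral_def
        proof (rule integral_mono)
          show "integrable \<mu> (\<lambda>w'. indicat_real (mball z r) w' *\<^sub>R w w')"
            using set_integrable_bounded[OF mball_in_fmeasurable[OF dbl(1) z'(1)] w(1), of \<tau> r] w(2,3) by (simp add: set_integrable_def)
          show "integrable \<mu> (\<lambda>w'. \<tau> * indicator P w')" using Pfm by (simp add: fmeasurable_def)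
          fix w'
          have "w w' = 0" if "w' \<notin> P"
          proof (rule ccontr)
            assume "w w' \<noteq> 0"
            then have "0 < w w'" using w(2)[of w'] by simp
            from truncation_pos[OF this[unfolded w_def]] that show False by (simp add: P_def)
          qed
          then show "indicat_real (mball z r) w' *\<^sub>R w w' \<le> \<tau> * indicator P w'"
            using w(3)[of w'] \<tau> by (cases "w' \<in> P") (auto simp: indicator_def)
        qed
        also have "\<dots> = \<tau> * measure \<mu> P" using Pm by simp
        also have "\<dots> \<le> \<tau> * (measure \<mu> (mball z r) / 2)" using le \<tau> by (intro mult_left_mono) auto
        finally show ?thesis
          unfolding average_def using measure_mball_pos[OF dbl(1) z'(1) r] by (simp add: divide_le_eq)
      qed
      have "measure \<mu> A \<le> 3 * Cd ^ n * (16 * Cd * (2 * C) * r / \<tau>) powr \<kappa> * measure ?\<nu> X"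
      proof (rule measure_level_set_le[OF dbl(1) Cd(1) C(2) n _ \<kappa>(1) w \<tau> _ \<nu>fin PIw \<Omega>(2) Am _ wA r avg])
        show "A \<subseteq> mball y \<rho>" by (auto simp: A_def)
      qed (use C in auto)
      also have "\<dots> \<le> 3 * Cd ^ n * ((256 * Cd * max 1 C) * (R / \<tau> * x powr \<theta>)) powr \<kappa> * measure ?\<nu> X"
      proof (intro mult_right_mono mult_left_mono powr_mono2)
        \<comment> \<open>Since \<open>Cd powr \<theta> = 2\<close>, the maximality of
          \<open>N\<close> becomes \<open>1 / 2 ^ N \<le> 4 * x powr \<theta>\<close>, that is
          \<open>r \<le> 8 * R * x powr \<theta>\<close>. The constant 256 is
          \<open>16 * 2 * 8\<close>.\<close>
        have two: "Cd powr \<theta> = 2" using Cd by (simp add: \<theta>_def powr_def)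
        have "2 ^ Suc N = (Cd powr \<theta>) ^ Suc N" by (simp add: two)
        also have "\<dots> = (Cd ^ Suc N) powr \<theta>"
          using Cd by (simp add: powr_realpow[symmetric] powr_powr mult.commute del: power_Suc)
        finally have pw: "(Cd ^ Suc N) powr \<theta> = 2 ^ Suc N" by simp
        have "1 powr \<theta> \<le> (2 * x * Cd ^ Suc N) powr \<theta>" using N(2) \<theta> by (intro powr_mono2) auto
        also have "\<dots> = (2 * x) powr \<theta> * 2 ^ Suc N" unfolding pw[symmetric] using x1 Cd by (subst powr_mult) auto
        also have "\<dots> \<le> (2 * x powr \<theta>) * 2 ^ Suc N"
        proof (rule mult_right_mono)
          have "(2 * x) powr \<theta> = 2 powr \<theta> * x powr \<theta>" using x1 by (simp add: powr_mult)
          also have "2 powr \<theta> \<le> 2 powr (1::real)" using \<theta> by (intro powr_mono) auto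
          finally show "(2 * x) powr \<theta> \<le> 2 * x powr \<theta>" by (simp add: mult_right_mono)
        qed simp
        finally have "1 \<le> 4 * x powr \<theta> * 2 ^ N" by simp
        then have "r \<le> 8 * R * x powr \<theta>" using R by (simp add: r_def field_simps)
        then have "16 * Cd * (2 * C) * r / \<tau> \<le> 16 * Cd * (2 * C) * (8 * R * x powr \<theta>) / \<tau>"
          using Cd C \<tau> by (intro divide_right_mono mult_left_mono) auto
        also have "\<dots> = (256 * Cd * C) * (R / \<tau> * x powr \<theta>)" by simp
        also have "\<dots> \<le> (256 * Cd * max 1 C) * (R / \<tau> * x powr \<theta>)"
          using Cd R \<tau> by (intro mult_right_mono mult_left_mono) auto
        finally show "16 * Cd * (2 * C) * r / \<tau> \<le> (256 * Cd * max 1 C) * (R / \<tau> * x powr \<theta>)" .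
      qed (use Cd C r \<tau> \<kappa> in auto)
      also have "\<dots> = c * (R / \<tau> * x powr \<theta>) powr \<kappa> * i"
        unfolding c_def \<nu>X using Cd R \<tau> by (subst powr_mult) auto
      finally show ?thesis .
    qed
    then show ?thesis unfolding i(1) emeasure_eq_measure2[OF Afm] using i(2) c0 by (simp add: ennreal_mult[symmetric] ennreal_leI)
  qed
  then show ?thesis unfolding A_def I_def L_def \<tau>_def x_def \<theta>_def c_def .
qed

end

section \<open>De Giorgi iteration\<close>

text \<open>The function \<Phi>. Integrands may be infinite and use this form, whereas heights are
  real numbers and use \<open>double_phase_real\<close>.\<close>

definition double_phase :: "real \<Rightarrow> real \<Rightarrow> ennreal \<Rightarrow> ennreal" where
  "double_phase p q x = epowr x p + epowr x q"

definition double_phase_real :: "real \<Rightarrow> real \<Rightarrow> real \<Rightarrow> real" where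
  "double_phase_real p q s = s powr p + s powr q"

lemma double_phase_ennreal: "0 \<le> s \<Longrightarrow> double_phase p q (ennreal s) = ennreal (double_phase_real p q s)"
  by (simp add: double_phase_def double_phase_real_def)

lemma double_phase_mono: "0 \<le> p \<Longrightarrow> 0 \<le> q \<Longrightarrow> x \<le> y \<Longrightarrow> double_phase p q x \<le> double_phase p q y"
  unfolding double_phase_def by (intro add_mono epowr_mono)

lemma double_phase_real_pos: "0 < s \<Longrightarrow> 0 < double_phase_real p q s"
  by (simp add: double_phase_real_def add_pos_pos)

text \<open>A substitute for homogeneity: of the two factors, \<open>c powr p\<close> is the smaller
  one for \<open>c \<ge> 1\<close>, and \<open>c powr q\<close> for
  \<open>c \<le> 1\<close>.\<close>

lemma double_phase_real_scale:
  assumes "0 \<le> s" "p \<le> q"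
  shows "1 \<le> c \<Longrightarrow> double_phase_real p q (c * s) \<le> c powr q * double_phase_real p q s"
    and "1 \<le> c \<Longrightarrow> c powr p * double_phase_real p q s \<le> double_phase_real p q (c * s)"
    and "0 < c \<Longrightarrow> c \<le> 1 \<Longrightarrow> c powr q * double_phase_real p q s \<le> double_phase_real p q (c * s)"
proof -
  have eq: "double_phase_real p q (c * s) = c powr p * s powr p + c powr q * s powr q" if "0 \<le> c"
    using assms that by (simp add: double_phase_real_def powr_mult)
  { assume c: "1 \<le> c"
    have "c powr p \<le> c powr q" using assms c by (intro powr_mono) auto
    then show "double_phase_real p q (c * s) \<le> c powr q * double_phase_real p q s"
      "c powr p * double_phase_real p q s \<le> double_phase_real p q (c * s)"
      using c unfolding eq[OF order_trans[OF zero_le_one c]] unfolding double_phase_real_def distrib_left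
      by (auto intro!: add_mono mult_right_mono) }
  assume c: "0 < c" "c \<le> 1"
  have "c powr q \<le> c powr p" using assms c by (intro powr_mono') auto
  then show "c powr q * double_phase_real p q s \<le> double_phase_real p q (c * s)"
    using c unfolding eq[OF less_imp_le[OF c(1)]] unfolding double_phase_real_def distrib_left
    by (auto intro!: add_mono mult_right_mono)
qed

lemma exists_dyadic:
  assumes "1 < (z::real)"
  shows "\<exists>m::nat. 2 ^ m < z \<and> z \<le> 2 ^ Suc m"
proof -
  obtain n where n: "z < 2 ^ n" using real_arch_pow[of 2 z] by auto
  define N where "N = (LEAST n. z \<le> 2 ^ n)"
  have N: "z \<le> 2 ^ N" unfolding N_def by (rule LeastI[of _ n]) (use n in simp)
  have "N \<noteq> 0" using N assms by (cases N) auto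
  then obtain M where M: "N = Suc M" by (cases N) auto
  have "\<not> z \<le> 2 ^ M" using not_less_Least[of M "\<lambda>n. z \<le> 2 ^ n"] M by (simp add: N_def)
  then show ?thesis using N M by (intro exI[of _ M]) auto
qed

context borel_regular_space
begin

definition excess :: "('a \<Rightarrow> ereal) \<Rightarrow> real \<Rightarrow> real \<Rightarrow> 'a \<Rightarrow> ennreal" where
  "excess u R k x = ennreal (1 / R) * e2ennreal (u x - ereal k)"

definition phase_integral :: "real \<Rightarrow> real \<Rightarrow> ('a \<Rightarrow> ereal) \<Rightarrow> 'a \<Rightarrow> real \<Rightarrow> real \<Rightarrow> real \<Rightarrow> ennreal" where
  "phase_integral p q u y R k r = (\<integral>\<^sup>+x\<in>mball y r. double_phase p q (excess u R k x) \<partial>\<mu>)"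

lemma excess_ge:
  assumes "0 < R" "ereal (k + R * s) \<le> u x" "0 \<le> s"
  shows "ennreal s \<le> excess u R k x"
proof -
  have "ennreal s = ennreal (1 / R) * e2ennreal (ereal (R * s))"
    using assms by (simp add: e2ennreal_ereal ennreal_mult[symmetric])
  also have "\<dots> \<le> excess u R k x"
    unfolding excess_def
  proof (intro mult_left_mono e2ennreal_mono)
    show "ereal (R * s) \<le> u x - ereal k" using assms(2) by (cases "u x") auto
  qed simp
  finally show ?thesis .
qed

lemma excess_eq_0: "u x \<le> ereal k \<Longrightarrow> excess u R k x = 0"
  by (cases "u x") (auto simp: excess_def e2ennreal_ereal e2ennreal_neg ennreal_neg)

lemma epowr_e2ennreal_eq_excess:
  assumes "0 < R"
  shows "epowr (e2ennreal (u x - ereal k)) \<kappa> = ennreal (R powr \<kappa>) * epowr (excess u R k x) \<kappa>"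
proof -
  have "e2ennreal (u x - ereal k) = ennreal R * excess u R k x"
    unfolding excess_def using assms by (simp add: mult.assoc[symmetric] ennreal_mult[symmetric])
  then show ?thesis using epowr_mult[OF assms] by simp
qed

lemma excess_antimono: "k \<le> k' \<Longrightarrow> excess u R k' x \<le> excess u R k x"
  unfolding excess_def by (intro mult_left_mono e2ennreal_mono ereal_minus_mono) auto

lemma measurable_excess:
  assumes "openin mtopology \<Omega>" "u \<in> borel_measurable (restrict_space \<mu> \<Omega>)" "B \<in> sets \<mu>" "B \<subseteq> \<Omega>"
  shows "(\<lambda>x. epowr (excess u R k x) \<kappa> * indicator B x) \<in> borel_measurable \<mu>"
  unfolding excess_def
  by (rule measurable_superlevel(3)[OF assms, where f="\<lambda>v. epowr (ennreal (1 / R) * e2ennreal (v - ereal k)) \<kappa>"]) measurable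

text \<open>This treats one term on the right side of the De Giorgi inequality. With the excess
  measured in units of \<open>R\<close>, the factor \<open>1 / e powr \<kappa>\<close> turns into
  \<open>(R / e) powr \<kappa>\<close>, and \<open>e \<le> R\<close> allows the common exponent
  \<open>q\<close>.\<close>

lemma superlevel_excess_bound:
  assumes R: "0 < R" and e: "0 < e" "e \<le> R" and \<kappa>: "0 < \<kappa>" "\<kappa> \<le> q"
    and c: "\<And>x. x \<in> X \<Longrightarrow> c x \<le> \<beta>" "0 \<le> \<beta>" and k: "k \<le> k'" and B: "B \<in> sets \<mu>" "S \<subseteq> B"
    and u: "(\<lambda>x. epowr (excess u R k x) \<kappa> * indicator B x) \<in> borel_measurable \<mu>"
  shows "ennreal (1 / e powr \<kappa>) * (\<integral>\<^sup>+x\<in>S. ennreal (c x) * epowr (e2ennreal (u x - ereal k')) \<kappa> \<partial>\<mu>)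
    \<le> ennreal (\<beta> * (R / e) powr q) * (\<integral>\<^sup>+x\<in>B. epowr (excess u R k x) \<kappa> \<partial>\<mu>)"
proof -
  have "(\<integral>\<^sup>+x\<in>S. ennreal (c x) * epowr (e2ennreal (u x - ereal k')) \<kappa> \<partial>\<mu>)
    \<le> (\<integral>\<^sup>+x. ennreal (\<beta> * R powr \<kappa>) * (epowr (excess u R k x) \<kappa> * indicator B x) \<partial>\<mu>)"
  proof (rule nn_integral_mono)
    fix x assume "x \<in> space \<mu>"
    then have x: "ennreal (c x) \<le> ennreal \<beta>" using c(1) by (simp add: space_mu ennreal_leI)
    have "ennreal (c x) * (ennreal (R powr \<kappa>) * epowr (excess u R k' x) \<kappa>) \<le> ennreal \<beta> * (ennreal (R powr \<kappa>) * epowr (excess u R k x) \<kappa>)"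
      by (intro mult_mono x epowr_mono excess_antimono k) (use \<kappa> in auto)
    then show "ennreal (c x) * epowr (e2ennreal (u x - ereal k')) \<kappa> * indicator S x \<le> ennreal (\<beta> * R powr \<kappa>) * (epowr (excess u R k x) \<kappa> * indicator B x)"
      unfolding epowr_e2ennreal_eq_excess[OF R] using B(2) c(2) by (auto simp: indicator_def ennreal_mult mult.assoc)
  qed
  also have "\<dots> = ennreal (\<beta> * R powr \<kappa>) * (\<integral>\<^sup>+x\<in>B. epowr (excess u R k x) \<kappa> \<partial>\<mu>)"
    by (rule nn_integral_cmult[OF u])
  finally have "ennreal (1 / e powr \<kappa>) * (\<integral>\<^sup>+x\<in>S. ennreal (c x) * epowr (e2ennreal (u x - ereal k')) \<kappa> \<partial>\<mu>)
    \<le> ennreal (1 / e powr \<kappa>) * (ennreal (\<beta> * R powr \<kappa>) * (\<integral>\<^sup>+x\<in>B. epowr (excess u R k x) \<kappa> \<partial>\<mu>))"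
    by (rule mult_left_mono) simp
  also have "\<dots> = ennreal (\<beta> * (R / e) powr \<kappa>) * (\<integral>\<^sup>+x\<in>B. epowr (excess u R k x) \<kappa> \<partial>\<mu>)"
    using R e c(2) by (simp add: mult.assoc[symmetric] ennreal_mult[symmetric] powr_divide)
  also have "\<dots> \<le> ennreal (\<beta> * (R / e) powr q) * (\<integral>\<^sup>+x\<in>B. epowr (excess u R k x) \<kappa> \<partial>\<mu>)"
    by (intro mult_right_mono ennreal_leI mult_left_mono powr_mono) (use R e \<kappa> c(2) in auto)
  finally show ?thesis .
qed

lemma phase_integral_eq:
  assumes "openin mtopology \<Omega>" "u \<in> borel_measurable (restrict_space \<mu> \<Omega>)" "mball y r \<subseteq> \<Omega>"
  shows "phase_integral p q u y R k r = (\<integral>\<^sup>+x\<in>mball y r. epowr (excess u R k x) p \<partial>\<mu>) + (\<integral>\<^sup>+x\<in>mball y r. epowr (excess u R k x) q \<partial>\<mu>)"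
  unfolding phase_integral_def double_phase_def distrib_right
  by (rule nn_integral_add) (intro measurable_excess[OF assms(1,2) _ assms(3)] mball_measurable)+

text \<open>The bounds for the coefficients turn the weighted De Giorgi inequality into one for
  \<Phi> on both sides, at the price of the factor \<open>\<beta> / \<alpha>\<close>.\<close>

lemma gradient_level_bound:
  assumes pq: "1 \<le> p" "p < q" and \<Omega>: "openin mtopology \<Omega>" "y \<in> \<Omega>" and R: "0 < R" "R \<le> half_dist \<Omega> y" "mball y R \<subseteq> \<Omega>"
    and ab: "0 < \<alpha>" "\<And>x. x \<in> X \<Longrightarrow> \<alpha> \<le> a x \<and> a x \<le> \<beta> \<and> \<alpha> \<le> b x \<and> b x \<le> \<beta>"
    and dg: "de_giorgi p q a b \<Omega> C\<^sub>D\<^sub>G u" "0 < C\<^sub>D\<^sub>G" and g: "minimal_weak_ug q \<Omega> u g"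
    and e: "0 < e" "0 < \<rho>" "\<rho> + e < r" "r \<le> R" and k: "k \<le> k'"
    and Y: "phase_integral p q u y R k r \<le> ennreal Y" "0 \<le> Y"
  shows "(\<integral>\<^sup>+x\<in>{x \<in> mball y \<rho>. ereal k' < u x}. epowr (g x) p + epowr (g x) q \<partial>\<mu>)
    \<le> ennreal (C\<^sub>D\<^sub>G * \<beta> / \<alpha> * (R / e) powr q * Y)"
proof -
  let ?P = "{x \<in> mball y \<rho>. ereal k' < u x}" and ?S = "superlevel \<Omega> u y k' (\<rho> + e)"
  have u: "u \<in> borel_measurable (restrict_space \<mu> \<Omega>)" using dg(1) by (simp add: de_giorgi_def newtonian_loc_def)
  have \<beta>: "0 < \<beta>" using ab(1) ab(2)[of y] open_subset[OF \<Omega>(1)] \<Omega>(2) by force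
  have sub: "mball y r \<subseteq> \<Omega>" "mball y \<rho> \<subseteq> \<Omega>" "mball y (\<rho> + e) \<subseteq> mball y r"
    using R(3) e mball_subset_concentric[of r R y] mball_subset_concentric[of \<rho> R y] mball_subset_concentric[of "\<rho> + e" r y] by auto
  have P: "superlevel \<Omega> u y k' \<rho> = ?P" using sub(2) by (auto simp: superlevel_def)
  have Pm: "?P \<in> sets \<mu>" by (rule measurable_superlevel(1)[OF \<Omega>(1) u _ sub(2)]) simp
  have g_meas: "g \<in> borel_measurable (borel_on \<Omega>)" using g by (simp add: minimal_weak_ug_def weak_upper_gradient_def)
  have gm: "(\<lambda>x. (epowr (g x) p + epowr (g x) q) * indicator ?P x) \<in> borel_measurable \<mu>"
  proof -
    have "(\<lambda>x. (epowr (g x) p * indicator \<Omega> x + epowr (g x) q * indicator \<Omega> x) * indicator ?P x) \<in> borel_measurable \<mu>"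
      using measurable_epowr_indicator[OF \<Omega>(1) g_meas, of p] measurable_epowr_indicator[OF \<Omega>(1) g_meas, of q] Pm by measurable
    also have "(\<lambda>x. (epowr (g x) p * indicator \<Omega> x + epowr (g x) q * indicator \<Omega> x) * indicator ?P x) = (\<lambda>x. (epowr (g x) p + epowr (g x) q) * indicator ?P x)"
      using sub(2) by (auto simp: indicator_def fun_eq_iff)
    finally show ?thesis .
  qed
  let ?I = "\<integral>\<^sup>+x\<in>?P. epowr (g x) p + epowr (g x) q \<partial>\<mu>"
  have "ennreal \<alpha> * ?I = (\<integral>\<^sup>+x. ennreal \<alpha> * ((epowr (g x) p + epowr (g x) q) * indicator ?P x) \<partial>\<mu>)"
    by (rule nn_integral_cmult[OF gm, symmetric])
  also have "\<dots> \<le> (\<integral>\<^sup>+x\<in>?P. ennreal (a x) * epowr (g x) p + ennreal (b x) * epowr (g x) q \<partial>\<mu>)"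
  proof (rule nn_integral_mono)
    fix x assume "x \<in> space \<mu>"
    then have "ennreal \<alpha> \<le> ennreal (a x)" "ennreal \<alpha> \<le> ennreal (b x)" using ab(2)[of x] by (auto simp: space_mu intro: ennreal_leI)
    then show "ennreal \<alpha> * ((epowr (g x) p + epowr (g x) q) * indicator ?P x) \<le> (ennreal (a x) * epowr (g x) p + ennreal (b x) * epowr (g x) q) * indicator ?P x"
      by (auto simp: indicator_def distrib_left intro!: add_mono mult_right_mono)
  qed
  also have "\<dots> \<le> ennreal C\<^sub>D\<^sub>G *
           (ennreal (1 / e powr p) * (\<integral>\<^sup>+ x \<in> ?S. ennreal (a x) * epowr (e2ennreal (u x - ereal k')) p \<partial>\<mu>)
            + ennreal (1 / e powr q) * (\<integral>\<^sup>+ x \<in> ?S. ennreal (b x) * epowr (e2ennreal (u x - ereal k')) q \<partial>\<mu>))"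
  proof -
    \<comment> \<open>The inequality is available only strictly below \<open>half_dist\<close>,
      whereas \<open>R\<close> may be equal to it; hence the slack
      \<open>\<rho> + e < r\<close>.\<close>
    have "0 < \<rho> \<and> \<rho> < \<rho> + e \<and> \<rho> + e < half_dist \<Omega> y" using e R by auto
    from dg(1)[unfolded de_giorgi_def, THEN conjunct2, rule_format, OF g \<Omega>(2) this, of k']
    show ?thesis unfolding P by simp
  qed
  also have "\<dots> \<le> ennreal C\<^sub>D\<^sub>G * (ennreal (\<beta> * (R / e) powr q) * (\<integral>\<^sup>+x\<in>mball y r. epowr (excess u R k x) p \<partial>\<mu>)
      + ennreal (\<beta> * (R / e) powr q) * (\<integral>\<^sup>+x\<in>mball y r. epowr (excess u R k x) q \<partial>\<mu>))"
  proof (intro mult_left_mono add_mono superlevel_excess_bound)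
    show "?S \<subseteq> mball y r" using sub(3) by (auto simp: superlevel_def)
    show "?S \<subseteq> mball y r" using sub(3) by (auto simp: superlevel_def)
  qed (use R(1) e pq ab \<beta> k measurable_excess[OF \<Omega>(1) u _ sub(1)] in auto)
  also have "\<dots> = ennreal C\<^sub>D\<^sub>G * (ennreal (\<beta> * (R / e) powr q) * phase_integral p q u y R k r)"
    unfolding phase_integral_eq[OF \<Omega>(1) u sub(1)] by (simp add: distrib_left)
  also have "\<dots> \<le> ennreal C\<^sub>D\<^sub>G * (ennreal (\<beta> * (R / e) powr q) * ennreal Y)"
    by (intro mult_left_mono Y) auto
  also have "\<dots> = ennreal (C\<^sub>D\<^sub>G * (\<beta> * (R / e) powr q * Y))"
    using dg(2) \<beta> Y(2) by (simp add: ennreal_mult[symmetric])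
  finally have *: "ennreal \<alpha> * ?I \<le> ennreal (C\<^sub>D\<^sub>G * (\<beta> * (R / e) powr q * Y))" .
  have "?I = ennreal (1 / \<alpha>) * (ennreal \<alpha> * ?I)"
    using ab(1) by (simp add: mult.assoc[symmetric] ennreal_mult[symmetric])
  also have "\<dots> \<le> ennreal (1 / \<alpha>) * ennreal (C\<^sub>D\<^sub>G * (\<beta> * (R / e) powr q * Y))" by (rule mult_left_mono[OF *]) simp
  also have "\<dots> = ennreal (C\<^sub>D\<^sub>G * \<beta> / \<alpha> * (R / e) powr q * Y)"
    using ab(1) dg(2) \<beta> Y(2) by (simp add: ennreal_mult[symmetric])
  finally show ?thesis .
qed

text \<open>Chebyshev's inequality: above the height \<open>k + R * s\<close> the excess over
  \<open>k\<close> is at least \<open>s\<close>.\<close>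

lemma level_measure_le:
  assumes pq: "0 \<le> p" "0 \<le> q" and R: "0 < R" "\<rho> \<le> r" and s: "0 < s"
    and Y: "phase_integral p q u y R k r \<le> ennreal Y" "0 \<le> Y"
    and P: "P = {x \<in> mball y \<rho>. ereal (k + R * s) < u x}" "P \<in> sets \<mu>" and fin: "emeasure \<mu> P = ennreal m"
    and m: "0 \<le> m"
  shows "double_phase_real p q s * m \<le> Y"
proof -
  have "ennreal (double_phase_real p q s * m) = (\<integral>\<^sup>+x. ennreal (double_phase_real p q s) * indicator P x \<partial>\<mu>)"
    using P(2) fin m double_phase_real_pos[OF s] by (simp add: nn_integral_cmult_indicator ennreal_mult less_imp_le)
  also have "\<dots> \<le> phase_integral p q u y R k r"
    unfolding phase_integral_def
  proof (rule nn_integral_mono)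
    fix x
    show "ennreal (double_phase_real p q s) * indicator P x \<le> double_phase p q (excess u R k x) * indicator (mball y r) x"
    proof (cases "x \<in> P")
      case True
      then have "ennreal s \<le> excess u R k x" using R s by (intro excess_ge) (auto simp: P less_imp_le)
      then have "double_phase p q (ennreal s) \<le> double_phase p q (excess u R k x)" by (rule double_phase_mono[OF pq])
      moreover have "x \<in> mball y r" using True R mball_subset_concentric[of \<rho> r y] by (auto simp: P)
      ultimately show ?thesis using True s by (simp add: double_phase_ennreal)
    qed simp
  qed
  also have "\<dots> \<le> ennreal Y" by (rule Y)
  finally show ?thesis using Y(2) by simp
qed

text \<open>If \<open>(u x - k) / (2 * R * s)\<close> lies between \<open>2 ^ m\<close> and
  \<open>2 ^ Suc m\<close>, then \<open>x\<close> belongs to the layer \<open>m\<close>, and its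
  excess is at most \<open>4 * (2 ^ m * s)\<close>: one factor 2 for the dyadic step, one for the
  spacing \<open>2 * R\<close>. This single summand already dominates the left side.\<close>

lemma double_phase_layers:
  assumes pq: "0 \<le> p" "p \<le> q" and R: "0 < R" and s: "0 < s" and fin: "u x \<noteq> \<infinity>"
  shows "double_phase p q (excess u R (k + 2 * R * s) x) \<le>
    (\<Sum>m. ennreal (4 powr q * double_phase_real p q (2 ^ m * s)) * indicator {x. ereal (k + 2 * R * (2 ^ m * s)) \<le> u x} x)"
proof (cases "u x \<le> ereal (k + 2 * R * s)")
  case True
  then show ?thesis by (simp add: excess_eq_0 double_phase_def)
next
  case False
  then obtain w where w: "u x = ereal w" "k + 2 * R * s < w" using fin by (cases "u x") auto
  have "1 < (w - k) / (2 * R * s)" using w R s by (simp add: field_simps)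
  then obtain m :: nat where m: "2 ^ m < (w - k) / (2 * R * s)" "(w - k) / (2 * R * s) \<le> 2 ^ Suc m"
    using exists_dyadic by blast
  then have m': "2 ^ m * (2 * R * s) < w - k" "w - k \<le> 2 ^ Suc m * (2 * R * s)"
    using R s by (simp_all add: pos_less_divide_eq pos_divide_le_eq)
  have "excess u R (k + 2 * R * s) x \<le> excess u R k x" using R s by (intro excess_antimono) simp
  also have "\<dots> = ennreal ((w - k) / R)"
    using R w mult_pos_pos[OF R s] by (simp add: excess_def e2ennreal_ereal ennreal_mult[symmetric])
  also have "\<dots> \<le> ennreal (4 * (2 ^ m * s))"
    using m'(2) R by (intro ennreal_leI) (simp add: pos_divide_le_eq mult_ac)
  finally have "double_phase p q (excess u R (k + 2 * R * s) x) \<le> double_phase p q (ennreal (4 * (2 ^ m * s)))"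
    using pq by (intro double_phase_mono) auto
  also have "\<dots> = ennreal (double_phase_real p q (4 * (2 ^ m * s)))" using s by (intro double_phase_ennreal) simp
  also have "\<dots> \<le> ennreal (4 powr q * double_phase_real p q (2 ^ m * s))"
    using s pq by (intro ennreal_leI double_phase_real_scale) auto
  also have "\<dots> = ennreal (4 powr q * double_phase_real p q (2 ^ m * s)) * indicator {x. ereal (k + 2 * R * (2 ^ m * s)) \<le> u x} x"
    using m'(1) w by (simp add: mult_ac)
  also have "\<dots> \<le> (\<Sum>m. ennreal (4 powr q * double_phase_real p q (2 ^ m * s)) * indicator {x. ereal (k + 2 * R * (2 ^ m * s)) \<le> u x} x)"
    by (rule ennreal_le_suminf)
  finally show ?thesis .
qed

text \<open>The rise by \<open>2 * R * s\<close> is spent in two halves. From \<open>k\<close> to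
  \<open>k + R * s\<close>, Chebyshev's inequality bounds the density of \<open>P\<close>; from
  there to \<open>k + 2 * R * s\<close>, \<open>level_decay\<close> bounds the measure by the energy
  on \<open>P\<close>, which the De Giorgi inequality bounds by \<open>Y\<close>.\<close>

lemma superlevel_measure_decay:
  assumes pq: "1 \<le> p" "p < q" and PI: "weak_poincare q p C l" and dbl: "doubling Cd" "2 \<le> Cd" and n: "4 * l + 2 \<le> 2 ^ n"
    and \<Omega>: "openin mtopology \<Omega>" "y \<in> \<Omega>" and R: "0 < R" "R \<le> half_dist \<Omega> y" "mball y R \<subseteq> \<Omega>"
    and ab: "0 < \<alpha>" "\<And>x. x \<in> X \<Longrightarrow> \<alpha> \<le> a x \<and> a x \<le> \<beta> \<and> \<alpha> \<le> b x \<and> b x \<le> \<beta>"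
    and dg: "de_giorgi p q a b \<Omega> C\<^sub>D\<^sub>G u" "0 < C\<^sub>D\<^sub>G"
    and r: "0 < r'" "r' < r" "r \<le> R" and s: "0 < s"
    and Y: "phase_integral p q u y R k r \<le> ennreal Y" "0 \<le> Y"
  shows "ennreal (double_phase_real p q s) * emeasure \<mu> {x \<in> mball y r'. ereal (k + 2 * R * s) \<le> u x}
    \<le> ennreal (3 * Cd ^ n * (256 * Cd * max 1 C) powr q * 2 powr q * (3 * R / (r - r')) powr q * (C\<^sub>D\<^sub>G * \<beta> / \<alpha> + 1) * Y
        * (Y / (double_phase_real p q s * measure \<mu> (mball y R))) powr (ln 2 / ln Cd))"
proof -
  \<comment> \<open>One third of the gap between the radii is for the cutoff, one for the De Giorgi
    inequality, and one to stay strictly inside \<open>r\<close>.\<close>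
  define e where "e = (r - r') / 3"
  define T where "T = 3 * R / (r - r')"
  define \<rho> where "\<rho> = r' + e"
  define \<theta> where "\<theta> = ln 2 / ln Cd"
  define P where "P = {x \<in> mball y \<rho>. ereal (k + R * s) < u x}"
  define A where "A = {x \<in> mball y r'. ereal (k + 2 * R * s) \<le> u x}"
  define x where "x = measure \<mu> P / measure \<mu> (mball y R)"
  define c where "c = 3 * Cd ^ n * (256 * Cd * max 1 C) powr q"
  define \<phi> where "\<phi> = double_phase_real p q s"
  have e: "0 < e" "r' < \<rho>" "\<rho> + e < r" "0 < \<rho>" "\<rho> < R" "e \<le> R" using r by (auto simp: e_def \<rho>_def field_simps)
  have T: "T = R / e" "1 \<le> T" using r e by (auto simp: T_def e_def)
  have yX: "y \<in> X" using \<Omega> open_subset by blast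
  have u: "u \<in> borel_measurable (restrict_space \<mu> \<Omega>)" using dg(1) by (simp add: de_giorgi_def newtonian_loc_def)
  obtain g where g: "minimal_weak_ug q \<Omega> u g" using dg(1) by (auto simp: de_giorgi_def newtonian_loc_def)
  then have g': "weak_upper_gradient q \<Omega> u g" "q_integrable_bdd q \<Omega> g" by (auto simp: minimal_weak_ug_def)
  have sub: "mball y \<rho> \<subseteq> mball y R" "mball y \<rho> \<subseteq> \<Omega>"
    using R(3) e mball_subset_concentric[of \<rho> R y] by auto
  have Pm: "P \<in> sets \<mu>" unfolding P_def by (rule measurable_superlevel(1)[OF \<Omega>(1) u _ sub(2)]) simp
  have PB: "P \<subseteq> mball y R" using sub by (auto simp: P_def)
  have Pfm: "P \<in> fmeasurable \<mu>" by (rule fmeasurableI2[OF mball_in_fmeasurable[OF dbl(1) yX] PB Pm])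
  have mR: "0 < measure \<mu> (mball y R)" by (rule measure_mball_pos[OF dbl(1) yX R(1)])
  have x0: "0 \<le> x" "x \<le> 1" using mR measure_mball_mono[OF dbl(1) yX PB Pm] by (auto simp: x_def)
  have \<phi>: "0 < \<phi>" unfolding \<phi>_def by (rule double_phase_real_pos[OF s])
  have \<beta>: "0 < \<beta>" using ab(1) ab(2)[OF yX] by linarith
  have \<theta>: "0 \<le> \<theta>" using dbl by (simp add: \<theta>_def)
  have c0: "0 < c" using dbl by (auto simp: c_def max_def)
  have \<mu>P: "\<phi> * measure \<mu> P \<le> Y"
    unfolding \<phi>_def
    by (rule level_measure_le[OF _ _ R(1) _ s Y P_def Pm emeasure_eq_measure2[OF Pfm]]) (use pq e in auto)
  have x_le: "x \<le> Y / (\<phi> * measure \<mu> (mball y R))"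
    using \<mu>P \<phi> mR by (simp add: x_def field_simps)
  let ?J = "\<lambda>\<kappa>. \<integral>\<^sup>+w\<in>P. epowr (g w) \<kappa> \<partial>\<mu>"
  have g_meas: "g \<in> borel_measurable (borel_on \<Omega>)" using g' by (simp add: weak_upper_gradient_def)
  have gm: "(\<lambda>w. epowr (g w) \<kappa> * indicator P w) \<in> borel_measurable \<mu>" for \<kappa>
  proof -
    have "(\<lambda>w. epowr (g w) \<kappa> * indicator \<Omega> w * indicator P w) \<in> borel_measurable \<mu>"
      using measurable_epowr_indicator[OF \<Omega>(1) g_meas, of \<kappa>] Pm by measurable
    also have "(\<lambda>w. epowr (g w) \<kappa> * indicator \<Omega> w * indicator P w) = (\<lambda>w. epowr (g w) \<kappa> * indicator P w)"
      using sub(2) by (auto simp: indicator_def fun_eq_iff P_def)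
    finally show ?thesis .
  qed
  \<comment> \<open>The factor \<open>s powr \<kappa>\<close> cancels the height difference in
    \<open>level_decay\<close>. Both exponents get the same constant, because
    \<open>x \<le> 1\<close> gives
    \<open>x powr (\<theta> * \<kappa>) \<le> x powr \<theta>\<close>.\<close>
  have main: "ennreal (s powr \<kappa>) * emeasure \<mu> A \<le> ennreal (c * x powr \<theta> * 2 powr q) * (?J \<kappa> + ennreal (T powr q * s powr \<kappa> * measure \<mu> P))"
    if \<kappa>: "p \<le> \<kappa>" "\<kappa> \<le> q" for \<kappa>
  proof -
    have \<kappa>1: "1 \<le> \<kappa>" using \<kappa> pq by simp
    define L where "L = T * s"
    have L: "0 < L" unfolding L_def using T(2) s by (intro mult_pos_pos) linarith+
    have L_eq: "(k + 2 * R * s - (k + R * s)) / (\<rho> - r') = L"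
      using e by (simp add: L_def T \<rho>_def field_simps)
    let ?I = "\<integral>\<^sup>+w\<in>P. epowr (g w + ennreal L) \<kappa> \<partial>\<mu>"
    have "emeasure \<mu> A \<le> ennreal (3 * Cd ^ n * (256 * Cd * max 1 C) powr \<kappa> * (R / (k + 2 * R * s - (k + R * s)) * (measure \<mu> P / measure \<mu> (mball y R)) powr (ln 2 / ln Cd)) powr \<kappa>) * ?I"
      unfolding A_def L_eq[symmetric]
      by (rule level_decay[OF pq(1) \<kappa>(1) _ PI dbl n \<Omega>(1) yX R(3) r(1) e(2,5) _ u g' P_def]) (use pq R s in auto)
    also have "R / (k + 2 * R * s - (k + R * s)) = 1 / s" using R s by simp
    also have "(1 / s * (measure \<mu> P / measure \<mu> (mball y R)) powr (ln 2 / ln Cd)) powr \<kappa> = x powr (\<theta> * \<kappa>) / s powr \<kappa>"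
      unfolding x_def[symmetric] \<theta>_def[symmetric] using s by (simp add: powr_divide powr_powr)
    finally have "ennreal (s powr \<kappa>) * emeasure \<mu> A \<le> ennreal (s powr \<kappa>) * (ennreal (3 * Cd ^ n * (256 * Cd * max 1 C) powr \<kappa> * (x powr (\<theta> * \<kappa>) / s powr \<kappa>)) * ?I)"
      by (rule mult_left_mono) simp
    also have "\<dots> = ennreal (3 * Cd ^ n * (256 * Cd * max 1 C) powr \<kappa> * x powr (\<theta> * \<kappa>)) * ?I"
      using s dbl by (simp add: mult.assoc[symmetric] ennreal_mult[symmetric])
    also have "\<dots> \<le> ennreal (c * x powr \<theta>) * ?I"
    proof (intro mult_right_mono ennreal_leI mult_mono)
      have "1 \<le> 256 * Cd * max 1 C" using mult_mono[of 1 "256 * Cd" 1 "max 1 C"] dbl by simp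
      then have "(256 * Cd * max 1 C) powr \<kappa> \<le> (256 * Cd * max 1 C) powr q" using \<kappa> by (intro powr_mono) auto
      then show "3 * Cd ^ n * (256 * Cd * max 1 C) powr \<kappa> \<le> c" unfolding c_def by (rule mult_left_mono) (use dbl in simp)
      show "x powr (\<theta> * \<kappa>) \<le> x powr \<theta>" using mult_left_mono[OF \<kappa>1 \<theta>] x0 by (intro powr_mono') auto
    qed (use c0 in auto)
    also have "?I \<le> (\<integral>\<^sup>+w. ennreal (2 powr q) * (epowr (g w) \<kappa> * indicator P w + ennreal (L powr \<kappa>) * indicator P w) \<partial>\<mu>)"
    proof (rule nn_integral_mono)
      fix w
      have "epowr (g w + ennreal L) \<kappa> \<le> ennreal (2 powr \<kappa>) * (epowr (g w) \<kappa> + epowr (ennreal L) \<kappa>)"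
        by (rule epowr_add_le) (use \<kappa>1 in simp)
      also have "\<dots> \<le> ennreal (2 powr q) * (epowr (g w) \<kappa> + epowr (ennreal L) \<kappa>)"
        by (intro mult_right_mono ennreal_leI powr_mono) (use \<kappa> in auto)
      finally show "epowr (g w + ennreal L) \<kappa> * indicator P w \<le> ennreal (2 powr q) * (epowr (g w) \<kappa> * indicator P w + ennreal (L powr \<kappa>) * indicator P w)"
        using L by (auto simp: indicator_def)
    qed
    also have "\<dots> = ennreal (2 powr q) * (?J \<kappa> + ennreal (L powr \<kappa>) * emeasure \<mu> P)"
      using gm[of \<kappa>] Pm by (simp add: nn_integral_cmult nn_integral_add nn_integral_cmult_indicator)
    also have "ennreal (L powr \<kappa>) * emeasure \<mu> P \<le> ennreal (T powr q * s powr \<kappa> * measure \<mu> P)"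
    proof -
      have "L powr \<kappa> = T powr \<kappa> * s powr \<kappa>" unfolding L_def using T s by (intro powr_mult)
      also have "\<dots> \<le> T powr q * s powr \<kappa>" by (intro mult_right_mono powr_mono) (use T \<kappa> in auto)
      finally have "L powr \<kappa> * measure \<mu> P \<le> T powr q * s powr \<kappa> * measure \<mu> P" by (rule mult_right_mono) simp
      then show ?thesis by (simp add: emeasure_eq_measure2[OF Pfm] ennreal_mult[symmetric] ennreal_leI)
    qed
    finally show ?thesis
      using c0 by (simp add: mult_left_mono add_left_mono mult.assoc[symmetric] ennreal_mult[symmetric])
  qed
  have "ennreal \<phi> * emeasure \<mu> A = ennreal (s powr p) * emeasure \<mu> A + ennreal (s powr q) * emeasure \<mu> A"
    by (simp add: \<phi>_def double_phase_real_def distrib_right)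
  also have "\<dots> \<le> ennreal (c * x powr \<theta> * 2 powr q) * (?J p + ennreal (T powr q * s powr p * measure \<mu> P))
     + ennreal (c * x powr \<theta> * 2 powr q) * (?J q + ennreal (T powr q * s powr q * measure \<mu> P))"
    using pq by (intro add_mono main) auto
  also have "\<dots> = ennreal (c * x powr \<theta> * 2 powr q) * ((?J p + ?J q) + (ennreal (T powr q * s powr p * measure \<mu> P) + ennreal (T powr q * s powr q * measure \<mu> P)))"
    by (simp only: distrib_left ac_simps)
  also have "\<dots> \<le> ennreal (c * x powr \<theta> * 2 powr q) * (ennreal (C\<^sub>D\<^sub>G * \<beta> / \<alpha> * T powr q * Y) + ennreal (T powr q * Y))"
  proof (intro mult_left_mono add_mono)
    have "?J p + ?J q = (\<integral>\<^sup>+w\<in>P. epowr (g w) p + epowr (g w) q \<partial>\<mu>)"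
      unfolding distrib_right by (rule nn_integral_add[symmetric, OF gm gm])
    also have "\<dots> \<le> ennreal (C\<^sub>D\<^sub>G * \<beta> / \<alpha> * (R / e) powr q * Y)"
      unfolding P_def
      by (rule gradient_level_bound[OF pq \<Omega> R ab dg g e(1,4,3) r(3) _ Y]) (use R s in auto)
    finally show "?J p + ?J q \<le> ennreal (C\<^sub>D\<^sub>G * \<beta> / \<alpha> * T powr q * Y)" by (simp add: T)
    have "ennreal (T powr q * s powr p * measure \<mu> P) + ennreal (T powr q * s powr q * measure \<mu> P) = ennreal (T powr q * (\<phi> * measure \<mu> P))"
      by (simp add: ennreal_plus[symmetric] \<phi>_def double_phase_real_def algebra_simps del: ennreal_plus)
    also have "\<dots> \<le> ennreal (T powr q * Y)" by (intro ennreal_leI mult_left_mono \<mu>P) simp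
    finally show "ennreal (T powr q * s powr p * measure \<mu> P) + ennreal (T powr q * s powr q * measure \<mu> P) \<le> ennreal (T powr q * Y)" .
  qed auto
  also have "\<dots> = ennreal (c * x powr \<theta> * 2 powr q * (T powr q * (C\<^sub>D\<^sub>G * \<beta> / \<alpha> + 1) * Y))"
    using c0 ab(1) \<beta> dg(2) Y(2)
    by (simp add: ennreal_plus[symmetric] ennreal_mult[symmetric] algebra_simps del: ennreal_plus)
  also have "\<dots> \<le> ennreal (c * (Y / (\<phi> * measure \<mu> (mball y R))) powr \<theta> * 2 powr q * (T powr q * (C\<^sub>D\<^sub>G * \<beta> / \<alpha> + 1) * Y))"
    using c0 ab(1) \<beta> dg(2) Y(2) x0 x_le \<theta>
    by (intro ennreal_leI mult_right_mono mult_left_mono powr_mono2) auto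
  finally show ?thesis unfolding A_def \<phi>_def c_def T_def \<theta>_def by (simp only: mult_ac)
qed

end

lemma suminf_geometric_ennreal:
  assumes "0 \<le> c" "0 \<le> x" "x < (1::real)"
  shows "(\<Sum>m. ennreal (c * x ^ m)) = ennreal (c / (1 - x))"
proof -
  have sm: "summable (\<lambda>m. c * x ^ m)" using assms by (intro summable_mult summable_geometric) simp
  have "(\<Sum>m. c * x ^ m) = c * (1 / (1 - x))"
    using assms by (subst suminf_mult[OF summable_geometric]) (auto simp: suminf_geometric)
  then show ?thesis using assms sm by (subst suminf_ennreal2) auto
qed

lemma step_constant_pos:
  fixes Cd :: real
  assumes "2 \<le> Cd" "0 < C\<^sub>D\<^sub>G" "0 < \<alpha>" "0 < \<beta>" "0 < \<theta>"
  shows "0 < 4 powr q * (3 * Cd ^ n * (256 * Cd * max 1 C) powr q * 2 powr q * (C\<^sub>D\<^sub>G * \<beta> / \<alpha> + 1)) / (1 - 2 powr - \<theta>)"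
proof -
  have "2 powr - \<theta> < 2 powr (0::real)" using assms by (intro powr_less_mono) auto
  then show ?thesis using assms by (intro divide_pos_pos mult_pos_pos add_pos_pos) (auto simp: max_def)
qed

section \<open>The recursion and its limit\<close>

context borel_regular_space
begin

text \<open>The decay estimate is summed over the dyadic heights \<open>2 ^ m * s\<close>. As
  \<open>p \<ge> 1\<close>, the value of \<Phi> at least doubles from one height to the next, so
  that each layer gains a factor \<open>2 powr - \<theta>\<close>. The geometric series yields the
  denominator of \<open>c\<close>, and \<open>4 powr q\<close> comes from the layers.\<close>

lemma phase_integral_step:
  assumes pq: "1 \<le> p" "p < q" and PI: "weak_poincare q p C l" and dbl: "doubling Cd" "2 \<le> Cd" and n: "4 * l + 2 \<le> 2 ^ n"
    and \<Omega>: "openin mtopology \<Omega>" "y \<in> \<Omega>" and R: "0 < R" "R \<le> half_dist \<Omega> y" "mball y R \<subseteq> \<Omega>"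
    and ab: "0 < \<alpha>" "\<And>x. x \<in> X \<Longrightarrow> \<alpha> \<le> a x \<and> a x \<le> \<beta> \<and> \<alpha> \<le> b x \<and> b x \<le> \<beta>"
    and dg: "de_giorgi p q a b \<Omega> C\<^sub>D\<^sub>G u" "0 < C\<^sub>D\<^sub>G"
    and r: "0 < r'" "r' < r" "r \<le> R" and s: "0 < s"
    and Y: "phase_integral p q u y R k r \<le> ennreal Y" "0 \<le> Y"
    and \<theta>_def: "\<theta> = ln 2 / ln Cd"
    and c_def: "c = 4 powr q * (3 * Cd ^ n * (256 * Cd * max 1 C) powr q * 2 powr q * (C\<^sub>D\<^sub>G * \<beta> / \<alpha> + 1)) / (1 - 2 powr - \<theta>)"
  shows "phase_integral p q u y R (k + 2 * R * s) r' \<le>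
    ennreal (c * (3 * R / (r - r')) powr q * Y * (Y / (double_phase_real p q s * measure \<mu> (mball y R))) powr \<theta>)"
proof -
  define A where "A m = {x \<in> mball y r'. ereal (k + 2 * R * (2 ^ m * s)) \<le> u x}" for m :: nat
  define c' where "c' = 3 * Cd ^ n * (256 * Cd * max 1 C) powr q * 2 powr q * (3 * R / (r - r')) powr q * (C\<^sub>D\<^sub>G * \<beta> / \<alpha> + 1) * Y"
  define \<phi> where "\<phi> = double_phase_real p q"
  define Z where "Z = Y / (\<phi> s * measure \<mu> (mball y R))"
  have yX: "y \<in> X" using \<Omega> open_subset by blast
  have u: "u \<in> borel_measurable (restrict_space \<mu> \<Omega>)" using dg(1) by (simp add: de_giorgi_def newtonian_loc_def)
  have sub: "mball y r' \<subseteq> \<Omega>" "mball y r' \<subseteq> mball y r" "mball y r \<subseteq> \<Omega>"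
    using R(3) r mball_subset_concentric[of r' R y] mball_subset_concentric[of r' r y] mball_subset_concentric[of r R y] by auto
  have Am: "A m \<in> sets \<mu>" for m unfolding A_def by (rule measurable_superlevel(2)[OF \<Omega>(1) u _ sub(1)]) simp
  have mR: "0 < measure \<mu> (mball y R)" by (rule measure_mball_pos[OF dbl(1) yX R(1)])
  have \<phi>: "0 < \<phi> s" unfolding \<phi>_def by (rule double_phase_real_pos[OF s])
  have \<theta>: "0 < \<theta>" using dbl by (simp add: \<theta>_def)
  have \<beta>: "0 < \<beta>" using ab(1) ab(2)[OF yX] by linarith
  have Z: "0 \<le> Z" using Y(2) \<phi> mR by (simp add: Z_def)
  have c': "0 \<le> c'" using dbl dg(2) ab(1) \<beta> Y(2) by (simp add: c'_def)
  have dm: "(\<lambda>x. double_phase p q (excess u R k x) * indicator (mball y r) x) \<in> borel_measurable \<mu>"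
    unfolding double_phase_def distrib_right
    by (intro borel_measurable_add measurable_excess[OF \<Omega>(1) u _ sub(3)] mball_measurable)
  \<comment> \<open>Finiteness of the integral excludes \<open>u x = \<infinity>\<close> outside a
    null set, as the decomposition into layers demands.\<close>
  have "AE x in \<mu>. double_phase p q (excess u R k x) * indicator (mball y r) x \<noteq> \<infinity>"
  proof (rule nn_integral_noteq_infinite[OF dm])
    have "phase_integral p q u y R k r < \<infinity>" using Y(1) by (rule le_less_trans) simp
    then show "(\<integral>\<^sup>+x\<in>mball y r. double_phase p q (excess u R k x) \<partial>\<mu>) \<noteq> \<infinity>" by (simp add: phase_integral_def less_top)
  qed
  then have AE: "AE x in \<mu>. x \<in> mball y r \<longrightarrow> u x \<noteq> \<infinity>"
  proof eventually_elim
    case (elim x)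
    show ?case
    proof (intro impI notI)
      assume "x \<in> mball y r" "u x = \<infinity>"
      then show False using elim R(1) by (simp add: double_phase_def excess_def ennreal_mult_top)
    qed
  qed
  have "phase_integral p q u y R (k + 2 * R * s) r' \<le> (\<integral>\<^sup>+x. (\<Sum>m. ennreal (4 powr q * \<phi> (2 ^ m * s)) * indicator (A m) x) \<partial>\<mu>)"
    unfolding phase_integral_def
  proof (rule nn_integral_mono_AE)
    show "AE x in \<mu>. double_phase p q (excess u R (k + 2 * R * s) x) * indicator (mball y r') x
      \<le> (\<Sum>m. ennreal (4 powr q * \<phi> (2 ^ m * s)) * indicator (A m) x)"
      using AE
    proof eventually_elim
      case (elim x)
      show ?case
      proof (cases "x \<in> mball y r'")
        case True
        then have "u x \<noteq> \<infinity>" using elim sub(2) by blast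
        have ind: "indicator {x. ereal (k + 2 * R * (2 ^ m * s)) \<le> u x} x = (indicator (A m) x :: ennreal)" for m
          using True by (simp only: A_def indicator_def mem_Collect_eq simp_thms)
        have "double_phase p q (excess u R (k + 2 * R * s) x) \<le>
          (\<Sum>m. ennreal (4 powr q * \<phi> (2 ^ m * s)) * indicator {x. ereal (k + 2 * R * (2 ^ m * s)) \<le> u x} x)"
          unfolding \<phi>_def using pq \<open>u x \<noteq> \<infinity>\<close> by (intro double_phase_layers[OF _ _ R(1) s]) auto
        then show ?thesis unfolding ind using True by simp
      qed simp
    qed
  qed
  also have "\<dots> = (\<Sum>m. \<integral>\<^sup>+x. ennreal (4 powr q * \<phi> (2 ^ m * s)) * indicator (A m) x \<partial>\<mu>)"
    by (rule nn_integral_suminf) (use Am in measurable)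
  also have "\<dots> \<le> (\<Sum>m. ennreal ((4 powr q * c' * Z powr \<theta>) * (2 powr - \<theta>) ^ m))"
  proof (rule suminf_le)
    fix m
    have sm: "0 < 2 ^ m * s" using s by simp
    have "(\<integral>\<^sup>+x. ennreal (4 powr q * \<phi> (2 ^ m * s)) * indicator (A m) x \<partial>\<mu>) = ennreal (4 powr q) * (ennreal (\<phi> (2 ^ m * s)) * emeasure \<mu> (A m))"
      using Am by (simp add: nn_integral_cmult_indicator) (simp add: ennreal_mult' mult.assoc)
    also have "\<dots> \<le> ennreal (4 powr q) * ennreal (c' * (Y / (\<phi> (2 ^ m * s) * measure \<mu> (mball y R))) powr \<theta>)"
      unfolding A_def c'_def \<phi>_def \<theta>_def
      by (intro mult_left_mono superlevel_measure_decay[OF pq PI dbl n \<Omega> R ab dg r sm Y]) simp_all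
    also have "\<dots> \<le> ennreal (4 powr q) * ennreal (c' * (Z powr \<theta> * (2 powr - \<theta>) ^ m))"
    proof (intro mult_left_mono ennreal_leI)
      have "(2::real) ^ m * \<phi> s \<le> (2 ^ m) powr p * \<phi> s"
      proof (rule mult_right_mono)
        have "((2::real) ^ m) powr 1 \<le> (2 ^ m) powr p" using pq by (intro powr_mono) auto
        then show "(2::real) ^ m \<le> (2 ^ m) powr p" by simp
      qed (use \<phi> in simp)
      also have "\<dots> \<le> \<phi> (2 ^ m * s)" unfolding \<phi>_def using s pq by (intro double_phase_real_scale) auto
      finally have ge: "2 ^ m * \<phi> s \<le> \<phi> (2 ^ m * s)" .
      have "Y / (\<phi> (2 ^ m * s) * measure \<mu> (mball y R)) \<le> Y / (2 ^ m * \<phi> s * measure \<mu> (mball y R))"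
        by (intro divide_left_mono mult_right_mono ge) (use Y(2) mR \<phi> less_le_trans[OF _ ge] in auto)
      also have "\<dots> = Z / 2 ^ m" by (simp add: Z_def)
      finally have "(Y / (\<phi> (2 ^ m * s) * measure \<mu> (mball y R))) powr \<theta> \<le> (Z / 2 ^ m) powr \<theta>"
      proof (rule powr_mono2[rotated 2])
        have "0 < \<phi> (2 ^ m * s)" unfolding \<phi>_def by (rule double_phase_real_pos[OF sm])
        then show "0 \<le> Y / (\<phi> (2 ^ m * s) * measure \<mu> (mball y R))" using Y(2) mR by simp
      qed (use \<theta> in simp)
      also have "\<dots> = Z powr \<theta> * (2 powr - \<theta>) ^ m"
        using Z by (simp add: powr_divide powr_realpow[symmetric] powr_powr powr_minus field_simps)
      finally show "(Y / (\<phi> (2 ^ m * s) * measure \<mu> (mball y R))) powr \<theta> \<le> Z powr \<theta> * (2 powr - \<theta>) ^ m" .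
    qed (use c' in auto)
    also have "\<dots> = ennreal ((4 powr q * c' * Z powr \<theta>) * (2 powr - \<theta>) ^ m)"
      using c' by (simp add: ennreal_mult[symmetric] mult.assoc)
    finally show "(\<integral>\<^sup>+x. ennreal (4 powr q * \<phi> (2 ^ m * s)) * indicator (A m) x \<partial>\<mu>) \<le> ennreal ((4 powr q * c' * Z powr \<theta>) * (2 powr - \<theta>) ^ m)" .
  qed auto
  also have "\<dots> = ennreal ((4 powr q * c' * Z powr \<theta>) / (1 - 2 powr - \<theta>))"
  proof (rule suminf_geometric_ennreal)
    have "2 powr - \<theta> < 2 powr (0::real)" using \<theta> by (intro powr_less_mono) auto
    then show "2 powr - \<theta> < 1" by simp
  qed (use c' in auto)
  also have "(4 powr q * c' * Z powr \<theta>) / (1 - 2 powr - \<theta>) = c * (3 * R / (r - r')) powr q * Y * Z powr \<theta>"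
    by (simp add: c_def c'_def)
  finally show ?thesis unfolding Z_def \<phi>_def .
qed

lemma phase_integral_mono:
  assumes "0 \<le> p" "0 \<le> q" "k \<le> k'" "r' \<le> r"
  shows "phase_integral p q u y R k' r' \<le> phase_integral p q u y R k r"
  unfolding phase_integral_def
proof (rule nn_integral_mono)
  fix x
  have "mball y r' \<subseteq> mball y r" by (rule mball_subset_concentric[OF assms(4)])
  then show "double_phase p q (excess u R k' x) * indicator (mball y r') x \<le> double_phase p q (excess u R k x) * indicator (mball y r) x"
    using double_phase_mono[OF assms(1,2) excess_antimono[OF assms(3)], of u R x] by (auto simp: indicator_def)
qed

text \<open>Fast geometric convergence: in units of \<open>m\<close> the recursion reads
  \<open>Y (j + 1) \<le> A * b ^ j * Y j powr (1 + \<theta>)\<close>. It preserves the bound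
  \<open>Y j \<le> \<eta> * x ^ j\<close> if \<open>x powr \<theta> = 1 / b\<close> and
  \<open>A * \<eta> powr \<theta> = x\<close>; these equations determine \<open>x\<close> and the
  threshold \<eta>.\<close>

lemma AE_le_of_phase_integral:
  assumes pq: "1 \<le> p" "p < q" and PI: "weak_poincare q p C l" and dbl: "doubling Cd" "2 \<le> Cd" and n: "4 * l + 2 \<le> 2 ^ n"
    and \<Omega>: "openin mtopology \<Omega>" "y \<in> \<Omega>" and R: "0 < R" "R \<le> half_dist \<Omega> y" "mball y R \<subseteq> \<Omega>"
    and ab: "0 < \<alpha>" "\<And>x. x \<in> X \<Longrightarrow> \<alpha> \<le> a x \<and> a x \<le> \<beta> \<and> \<alpha> \<le> b x \<and> b x \<le> \<beta>"
    and dg: "de_giorgi p q a b \<Omega> C\<^sub>D\<^sub>G u" "0 < C\<^sub>D\<^sub>G"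
    and \<theta>_def: "\<theta> = ln 2 / ln Cd"
    and c_def: "c = 4 powr q * (3 * Cd ^ n * (256 * Cd * max 1 C) powr q * 2 powr q * (C\<^sub>D\<^sub>G * \<beta> / \<alpha> + 1)) / (1 - 2 powr - \<theta>)"
    and \<eta>_def: "\<eta> = (c * 12 powr q * (4 powr q) powr \<theta> * (2 powr (q + q * \<theta>)) powr (1 / \<theta>)) powr (- 1 / \<theta>)"
    and \<delta>: "0 < \<delta>" and Y: "phase_integral p q u y R k R \<le> ennreal (double_phase_real p q (\<delta> / R) * measure \<mu> (mball y R) * \<eta>)"
  shows "AE x in \<mu>. x \<in> mball y (R / 2) \<longrightarrow> u x \<le> ereal (k + \<delta>)"
proof -
  define D where "D = \<delta> / R"
  define m where "m = double_phase_real p q D * measure \<mu> (mball y R)"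
  define A where "A = c * 12 powr q * (4 powr q) powr \<theta>"
  define b where "b = 2 powr (q + q * \<theta>)"
  define x where "x = b powr (- 1 / \<theta>)"
  have yX: "y \<in> X" using \<Omega> open_subset by blast
  have D: "0 < D" using \<delta> R by (simp add: D_def)
  have mR: "0 < measure \<mu> (mball y R)" by (rule measure_mball_pos[OF dbl(1) yX R(1)])
  have m: "0 < m" unfolding m_def using double_phase_real_pos[OF D] mR by simp
  have \<theta>: "0 < \<theta>" using dbl by (simp add: \<theta>_def)
  have \<beta>: "0 < \<beta>" using ab(1) ab(2)[OF yX] by linarith
  have c: "0 < c" unfolding c_def by (rule step_constant_pos[OF dbl(2) dg(2) ab(1) \<beta> \<theta>])
  have A: "0 < A" using c by (simp add: A_def)
  have b: "1 < b" unfolding b_def using pq \<theta> by (intro gr_one_powr) (auto intro: add_pos_pos)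
  have \<eta>: "0 < \<eta>" unfolding \<eta>_def using c by simp
  have inv: "(B powr (- 1 / \<theta>)) powr \<theta> = 1 / B" if "0 < B" for B :: real
    unfolding powr_powr using \<theta> that by (simp add: powr_minus_divide)
  have \<eta>\<theta>: "\<eta> powr \<theta> = 1 / (A * b powr (1 / \<theta>))"
    unfolding \<eta>_def A_def[symmetric] b_def[symmetric] by (rule inv) (use A b in simp)
  have x: "0 < x" "x < 1"
  proof -
    show "0 < x" using b by (simp add: x_def)
    have "b powr (- 1 / \<theta>) < b powr 0" using b \<theta> by (intro powr_less_mono) (auto simp: divide_neg_pos)
    then show "x < 1" using b by (simp add: x_def)
  qed
  have x\<theta>: "x powr \<theta> = 1 / b" "b powr (1 / \<theta>) = 1 / x"
    using inv[of b] b by (auto simp: x_def powr_minus_divide)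
  have rec: "A * b ^ j * (\<eta> * x ^ j) powr \<theta> = x" for j
  proof -
    have "(x ^ j) powr \<theta> = (x powr \<theta>) ^ j" using x by (simp add: powr_realpow[symmetric] powr_powr mult.commute)
    then have "(\<eta> * x ^ j) powr \<theta> = \<eta> powr \<theta> * (1 / b) ^ j" using \<eta> x by (simp add: powr_mult x\<theta>)
    then show ?thesis unfolding \<eta>\<theta> x\<theta>(2) using A b x by (simp add: power_divide)
  qed
  \<comment> \<open>The heights rise from \<open>k\<close> towards \<open>k + \<delta>\<close> and
    the radii fall from \<open>R\<close> towards \<open>R / 2\<close>, both in geometric
    steps.\<close>
  define K where "K j = k + \<delta> * (1 - 1 / 2 ^ j)" for j :: nat
  define r' where "r' j = R / 2 + R / 2 ^ Suc j" for j :: nat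
  have bound: "phase_integral p q u y R (K j) (r' j) \<le> ennreal (m * (\<eta> * x ^ j))" for j
  proof (induction j)
    case 0
    show ?case using Y by (simp add: K_def r'_def m_def D_def mult.assoc)
  next
    case (Suc j)
    \<comment> \<open>The height step \<open>\<delta> / 2 ^ (j + 1)\<close> equals
      \<open>2 * R * s\<close>, and the radius step is \<open>R / 2 ^ (j + 2)\<close>. The numbers
      12 and 4 in \<eta> come from here: \<open>3 * R\<close> over the radius step is
      \<open>12 * 2 ^ j\<close>, and \<open>D / s\<close> is \<open>4 * 2 ^ j\<close>.\<close>
    define s where "s = D * (1 / 2 ^ (j + 2))"
    have s: "0 < s" using D by (simp add: s_def)
    have K: "K (Suc j) = K j + 2 * R * s" using R(1) by (simp add: K_def s_def D_def field_simps)
    have rr: "r' j - r' (Suc j) = R / 2 ^ (j + 2)" by (simp add: r'_def field_simps)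
    have r: "0 < r' (Suc j)" "r' (Suc j) < r' j" "r' j \<le> R"
      using R(1) rr by (auto simp: r'_def field_simps add_pos_pos)
    have T: "3 * R / (r' j - r' (Suc j)) = 12 * 2 ^ j" unfolding rr using R(1) by simp
    let ?Y = "m * (\<eta> * x ^ j)"
    have Y0: "0 < ?Y" using m \<eta> x by simp
    have "phase_integral p q u y R (K (Suc j)) (r' (Suc j)) \<le>
      ennreal (c * (12 * 2 ^ j) powr q * ?Y * (?Y / (double_phase_real p q s * measure \<mu> (mball y R))) powr \<theta>)"
      unfolding K T[symmetric]
      by (rule phase_integral_step[OF pq PI dbl n \<Omega> R ab dg r s Suc less_imp_le[OF Y0] \<theta>_def c_def])
    also have "\<dots> \<le> ennreal (c * (12 * 2 ^ j) powr q * ?Y * ((4 * 2 ^ j) powr q * (\<eta> * x ^ j)) powr \<theta>)"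
    proof (intro ennreal_leI mult_left_mono powr_mono2)
      have "(1 / (4 * 2 ^ j)) powr q * double_phase_real p q D \<le> double_phase_real p q (1 / (4 * 2 ^ j) * D)"
        by (rule double_phase_real_scale) (use D pq in \<open>auto simp: field_simps intro: order_trans[OF one_le_power[of 2 j]]\<close>)
      also have "1 / (4 * 2 ^ j) * D = s" by (simp add: s_def)
      finally have "(1 / (4 * 2 ^ j)) powr q * double_phase_real p q D \<le> double_phase_real p q s" .
      then have "(1 / (4 * 2 ^ j)) powr q * m \<le> double_phase_real p q s * measure \<mu> (mball y R)"
        unfolding m_def mult.assoc[symmetric] by (rule mult_right_mono) simp
      then have "?Y / (double_phase_real p q s * measure \<mu> (mball y R)) \<le> ?Y / ((1 / (4 * 2 ^ j)) powr q * m)"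
        by (intro divide_left_mono) (use Y0 m mR double_phase_real_pos[OF s] in auto)
      also have "\<dots> = (4 * 2 ^ j) powr q * (\<eta> * x ^ j)" using m by (simp add: powr_divide)
      finally show "?Y / (double_phase_real p q s * measure \<mu> (mball y R)) \<le> (4 * 2 ^ j) powr q * (\<eta> * x ^ j)" .
    qed (use c Y0 mR double_phase_real_pos[OF s, of p q] \<theta> in \<open>auto intro!: divide_nonneg_pos mult_pos_pos mult_nonneg_nonneg less_imp_le\<close>)
    also have "c * (12 * 2 ^ j) powr q * ?Y * ((4 * 2 ^ j) powr q * (\<eta> * x ^ j)) powr \<theta>
      = ?Y * (A * b ^ j * (\<eta> * x ^ j) powr \<theta>)"
    proof -
      have "(2 ^ j) powr q * ((2 ^ j) powr q) powr \<theta> = b ^ j"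
        unfolding b_def by (simp add: powr_realpow[symmetric] powr_powr powr_add[symmetric] algebra_simps)
      moreover have "(12 * 2 ^ j) powr q = 12 powr q * (2 ^ j) powr q" "(4 * 2 ^ j) powr q = 4 powr q * (2 ^ j) powr q"
        by (simp_all add: powr_mult)
      moreover have "((4 * 2 ^ j) powr q * (\<eta> * x ^ j)) powr \<theta> = ((4 * 2 ^ j) powr q) powr \<theta> * (\<eta> * x ^ j) powr \<theta>"
        using \<eta> x by (intro powr_mult)
      moreover have "(4 powr q * (2 ^ j) powr q) powr \<theta> = (4 powr q) powr \<theta> * ((2 ^ j) powr q) powr \<theta>"
        by (intro powr_mult)
      ultimately show ?thesis unfolding A_def by (simp only: mult_ac)
    qed
    also have "\<dots> = m * (\<eta> * x ^ Suc j)" unfolding rec by simp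
    finally show ?case .
  qed
  have "phase_integral p q u y R (k + \<delta>) (R / 2) \<le> ennreal (m * (\<eta> * x ^ j))" for j
  proof (rule order_trans[OF phase_integral_mono bound[of j]])
    show "K j \<le> k + \<delta>" using \<delta> by (simp add: K_def algebra_simps)
    show "R / 2 \<le> r' j" using R(1) by (simp add: r'_def)
  qed (use pq in auto)
  moreover have "(\<lambda>j. ennreal (m * (\<eta> * x ^ j))) \<longlonglongrightarrow> ennreal (m * (\<eta> * 0))"
    by (intro tendsto_ennrealI tendsto_intros LIMSEQ_power_zero) (use x in simp)
  ultimately have "phase_integral p q u y R (k + \<delta>) (R / 2) \<le> ennreal (m * (\<eta> * 0))"
    by (intro LIMSEQ_le_const) auto
  then have 0: "phase_integral p q u y R (k + \<delta>) (R / 2) = 0" by simp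
  have u: "u \<in> borel_measurable (restrict_space \<mu> \<Omega>)" using dg(1) by (simp add: de_giorgi_def newtonian_loc_def)
  have sub: "mball y (R / 2) \<subseteq> \<Omega>" using R mball_subset_concentric[of "R / 2" R y] by auto
  have "(\<lambda>x. double_phase p q (excess u R (k + \<delta>) x) * indicator (mball y (R / 2)) x) \<in> borel_measurable \<mu>"
    unfolding double_phase_def distrib_right
    by (intro borel_measurable_add measurable_excess[OF \<Omega>(1) u _ sub] mball_measurable)
  then have "AE x in \<mu>. double_phase p q (excess u R (k + \<delta>) x) * indicator (mball y (R / 2)) x = 0"
    using 0 unfolding phase_integral_def by (simp add: nn_integral_0_iff_AE)
  then show ?thesis
  proof eventually_elim
    case (elim z)
    show ?case
    proof (intro impI leI notI)
      assume z: "z \<in> mball y (R / 2)" and gt: "ereal (k + \<delta>) < u z"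
      \<comment> \<open>\<open>u z\<close> may be infinite, hence a real \<open>w\<close> above
        \<open>k + \<delta>\<close>, at which \<Phi> of the excess is positive and finite.\<close>
      obtain w where w: "ereal (k + \<delta>) < ereal w" "ereal w \<le> u z" using ereal_dense2[OF gt] by (auto intro: less_imp_le)
      then have "ennreal ((w - (k + \<delta>)) / R) \<le> excess u R (k + \<delta>) z" using R(1) by (intro excess_ge) auto
      then have "double_phase p q (ennreal ((w - (k + \<delta>)) / R)) \<le> double_phase p q (excess u R (k + \<delta>) z)"
        using pq by (intro double_phase_mono) auto
      moreover have "0 < (w - (k + \<delta>)) / R" using w R(1) by simp
      ultimately show False
        using elim z double_phase_real_pos[of "(w - (k + \<delta>)) / R" p q] by (simp add: double_phase_ennreal)
    qed
  qed
qed

text \<open>By Hoelder's inequality the \<open>q\<close>-mean also controls the \<open>p\<close>-th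
  power, so that the integral of \<Phi> is at most \<open>2 * \<Phi> (M / R)\<close> times the
  measure of the ball. At the height \<open>\<Lambda> * M\<close> the value of \<Phi> is larger by
  the factor \<Lambda> at least, and \<open>\<Lambda> * \<eta> \<ge> 2\<close> absorbs the 2 and
  meets the threshold.\<close>

lemma AE_le_of_mean:
  assumes pq: "1 \<le> p" "p < q" and PI: "weak_poincare q p C l" and dbl: "doubling Cd" "2 \<le> Cd" and n: "4 * l + 2 \<le> 2 ^ n"
    and \<Omega>: "openin mtopology \<Omega>" "y \<in> \<Omega>" and R: "0 < R" "R \<le> half_dist \<Omega> y" "mball y R \<subseteq> \<Omega>"
    and ab: "0 < \<alpha>" "\<And>x. x \<in> X \<Longrightarrow> \<alpha> \<le> a x \<and> a x \<le> \<beta> \<and> \<alpha> \<le> b x \<and> b x \<le> \<beta>"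
    and dg: "de_giorgi p q a b \<Omega> C\<^sub>D\<^sub>G u" "0 < C\<^sub>D\<^sub>G"
    and \<theta>_def: "\<theta> = ln 2 / ln Cd"
    and c_def: "c = 4 powr q * (3 * Cd ^ n * (256 * Cd * max 1 C) powr q * 2 powr q * (C\<^sub>D\<^sub>G * \<beta> / \<alpha> + 1)) / (1 - 2 powr - \<theta>)"
    and \<eta>_def: "\<eta> = (c * 12 powr q * (4 powr q) powr \<theta> * (2 powr (q + q * \<theta>)) powr (1 / \<theta>)) powr (- 1 / \<theta>)"
    and \<Lambda>_def: "\<Lambda> = max 1 (2 / \<eta>)"
    and M: "0 \<le> M" "(\<integral>\<^sup>+x\<in>mball y R. epowr (e2ennreal (u x - ereal k)) q \<partial>\<mu>) = ennreal (M powr q * measure \<mu> (mball y R))"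
  shows "AE x in \<mu>. x \<in> mball y (R / 2) \<longrightarrow> u x \<le> ereal (k + \<Lambda> * M)"
proof -
  have yX: "y \<in> X" using \<Omega> open_subset by blast
  have \<beta>: "0 < \<beta>" using ab(1) ab(2)[OF yX] by linarith
  have "0 < \<theta>" using dbl by (simp add: \<theta>_def)
  then have "0 < c" unfolding c_def by (rule step_constant_pos[OF dbl(2) dg(2) ab(1) \<beta>])
  then have "0 < \<eta>" by (simp add: \<eta>_def)
  then have \<Lambda>: "1 \<le> \<Lambda>" "2 \<le> \<Lambda> * \<eta>" by (auto simp: \<Lambda>_def max_def field_simps)
  have mR: "0 < measure \<mu> (mball y R)" by (rule measure_mball_pos[OF dbl(1) yX R(1)])
  have u: "u \<in> borel_measurable (restrict_space \<mu> \<Omega>)" using dg(1) by (simp add: de_giorgi_def newtonian_loc_def)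
  have meas: "(\<lambda>x. epowr (excess u R k x) \<kappa> * indicator (mball y R) x) \<in> borel_measurable \<mu>" for \<kappa>
    by (rule measurable_excess[OF \<Omega>(1) u _ R(3)]) simp
  have ex1: "(\<lambda>x. excess u R k x * indicator (mball y R) x) \<in> borel_measurable \<mu>"
    unfolding excess_def
    by (rule measurable_superlevel(3)[OF \<Omega>(1) u _ R(3), where f="\<lambda>v. ennreal (1 / R) * e2ennreal (v - ereal k)"]) measurable
  have "ennreal (R powr q) * (\<integral>\<^sup>+x\<in>mball y R. epowr (excess u R k x) q \<partial>\<mu>) = ennreal (M powr q * measure \<mu> (mball y R))"
    unfolding M(2)[symmetric] epowr_e2ennreal_eq_excess[OF R(1)] mult.assoc by (rule nn_integral_cmult[OF meas, symmetric])
  then have "ennreal (1 / R powr q) * (ennreal (R powr q) * (\<integral>\<^sup>+x\<in>mball y R. epowr (excess u R k x) q \<partial>\<mu>)) = ennreal (1 / R powr q) * ennreal (M powr q * measure \<mu> (mball y R))"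
    by simp
  then have Iq: "(\<integral>\<^sup>+x\<in>mball y R. epowr (excess u R k x) q \<partial>\<mu>) = ennreal ((M / R) powr q * measure \<mu> (mball y R))"
    using R(1) M(1) by (simp add: mult.assoc[symmetric] ennreal_mult[symmetric] powr_divide)
  show ?thesis
  \<comment> \<open>The iteration starts from a positive height. For \<open>M = 0\<close> the excess
    itself vanishes almost everywhere.\<close>
  proof (cases "M = 0")
    case True
    then have "AE x in \<mu>. epowr (excess u R k x) q * indicator (mball y R) x = 0"
      using Iq by (simp add: nn_integral_0_iff_AE[OF meas])
    then show ?thesis
    proof eventually_elim
      case (elim z)
      show ?case
      proof (intro impI leI notI)
        assume z: "z \<in> mball y (R / 2)" and gt: "ereal (k + \<Lambda> * M) < u z"
        obtain w where w: "ereal k < ereal w" "ereal w \<le> u z" using ereal_dense2[OF gt] True by (auto intro: less_imp_le)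
        then have "ennreal ((w - k) / R) \<le> excess u R k z" using R(1) by (intro excess_ge) auto
        then have "epowr (ennreal ((w - k) / R)) q \<le> epowr (excess u R k z) q"
          using pq by (intro epowr_mono) auto
        moreover have "0 < (w - k) / R" using w R(1) by simp
        moreover have "epowr (excess u R k z) q = 0"
          using elim z mball_subset_concentric[of "R / 2" R y] R(1) by (auto simp: indicator_def split: if_splits)
        moreover have "R \<noteq> 0" "w \<noteq> k" using w R(1) by auto
        ultimately show False by simp
      qed
    qed
  next
    case False
    then have M0: "0 < M / R" using M(1) R(1) by simp
    have Ip: "(\<integral>\<^sup>+x\<in>mball y R. epowr (excess u R k x) p \<partial>\<mu>) \<le> ennreal (2 * ((M / R) powr q) powr (p / q) * measure \<mu> (mball y R))"
      by (rule nn_integral_epowr_Hoelder[OF _ _ _ emeasure_mball[OF dbl(1) yX] mR ex1]) (use pq Iq in auto)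
    have "phase_integral p q u y R k R \<le> ennreal (2 * (M / R) powr p * measure \<mu> (mball y R)) + ennreal (2 * (M / R) powr q * measure \<mu> (mball y R))"
      unfolding phase_integral_eq[OF \<Omega>(1) u R(3)] Iq
      by (intro add_mono order_trans[OF Ip] ennreal_leI) (use pq in \<open>auto simp: powr_powr\<close>)
    also have "\<dots> = ennreal (2 * double_phase_real p q (M / R) * measure \<mu> (mball y R))"
      by (simp add: ennreal_plus[symmetric] double_phase_real_def algebra_simps del: ennreal_plus)
    also have "\<dots> \<le> ennreal (double_phase_real p q (\<Lambda> * M / R) * measure \<mu> (mball y R) * \<eta>)"
    proof (rule ennreal_leI)
      have \<phi>: "0 < double_phase_real p q (M / R)" by (rule double_phase_real_pos[OF M0])
      have \<eta>: "0 \<le> \<eta>" by (simp add: \<eta>_def)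
      have "\<Lambda> powr 1 \<le> \<Lambda> powr p" using \<Lambda>(1) pq by (intro powr_mono) auto
      then have "\<Lambda> * double_phase_real p q (M / R) \<le> \<Lambda> powr p * double_phase_real p q (M / R)"
        using \<Lambda>(1) \<phi> by (intro mult_right_mono) auto
      also have "\<dots> \<le> double_phase_real p q (\<Lambda> * (M / R))"
        by (rule double_phase_real_scale) (use M0 pq \<Lambda> in auto)
      finally have "\<Lambda> * double_phase_real p q (M / R) * \<eta> \<le> double_phase_real p q (\<Lambda> * M / R) * \<eta>"
        using \<eta> by (intro mult_right_mono) auto
      moreover have "2 * double_phase_real p q (M / R) \<le> \<Lambda> * \<eta> * double_phase_real p q (M / R)"
        using \<Lambda>(2) \<phi> by (intro mult_right_mono) auto
      ultimately have "2 * double_phase_real p q (M / R) \<le> double_phase_real p q (\<Lambda> * M / R) * \<eta>" by (simp add: mult_ac)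
      then have "2 * double_phase_real p q (M / R) * measure \<mu> (mball y R) \<le> double_phase_real p q (\<Lambda> * M / R) * \<eta> * measure \<mu> (mball y R)"
        by (rule mult_right_mono) simp
      then show "2 * double_phase_real p q (M / R) * measure \<mu> (mball y R) \<le> double_phase_real p q (\<Lambda> * M / R) * measure \<mu> (mball y R) * \<eta>"
        by (simp add: mult_ac)
    qed
    finally have bound: "phase_integral p q u y R k R \<le> ennreal (double_phase_real p q (\<Lambda> * M / R) * measure \<mu> (mball y R) * \<eta>)" .
    have "0 < \<Lambda> * M" using \<Lambda>(1) False M(1) by simp
    from AE_le_of_phase_integral[OF pq PI dbl n \<Omega> R ab dg \<theta>_def c_def \<eta>_def this bound] show ?thesis .
  qed
qed

text \<open>Enlarging \<open>Cd\<close> to \<open>D\<close> keeps the doubling property and makes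
  \<theta> positive and at most 1. An infinite mean makes the claim trivial; a finite one is a real
  number \<open>M\<close>, to which the iteration applies.\<close>

lemma esssup_le_mean_excess:
  assumes pq: "1 \<le> p" "p < q" and n: "4 * l + 2 \<le> 2 ^ n"
    and standing: "standing p q s Q Cd C l \<alpha> \<beta> a b \<Omega>" and \<alpha>: "0 < \<alpha>"
    and dg: "de_giorgi p q a b \<Omega> C\<^sub>D\<^sub>G u" "0 < C\<^sub>D\<^sub>G"
    and y: "y \<in> \<Omega>" and R: "mball y R \<subseteq> \<Omega>" "0 < R" "R \<le> half_dist \<Omega> y"
    and D_def: "D = max Cd 2" and \<theta>_def: "\<theta> = ln 2 / ln D"
    and c_def: "c = 4 powr q * (3 * D ^ n * (256 * D * max 1 C) powr q * 2 powr q * (C\<^sub>D\<^sub>G * \<beta> / \<alpha> + 1)) / (1 - 2 powr - \<theta>)"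
    and \<eta>_def: "\<eta> = (c * 12 powr q * (4 powr q) powr \<theta> * (2 powr (q + q * \<theta>)) powr (1 / \<theta>)) powr (- 1 / \<theta>)"
    and \<Lambda>_def: "\<Lambda> = max 1 (2 / \<eta>)"
  shows "esssup (restrict_space \<mu> (mball y (R / 2))) u \<le> ereal k + enn2ereal (ennreal \<Lambda> * mean_excess q u k (mball y R))"
proof -
  have PI: "weak_poincare q p C l" and \<Omega>: "openin mtopology \<Omega>"
    and ab: "\<And>x. x \<in> X \<Longrightarrow> \<alpha> \<le> a x \<and> a x \<le> \<beta> \<and> \<alpha> \<le> b x \<and> b x \<le> \<beta>" and "doubling Cd"
    using standing by (auto simp: standing_def)
  then have dbl: "doubling D" "2 \<le> D" using doubling_mono[of Cd D] by (auto simp: D_def)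
  have yX: "y \<in> X" using y open_subset[OF \<Omega>] by blast
  define m where "m = measure \<mu> (mball y R)"
  have m: "0 < m" "emeasure \<mu> (mball y R) = ennreal m"
    unfolding m_def using measure_mball_pos[OF dbl(1) yX R(2)] emeasure_mball[OF dbl(1) yX] by auto
  have \<Lambda>: "1 \<le> \<Lambda>" by (simp add: \<Lambda>_def)
  define I where "I = (\<integral>\<^sup>+x\<in>mball y R. epowr (e2ennreal (u x - ereal k)) q \<partial>\<mu>)"
  have mean: "mean_excess q u k (mball y R) = epowr (I / ennreal m) (1 / q)" by (simp add: mean_excess_def I_def m(2))
  show ?thesis
  proof (cases I)
    case top
    then have "ennreal \<Lambda> * mean_excess q u k (mball y R) = top"
      using \<Lambda> by (simp add: mean ennreal_top_divide ennreal_mult_top)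
    then show ?thesis by simp
  next
    case (real i)
    define M where "M = (i / m) powr (1 / q)"
    have M: "0 \<le> M" "I = ennreal (M powr q * m)"
      using real m pq by (auto simp: M_def powr_powr)
    have mean_M: "mean_excess q u k (mball y R) = ennreal M"
      using real m by (simp add: mean M_def divide_ennreal)
    have "AE x in \<mu>. x \<in> mball y (R / 2) \<longrightarrow> u x \<le> ereal (k + \<Lambda> * M)"
      by (rule AE_le_of_mean[OF pq PI dbl n \<Omega> y R(2,3,1) \<alpha> ab dg \<theta>_def c_def \<eta>_def \<Lambda>_def M(1) M(2)[unfolded I_def m_def]])
    then have AE: "AE x in restrict_space \<mu> (mball y (R / 2)). u x \<le> ereal (k + \<Lambda> * M)"
      by (subst AE_restrict_space_iff) (use sets.sets_into_space[OF mball_measurable] in \<open>auto simp: inf_absorb1\<close>)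
    have "u \<in> borel_measurable (restrict_space \<mu> \<Omega>)" using dg(1) by (simp add: de_giorgi_def newtonian_loc_def)
    moreover have "mball y (R / 2) \<subseteq> \<Omega>" using R mball_subset_concentric[of "R / 2" R y] by auto
    ultimately have "u \<in> borel_measurable (restrict_space \<mu> (mball y (R / 2)))" by (rule measurable_restrict_mono)
    then have "esssup (restrict_space \<mu> (mball y (R / 2))) u \<le> ereal (k + \<Lambda> * M)" using AE by (rule esssup_I)
    also have "\<dots> = ereal k + enn2ereal (ennreal \<Lambda> * mean_excess q u k (mball y R))"
      using \<Lambda> M(1) by (simp add: mean_M ennreal_mult[symmetric] enn2ereal_ennreal)
    finally show ?thesis .
  qed
qed

end

theorem theorem4p5:
  fixes p q s Q Cd C\<^sub>P\<^sub>I l \<alpha> \<beta> C\<^sub>D\<^sub>G :: real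
  assumes "1 < s" "s < p" "p < q" "p < Q" "q < Q * p / (Q - p)"
    and "0 < \<alpha>" and "0 < C\<^sub>D\<^sub>G"
  shows "\<exists>C>0. \<forall>(X :: 'a set) d \<mu> a b \<Omega> u y R k\<^sub>0.
    borel_regular_space X d \<mu> \<longrightarrow>
    borel_regular_space.standing X d \<mu> p q s Q Cd C\<^sub>P\<^sub>I l \<alpha> \<beta> a b \<Omega> \<longrightarrow>
    borel_regular_space.de_giorgi X d \<mu> p q a b \<Omega> C\<^sub>D\<^sub>G u \<longrightarrow>
    y \<in> \<Omega> \<longrightarrow> Metric_space.mball X d y R \<subseteq> \<Omega> \<longrightarrow>
    0 < R \<longrightarrow> R \<le> Metric_space.half_dist X d \<Omega> y \<longrightarrow>
    esssup (restrict_space \<mu> (Metric_space.mball X d y (R / 2))) u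
      \<le> ereal k\<^sub>0 + enn2ereal (ennreal C *
          borel_regular_space.mean_excess \<mu> q u k\<^sub>0 (Metric_space.mball X d y R))"
proof -
  \<comment> \<open>All constants are built from the numerical parameters before the space, the ball
    and \<open>u\<close> are introduced, which gives the independence claimed. Here \<open>n\<close>
    counts the doublings in the packing bound for balls enlarged by \<open>l\<close>.\<close>
  obtain n where "4 * l + 2 < 2 ^ n" using real_arch_pow[of 2 "4 * l + 2"] by auto
  then have n: "4 * l + 2 \<le> 2 ^ n" by simp
  define D where "D = max Cd 2"
  define \<theta> where "\<theta> = ln 2 / ln D"
  define c where "c = 4 powr q * (3 * D ^ n * (256 * D * max 1 C\<^sub>P\<^sub>I) powr q * 2 powr q * (C\<^sub>D\<^sub>G * \<beta> / \<alpha> + 1)) / (1 - 2 powr - \<theta>)"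
  define \<eta> where "\<eta> = (c * 12 powr q * (4 powr q) powr \<theta> * (2 powr (q + q * \<theta>)) powr (1 / \<theta>)) powr (- 1 / \<theta>)"
  define \<Lambda> where "\<Lambda> = max 1 (2 / \<eta>)"
  have p: "1 \<le> p" using assms by simp
  show ?thesis
  proof (intro exI[of _ \<Lambda>] conjI allI impI)
    show "0 < \<Lambda>" by (simp add: \<Lambda>_def)
  qed (rule borel_regular_space.esssup_le_mean_excess[OF _ p \<open>p < q\<close> n _ \<open>0 < \<alpha>\<close> _ \<open>0 < C\<^sub>D\<^sub>G\<close> _ _ _ _ D_def \<theta>_def c_def \<eta>_def \<Lambda>_def])
qed

end
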